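(* Let $f\in W^{3,1}([0,T],X)$, $u_0=0$, and $f(0)=f'(0)=f''(0)=0$. Let $F\colon \mathsf{D}(F)\subset\mathcal{L}^*(X)\to\mathcal{C}([0,T],X)$, $B\mapsto u$, be the parameter-to-solution map of the evolution equation $$Bu'(t)+Au(t)+BQu(t)=f(t),\quad t\in\,]0,T[,\qquad u(0)=u_0 .$$ Then $F$ is twice Fréchet differentiable at every $B\in\operatorname{int}(\mathsf{D}(F))$ with $F''(B)[H_1,H_2]=\overline{\overline{u}}$ for $H_1,H_2\in\mathcal{L}^*(X)$, where $\overline{\overline{u}}\in\mathcal{C}([0,T],X)$ is the mild (in fact the classical) solution of $$B\overline{\overline{u}}\,'(t)+(A+BQ)\overline{\overline{u}}(t)=-H_1\big(u_2'(t)+Qu_2(t)\big)-H_2\big(u_1'(t)+Qu_1(t)\big),\qquad \overline{\overline{u}}(0)=0 .$$ Here $u_i\in\mathcal{C}^2([0,T],X)\cap\mathcal{C}^1([0,T],\mathsf{D}(A))$, $i=1,2$, is the classical solution of $$Bu_i'(t)+(A+BQ)u_i(t)=-H_i\big(u'(t)+Qu(t)\big),\qquad u_i(0)=0,$$ and $u=F(B)\in\mathcal{C}^3([0,T],X)\cap\mathcal{C}^2([0,T],\mathsf{D}(A))$ solves the evolution equation $Bu'+Au+BQu=f$, $u(0)=0$.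
   Context: $X$ is a Hilbert space, $T>0$, $\mathcal{L}(X)$ is the space of bounded linear operators on $X$ and $\mathcal{L}^*(X)=\{J\in\mathcal{L}(X): J^*=J\}$ is the Banach space of bounded self-adjoint operators (with the operator norm). $A\colon\mathsf{D}(A)\subset X\to X$ is a (linear) maximal monotone operator: $\langle Ax,x\rangle_X\ge 0$ for all $x\in\mathsf{D}(A)$ and $I+A\colon\mathsf{D}(A)\to X$ is onto; $\mathsf{D}(A)$ carries the graph norm. $Q\in\mathcal{L}(X)$. For fixed $0<\beta_-<\beta_+<\infty$, $$\mathsf{D}(F)=\{B\in\mathcal{L}^*(X): \beta_-\|x\|_X^2\le\langle Bx,x\rangle_X\le\beta_+\|x\|_X^2\ \text{for all } x\in X\}.$$ For $B\in\mathsf{D}(F)$, $h\in L^1([0,T],X)$, $z_0\in X$, the mild solution of $Bz'(t)+Az(t)+BQz(t)=h(t)$, $z(0)=z_0$, is $z(t)=S(t)z_0+\int_0^tS(t-s)B^{-1}h(s)\,ds$, where $\{S(t)\}_{t\ge0}$ is the $C_0$-semigroup on $X$ generated by $-(B^{-1}A+Q)$ (with domain $\mathsf{D}(A)$). A classical solution is one in $\mathcal{C}^1([0,T],X)\cap\mathcal{C}([0,T],\mathsf{D}(A))$. With $f$ and $u_0$ fixed, $F(B)$ is the mild solution $u$ of $Bu'+Au+BQu=f$, $u(0)=u_0$. $\operatorname{int}$ denotes the interior in $\mathcal{L}^*(X)$. *)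

theory Defs
  imports "HOL-Analysis.Analysis"
begin

section \<open>The space of bounded self-adjoint operators\<close>

text \<open>The type \<open>'a sa_op\<close> is the space of the \<open>J\<close> with \<open>J\<^sup>* = J\<close>; the condition below says that \<open>J\<close>
  itself has the defining property of the Hilbert space adjoint of \<open>J\<close> (cf. \<open>adjoint_unique\<close>).\<close>

typedef (overloaded) ('a::real_inner) sa_op =
  "{J :: 'a \<Rightarrow>\<^sub>L 'a. \<forall>x y. inner (blinfun_apply J x) y = inner x (blinfun_apply J y)}"
  morphisms blinfun_of Sa_op
  by (rule exI[of _ 0]) simp

setup_lifting type_definition_sa_op

instantiation sa_op :: (real_inner) real_normed_vector
begin

lift_definition zero_sa_op :: "'a sa_op" is 0 by simp

lift_definition plus_sa_op :: "'a sa_op \<Rightarrow> 'a sa_op \<Rightarrow> 'a sa_op" is "(+)"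
  by (simp add: blinfun.add_left inner_add_left inner_add_right)

lift_definition minus_sa_op :: "'a sa_op \<Rightarrow> 'a sa_op \<Rightarrow> 'a sa_op" is "(-)"
  by (simp add: blinfun.diff_left inner_diff_left inner_diff_right)

lift_definition uminus_sa_op :: "'a sa_op \<Rightarrow> 'a sa_op" is uminus
  by (simp add: blinfun.minus_left)

lift_definition scaleR_sa_op :: "real \<Rightarrow> 'a sa_op \<Rightarrow> 'a sa_op" is "(*\<^sub>R)"
  by (simp add: blinfun.scaleR_left)

lift_definition norm_sa_op :: "'a sa_op \<Rightarrow> real" is norm .

definition dist_sa_op :: "'a sa_op \<Rightarrow> 'a sa_op \<Rightarrow> real"
  where "dist_sa_op J K = norm (J - K)"

definition sgn_sa_op :: "'a sa_op \<Rightarrow> 'a sa_op"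
  where "sgn_sa_op J = scaleR (inverse (norm J)) J"

definition uniformity_sa_op :: "('a sa_op \<times> 'a sa_op) filter"
  where [code del]: "uniformity_sa_op = (INF e\<in>{0<..}. principal {(x, y). dist x y < e})"

definition open_sa_op :: "'a sa_op set \<Rightarrow> bool"
  where [code del]:
    "open_sa_op U = (\<forall>x\<in>U. eventually (\<lambda>(x', y). x' = x \<longrightarrow> y \<in> U) uniformity)"

instance
proof
  fix J K L :: "'a sa_op" and a b :: real
  show "J + K + L = J + (K + L)" by transfer (simp add: add.assoc)
  show "J + K = K + J" by transfer (simp add: add.commute)
  show "0 + J = J" by transfer simp
  show "- J + J = 0" by transfer simp
  show "J - K = J + - K" by transfer simp
  show "a *\<^sub>R (J + K) = a *\<^sub>R J + a *\<^sub>R K" by transfer (simp add: scaleR_add_right)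
  show "(a + b) *\<^sub>R J = a *\<^sub>R J + b *\<^sub>R J" by transfer (simp add: scaleR_add_left)
  show "a *\<^sub>R b *\<^sub>R J = (a * b) *\<^sub>R J" by transfer simp
  show "1 *\<^sub>R J = J" by transfer simp
  show "norm J = 0 \<longleftrightarrow> J = 0" by transfer simp
  show "norm (J + K) \<le> norm J + norm K" by transfer (rule norm_triangle_ineq)
  show "norm (a *\<^sub>R J) = \<bar>a\<bar> * norm J" by transfer simp
qed (simp_all add: dist_sa_op_def sgn_sa_op_def uniformity_sa_op_def open_sa_op_def)

end

definition param_domain :: "real \<Rightarrow> real \<Rightarrow> ('a::real_inner) sa_op set" where
  "param_domain bmin bmax =
     {B. \<forall>x. bmin * (norm x)\<^sup>2 \<le> inner (blinfun_of B x) x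
            \<and> inner (blinfun_of B x) x \<le> bmax * (norm x)\<^sup>2}"


section \<open>Unbounded operators and semigroups\<close>

text \<open>An unbounded operator is a pair of a domain \<open>D\<close> and a total function \<open>A\<close> whose values
  outside \<open>D\<close> are irrelevant.\<close>

definition maximal_monotone :: "('a::real_inner) set \<Rightarrow> ('a \<Rightarrow> 'a) \<Rightarrow> bool" where
  "maximal_monotone D A \<longleftrightarrow>
     subspace D
     \<and> (\<forall>x\<in>D. \<forall>y\<in>D. A (x + y) = A x + A y)
     \<and> (\<forall>c. \<forall>x\<in>D. A (c *\<^sub>R x) = c *\<^sub>R A x)
     \<and> (\<forall>x\<in>D. 0 \<le> inner (A x) x)
     \<and> (\<forall>y. \<exists>x\<in>D. x + A x = y)"

definition C0_semigroup :: "(real \<Rightarrow> ('a::real_normed_vector \<Rightarrow>\<^sub>L 'a)) \<Rightarrow> bool" where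
  "C0_semigroup S \<longleftrightarrow>
     S 0 = id_blinfun
     \<and> (\<forall>s\<ge>0. \<forall>t\<ge>0. S (s + t) = S s o\<^sub>L S t)
     \<and> (\<forall>x. ((\<lambda>t. S t x) \<longlongrightarrow> x) (at_right 0))"

text \<open>The limit defining the generator exists exactly on \<open>D\<close> and equals \<open>G x\<close> there. Values of \<open>S\<close>
  at negative times are irrelevant.\<close>

definition generates ::
    "('a::real_normed_vector) set \<Rightarrow> ('a \<Rightarrow> 'a) \<Rightarrow> (real \<Rightarrow> ('a \<Rightarrow>\<^sub>L 'a)) \<Rightarrow> bool" where
  "generates D G S \<longleftrightarrow>
     C0_semigroup S
     \<and> (\<forall>x y. ((\<lambda>h. (S h x - x) /\<^sub>R h) \<longlongrightarrow> y) (at_right 0) \<longleftrightarrow> x \<in> D \<and> y = G x)"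


section \<open>Function spaces on a compact interval\<close>

text \<open>Functions on \<open>[0,T]\<close> are total functions on the reals of which only the restriction to \<open>[0,T]\<close>
  matters; \<open>deriv_on T z\<close> is \<open>z'\<close>, one-sided at the end points.\<close>

definition deriv_on :: "real \<Rightarrow> (real \<Rightarrow> 'a::real_normed_vector) \<Rightarrow> real \<Rightarrow> 'a" where
  "deriv_on T z t = vector_derivative z (at t within {0..T})"

primrec C_k :: "nat \<Rightarrow> real \<Rightarrow> (real \<Rightarrow> 'a::real_normed_vector) \<Rightarrow> bool" where
  "C_k 0 T z \<longleftrightarrow> continuous_on {0..T} z"
| "C_k (Suc k) T z \<longleftrightarrow> z differentiable_on {0..T} \<and> C_k k T (deriv_on T z)"

text \<open>\<open>C_k_graph k D A T\<close> is the space of \<open>k\<close> times continuously differentiable functions into the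
  domain \<open>D\<close> with the graph norm of \<open>A\<close>: the graph norm topology is the one induced
  by the embedding of \<open>D\<close> into the product space that maps \<open>x\<close> to \<open>(x, A x)\<close>.\<close>

primrec C_k_graph ::
    "nat \<Rightarrow> ('a::real_normed_vector) set \<Rightarrow> ('a \<Rightarrow> 'a) \<Rightarrow> real \<Rightarrow> (real \<Rightarrow> 'a) \<Rightarrow> bool" where
  "C_k_graph 0 D A T z \<longleftrightarrow>
     (\<forall>t\<in>{0..T}. z t \<in> D) \<and> continuous_on {0..T} (\<lambda>t. (z t, A (z t)))"
| "C_k_graph (Suc k) D A T z \<longleftrightarrow>
     (\<forall>t\<in>{0..T}. z t \<in> D)
     \<and> (\<forall>t\<in>{0..T}. ((\<lambda>s. (z s, A (z s))) has_vector_derivative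
           (deriv_on T z t, A (deriv_on T z t))) (at t within {0..T}))
     \<and> C_k_graph k D A T (deriv_on T z)"

text \<open>Bochner integrability, as in \<open>has_bochner_integral\<close>, but without the restriction to
  second countable range types (the Hilbert space need not be separable). All simple functions
  qualify as approximants because the measure is finite.\<close>

definition L1_on :: "real \<Rightarrow> (real \<Rightarrow> 'a::real_normed_vector) \<Rightarrow> bool" where
  "L1_on T h \<longleftrightarrow>
     h \<in> borel_measurable (lebesgue_on {0..T})
     \<and> (\<exists>s. (\<forall>i. simple_function (lebesgue_on {0..T}) (s i))
          \<and> (\<lambda>i::nat. \<integral>\<^sup>+x. ennreal (norm (h x - s i x)) \<partial>lebesgue_on {0..T}) \<longlonglongrightarrow> 0)"

text \<open>The Sobolev space \<open>W\<^sup>k\<^sup>,\<^sup>1([0,T],X)\<close>, for the absolutely continuous representatives. The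
  integral is the gauge integral of the library, which is available for all range spaces
  and agrees with the Bochner integral for Bochner integrable functions.\<close>

primrec W_k1 :: "nat \<Rightarrow> real \<Rightarrow> (real \<Rightarrow> 'a::real_normed_vector) \<Rightarrow> bool" where
  "W_k1 0 T f \<longleftrightarrow> L1_on T f"
| "W_k1 (Suc k) T f \<longleftrightarrow>
     (\<exists>g. W_k1 k T g \<and> (\<forall>t\<in>{0..T}. (g has_integral (f t - f 0)) {0..t}))"

text \<open>The Banach space \<open>C([0,T],X)\<close>, isometrically embedded into the bounded continuous functions on
  the reals by constant extension beyond both end points.\<close>

definition C_interval :: "real \<Rightarrow> (real \<Rightarrow>\<^sub>C 'a::real_normed_vector) set" where
  "C_interval T = {u. \<forall>t. apply_bcontfun u t = apply_bcontfun u (clamp 0 T t)}"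


section \<open>The evolution equation\<close>

text \<open>Solutions of \<open>B z' + A z + B Q z = h\<close>, \<open>z 0 = z0\<close> on \<open>[0,T]\<close>.\<close>

definition mild_solution ::
    "('a::{real_inner,banach}) set \<Rightarrow> ('a \<Rightarrow> 'a) \<Rightarrow> ('a \<Rightarrow>\<^sub>L 'a) \<Rightarrow> real \<Rightarrow> 'a sa_op
      \<Rightarrow> (real \<Rightarrow> 'a) \<Rightarrow> 'a \<Rightarrow> (real \<Rightarrow> 'a) \<Rightarrow> bool" where
  "mild_solution D A Q T B h z0 z \<longleftrightarrow>
     L1_on T h
     \<and> (\<exists>S. generates D (\<lambda>x. - (inv (blinfun_of B) (A x) + Q x)) S
          \<and> (\<forall>t\<in>{0..T}. z t = S t z0
                + integral {0..t} (\<lambda>s. S (t - s) (inv (blinfun_of B) (h s)))))"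

definition classical_solution ::
    "('a::{real_inner,banach}) set \<Rightarrow> ('a \<Rightarrow> 'a) \<Rightarrow> ('a \<Rightarrow>\<^sub>L 'a) \<Rightarrow> real \<Rightarrow> 'a sa_op
      \<Rightarrow> (real \<Rightarrow> 'a) \<Rightarrow> 'a \<Rightarrow> (real \<Rightarrow> 'a) \<Rightarrow> bool" where
  "classical_solution D A Q T B h z0 z \<longleftrightarrow>
     C_k 1 T z \<and> C_k_graph 0 D A T z \<and> z 0 = z0
     \<and> (\<forall>t\<in>{0..T}. blinfun_of B (deriv_on T z t) + A (z t) + blinfun_of B (Q (z t)) = h t)"

definition param_to_solution ::
    "('a::{real_inner,banach}) set \<Rightarrow> ('a \<Rightarrow> 'a) \<Rightarrow> ('a \<Rightarrow>\<^sub>L 'a) \<Rightarrow> real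
      \<Rightarrow> (real \<Rightarrow> 'a) \<Rightarrow> 'a \<Rightarrow> 'a sa_op \<Rightarrow> (real \<Rightarrow>\<^sub>C 'a)" where
  "param_to_solution D A Q T f u0 B =
     (THE u. u \<in> C_interval T \<and> mild_solution D A Q T B f u0 (apply_bcontfun u))"


section \<open>Second Frechet derivatives\<close>

text \<open>\<open>F2\<close> is the derivative at \<open>x\<close> of the derivative of \<open>F\<close> (which exists near \<open>x\<close>), so
  \<open>F''(x)[h1,h2]\<close> is \<open>F2 h1 h2\<close>.\<close>

definition has_second_derivative ::
    "('b::real_normed_vector \<Rightarrow> 'c::real_normed_vector) \<Rightarrow> ('b \<Rightarrow>\<^sub>L 'b \<Rightarrow>\<^sub>L 'c) \<Rightarrow> 'b \<Rightarrow> bool" where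
  "has_second_derivative F F2 x \<longleftrightarrow>
     (\<exists>F1 :: 'b \<Rightarrow> 'b \<Rightarrow>\<^sub>L 'c.
        (\<forall>\<^sub>F y in nhds x. (F has_derivative blinfun_apply (F1 y)) (at y))
        \<and> (F1 has_derivative blinfun_apply F2) (at x))"

end

theory Submission
  imports Defs
begin

text \<open>
  The equation is linear in the solution and affine in \<open>B\<close>, so everything follows from one
  algebraic identity and from bounds for the solution operators that are uniform in \<open>B\<close>.
  Write \<open>sol B h\<close> for the solution \<open>z\<close> of \<open>B z' + A z + B Q z = h\<close>, \<open>z 0 = 0\<close>, and
  \<open>velocity B h = z' + Q z\<close>. The parameter enters the equation only through \<open>B\<close> times the velocity,
  hence the solution for the parameter \<open>B'\<close> solves the equation for \<open>B\<close> with the right-hand side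
  \<open>h - (B' - B) (velocity B' h)\<close>. This is \<open>sol_change\<close>, the counterpart of the resolvent
  identity. Iterating it twice gives the Taylor expansion of \<open>B \<mapsto> sol B f\<close>, with remainders in which
  \<open>B' - B\<close> occurs twice (\<open>first_remainder\<close>, \<open>second_remainder\<close>).

  Each application of \<open>velocity\<close> costs one derivative. The remainder of the second order contains
  three velocities, which is why \<open>f\<close> must have three derivatives and why its initial values must
  vanish: the functions that vanish for \<open>t \<le> 0\<close> together with their derivatives form a scale of
  spaces (\<open>causal\<close>) in which \<open>sol B\<close> preserves the order of smoothness and \<open>velocity B\<close>
  lowers it by one. The constants depend on \<open>B\<close> only through the bounds \<open>bmin\<close>, \<open>bmax\<close>, because they
  all come from the energy \<open>\<langle>B z, z\<rangle>\<close>, in which \<open>- (B\<inverse> A + Q)\<close> is dissipative up to a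
  shift. The last derivative of \<open>f\<close> is only integrable. There the estimate by the \<open>L\<^sup>1\<close> norm of
  \<open>h\<close> takes over, after an approximation of the third derivative by continuous functions (\<open>causal_sol_W1\<close>).

  The solutions are given by the semigroup generated by \<open>- (B\<inverse> A + Q)\<close>, which has to be constructed.
  Surjectivity of \<open>I + A\<close> passes to \<open>P + A\<close> for every bounded coercive \<open>P\<close>
  (\<open>coercive_plus_maximal_monotone_onto\<close>), so the resolvent exists. Its Yosida approximations generate
  uniformly bounded flows of ordinary differential equations, and these converge to the semigroup
  (\<open>generates_propagator\<close>). The mild solution is well defined because a semigroup is determined by its
  generator (\<open>generates_unique\<close>): its orbits starting in the domain are differentiable, and
  differences of such orbits have no energy.
\<close>

section \<open>Uniform boundedness\<close>

text \<open>Baire's theorem: the whole space is the union of the closed sets on which all \<open>L n\<close> are bounded by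
  a fixed integer, so one of these sets contains a ball.\<close>

lemma uniform_boundedness:
  fixes L :: "nat \<Rightarrow> 'a::banach \<Rightarrow>\<^sub>L 'b::real_normed_vector"
  assumes pt: "\<And>x. bounded (range (\<lambda>n. L n x))"
  shows "bounded (range L)"
proof -
  define C where "C m = {x. \<forall>n. norm (L n x) \<le> real m}" for m :: nat
  have C_eq: "C m = (\<Inter>n. {x. norm (L n x) \<le> real m})" for m
    by (auto simp: C_def)
  have closed: "closed (C m)" for m
    unfolding C_eq by (intro closed_INT ballI closed_Collect_le continuous_intros)
  have cover: "(\<Union>m. C m) = UNIV"
  proof -
    have "\<exists>m. x \<in> C m" for x
    proof -
      obtain K where "\<forall>n. norm (L n x) \<le> K"
        using pt[of x] by (auto simp: bounded_iff)
      moreover obtain m where "K \<le> real m"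
        using real_arch_simple by blast
      ultimately show ?thesis
        unfolding C_def by (auto intro: order_trans)
    qed
    then show ?thesis by auto
  qed
  have "\<exists>m. interior (C m) \<noteq> {}"
  proof (rule ccontr)
    assume "\<not> ?thesis"
    then have "Met_TC.mtopology interior_of \<Union>(range C) = ({}::'a set)"
      using closed by (intro Met_TC.metric_Baire_category_alt)
        (auto simp: mcomplete_iff_complete complete_UNIV)
    then show False
      using cover by simp
  qed
  then obtain m x0 where "x0 \<in> interior (C m)" by blast
  then obtain r where r: "0 < r" "cball x0 r \<subseteq> C m"
    by (meson interior_subset mem_interior_cball subset_trans)
  have "norm (L n) \<le> 2 * real m / r" for n
  proof (rule norm_blinfun_bound)
    show "0 \<le> 2 * real m / r" using r by simp
    fix x
    show "norm (L n x) \<le> 2 * real m / r * norm x"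
    proof (cases "x = 0")
      case False
      define y where "y = (r / norm x) *\<^sub>R x"
      have "x0 + y \<in> C m" "x0 \<in> C m"
        using r False by (auto simp: y_def dist_norm intro!: subsetD[OF r(2)])
      then have "norm (L n (x0 + y)) \<le> real m" "norm (L n x0) \<le> real m"
        by (auto simp: C_def)
      moreover have "L n y = L n (x0 + y) - L n x0"
        by (simp add: blinfun.add_right)
      ultimately have "norm (L n y) \<le> 2 * real m"
        using norm_triangle_ineq4[of "L n (x0 + y)" "L n x0"] by (metis add_mono mult_2 order_trans)
      then have "r / norm x * norm (L n x) \<le> 2 * real m"
        using r by (simp add: y_def blinfun.scaleR_right)
      then show ?thesis
        using r False by (simp add: field_simps)
    qed (simp add: blinfun.zero_right)
  qed
  then show ?thesis
    by (auto simp: bounded_iff)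
qed

section \<open>Maximal monotone operators\<close>

text \<open>Coercivity and monotonicity make \<open>(P + A)\<inverse>\<close> Lipschitz with constant \<open>1/c\<close>, so \<open>x \<mapsto> (P + A)\<inverse> (y - R x)\<close> is a contraction
  as long as the norm of \<open>R\<close> is smaller than \<open>c\<close>.\<close>

lemma coercive_perturbation_onto:
  fixes D :: "'a::{real_inner,banach} set"
  assumes A: "maximal_monotone D A" and c: "0 < c"
    and P: "\<And>x. c * (norm x)\<^sup>2 \<le> inner (P x) x"
    and onto: "\<And>y. \<exists>x\<in>D. P x + A x = y"
    and R: "norm R < c"
    and P_lin: "bounded_linear P"
  shows "\<exists>x\<in>D. P x + blinfun_apply R x + A x = y"
proof -
  interpret P: bounded_linear P by fact
  have D: "subspace D" and A_add: "\<And>x y. x \<in> D \<Longrightarrow> y \<in> D \<Longrightarrow> A (x + y) = A x + A y"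
    and A_sc: "\<And>c x. x \<in> D \<Longrightarrow> A (c *\<^sub>R x) = c *\<^sub>R A x"
    and A_pos: "\<And>x. x \<in> D \<Longrightarrow> 0 \<le> inner (A x) x"
    using A by (auto simp: maximal_monotone_def)
  obtain g where g: "\<And>y. g y \<in> D" "\<And>y. P (g y) + A (g y) = y"
    using onto by metis
  have lip: "c * norm (g y - g z) \<le> norm (y - z)" for y z
  proof -
    let ?d = "g y - g z"
    have d: "?d \<in> D" using g(1) D by (simp add: subspace_diff)
    have "A ?d = A (g y) - A (g z)"
      using A_add[of "g y" "(-1) *\<^sub>R g z"] A_sc[of "g z" "-1"] g(1) D by (simp add: subspace_neg)
    then have "y - z = P ?d + A ?d"
      using g(2)[of y] g(2)[of z] by (simp add: P.diff) (metis add_diff_add)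
    then have "inner (y - z) ?d = inner (P ?d) ?d + inner (A ?d) ?d"
      by (simp add: inner_add_left)
    then have "c * (norm ?d)\<^sup>2 \<le> inner (y - z) ?d"
      using P[of ?d] A_pos[OF d] by linarith
    also have "\<dots> \<le> norm (y - z) * norm ?d" by (rule norm_cauchy_schwarz)
    finally have "(c * norm ?d) * norm ?d \<le> norm (y - z) * norm ?d"
      by (simp add: power2_eq_square mult.assoc)
    then show ?thesis
      by (cases "norm ?d = 0") (simp, simp add: mult_le_cancel_right)
  qed
  let ?f = "\<lambda>x. g (y - blinfun_apply R x)"
  have "\<exists>!x. ?f x = x"
  proof (rule banach_fix_type)
    show "0 \<le> norm R / c" "norm R / c < 1" using c R by auto
    show "\<forall>x z. dist (?f x) (?f z) \<le> norm R / c * dist x z"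
    proof (intro allI)
      fix x z
      have "c * norm (?f x - ?f z) \<le> norm (blinfun_apply R (z - x))"
        using lip[of "y - R x" "y - R z"] by (simp add: blinfun.diff_right)
      also have "\<dots> \<le> norm R * norm (z - x)" by (rule norm_blinfun)
      finally show "dist (?f x) (?f z) \<le> norm R / c * dist x z"
        using c by (simp add: dist_norm field_simps norm_minus_commute)
    qed
  qed
  then obtain x where x: "g (y - R x) = x" by blast
  then have "x \<in> D" "P x + A x = y - R x" using g by metis+
  then show ?thesis by (intro bexI[of _ x]) (auto simp: algebra_simps)
qed

text \<open>The segment from the identity to \<open>P\<close> consists of operators with the common coercivity constant
  \<open>min 1 c\<close>. Hence finitely many perturbation steps of equal size lead from \<open>I + A\<close> to \<open>P + A\<close>.\<close>

lemma coercive_plus_maximal_monotone_onto: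
  fixes D :: "'a::{real_inner,banach} set"
  assumes A: "maximal_monotone D A" and c: "0 < c"
    and P: "\<And>x. c * (norm x)\<^sup>2 \<le> inner (blinfun_apply P x) x"
  shows "\<exists>x\<in>D. P x + A x = y"
proof -
  define c' where "c' = min 1 c"
  have c': "0 < c'" "c' \<le> 1" "c' \<le> c" using c by (auto simp: c'_def)
  define K where "K = P - id_blinfun"
  obtain n :: nat where n: "norm K / c' < real n"
    using reals_Archimedean2 by blast
  then have n0: "0 < real n" using c' by (smt (verit) divide_nonneg_pos norm_ge_zero)
  define p where "p k = id_blinfun + (real k / real n) *\<^sub>R K" for k
  have coer: "c' * (norm x)\<^sup>2 \<le> inner (p k x) x" if "k \<le> n" for k x
  proof -
    let ?s = "real k / real n"
    have s: "0 \<le> ?s" "?s \<le> 1" using that n0 by auto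
    have "c' * (norm x)\<^sup>2 = (1 - ?s) * (c' * (norm x)\<^sup>2) + ?s * (c' * (norm x)\<^sup>2)"
      by (simp add: algebra_simps)
    also have "\<dots> \<le> (1 - ?s) * (norm x)\<^sup>2 + ?s * inner (P x) x"
    proof (intro add_mono mult_left_mono)
      show "c' * (norm x)\<^sup>2 \<le> (norm x)\<^sup>2" using c' by (simp add: mult_left_le_one_le)
      show "c' * (norm x)\<^sup>2 \<le> inner (P x) x"
        using P[of x] c' by (smt (verit) mult_right_mono zero_le_power2)
    qed (use s in auto)
    also have "\<dots> = inner (p k x) x"
      by (simp add: p_def K_def blinfun.add_left blinfun.diff_left blinfun.scaleR_left
          inner_add_left inner_diff_left algebra_simps power2_norm_eq_inner)
    finally show ?thesis .
  qed
  have "k \<le> n \<Longrightarrow> \<forall>y. \<exists>x\<in>D. p k x + A x = y" for k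
  proof (induction k)
    case 0
    then show ?case using A by (simp add: p_def maximal_monotone_def)
  next
    case (Suc k)
    have "norm ((1 / real n) *\<^sub>R K) < c'"
      using n n0 c' by (simp add: field_simps)
    then have "\<exists>x\<in>D. p k x + ((1 / real n) *\<^sub>R K) x + A x = y" for y
      using coercive_perturbation_onto[OF A c'(1) coer[of k] _ _ blinfun.bounded_linear_right, of "(1 / real n) *\<^sub>R K" y] Suc
      by auto
    moreover have "p k x + ((1 / real n) *\<^sub>R K) x = p (Suc k) x" for x
      by (simp add: p_def blinfun.add_left blinfun.scaleR_left add_divide_distrib scaleR_add_left)
    ultimately show ?case by simp
  qed
  moreover have "p n = P" using n0 by (simp add: p_def K_def)
  ultimately show ?thesis by auto
qed

text \<open>For a given \<open>y\<close> the points \<open>x n = (I + A/n)\<inverse> y\<close> of \<open>D\<close> converge to \<open>y\<close>. Monotonicity makes the norms of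
  the defects \<open>y - x n\<close> decrease and turns this decrease into the Cauchy property. The limit \<open>p\<close>
  of the defects is orthogonal to \<open>D\<close>, and \<open>p = w + A w\<close> tested against \<open>w\<close> gives \<open>p = 0\<close>.\<close>

lemma maximal_monotone_dense:
  fixes D :: "'a::{real_inner,banach} set"
  assumes A: "maximal_monotone D A"
  shows "closure D = UNIV"
proof -
  have D: "subspace D" and A_add: "\<And>x y. x \<in> D \<Longrightarrow> y \<in> D \<Longrightarrow> A (x + y) = A x + A y"
    and A_sc: "\<And>c x. x \<in> D \<Longrightarrow> A (c *\<^sub>R x) = c *\<^sub>R A x"
    and A_pos: "\<And>x. x \<in> D \<Longrightarrow> 0 \<le> inner (A x) x"
    and A_onto: "\<And>y. \<exists>x\<in>D. x + A x = y"
    using A by (auto simp: maximal_monotone_def)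
  have A_diff: "A (x - y) = A x - A y" if "x \<in> D" "y \<in> D" for x y
    using A_add[of x "(-1) *\<^sub>R y"] A_sc[of y "-1"] that D by (simp add: subspace_neg)
  have "y \<in> closure D" for y
  proof -
    have "\<exists>x\<in>D. (real (Suc n) *\<^sub>R id_blinfun) x + A x = real (Suc n) *\<^sub>R y" for n
      by (rule coercive_plus_maximal_monotone_onto[OF A, of "real (Suc n)"])
        (auto simp: blinfun.scaleR_left power2_norm_eq_inner)
    then obtain x where x: "\<And>n. x n \<in> D" "\<And>n. real (Suc n) *\<^sub>R x n + A (x n) = real (Suc n) *\<^sub>R y"
      by (simp add: blinfun.scaleR_left) metis
    define r where "r n = y - x n" for n
    have Ax: "A (x n) = real (Suc n) *\<^sub>R r n" for n
      using x(2)[of n] by (simp add: r_def algebra_simps)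
    (* A (x n) is the multiple (n + 1) of the defect, so this is monotonicity at x n and x m *)
    have mono: "0 \<le> inner (real (Suc n) *\<^sub>R r n - real (Suc m) *\<^sub>R r m) (r m - r n)" for n m
      using A_pos[of "x n - x m"] x(1) D by (simp add: subspace_diff A_diff Ax r_def)
    have key: "(real (Suc n) + real (Suc m)) * (norm (r n - r m))\<^sup>2
        \<le> (real (Suc m) - real (Suc n)) * ((norm (r n))\<^sup>2 - (norm (r m))\<^sup>2)" for n m
      using mono[of n m]
      by (simp add: power2_norm_eq_inner inner_diff_left inner_diff_right inner_commute algebra_simps del: of_nat_Suc)
    have key2: "(norm (r n - r m))\<^sup>2 \<le> (norm (r n))\<^sup>2 - (norm (r m))\<^sup>2" if "n \<le> m" for n m
    proof (cases "n = m")
      case False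
      let ?N = "real (Suc n)" and ?M = "real (Suc m)"
      have NM: "0 < ?M - ?N" "?M - ?N \<le> ?N + ?M" using that False by auto
      have "(?M - ?N) * (norm (r n - r m))\<^sup>2 \<le> (?N + ?M) * (norm (r n - r m))\<^sup>2"
        using NM by (intro mult_right_mono) auto
      also note key[of n m]
      finally show ?thesis using NM(1) by (simp add: mult_le_cancel_left_pos)
    qed auto
    have dec: "decseq (\<lambda>n. (norm (r n))\<^sup>2)"
      unfolding decseq_def using key2 by (smt (verit) zero_le_power2)
    then obtain l where l: "(\<lambda>n. (norm (r n))\<^sup>2) \<longlonglongrightarrow> l"
      using decseq_convergent[OF dec, of 0] by auto
    have "Cauchy r"
    proof (rule CauchyI)
      fix e :: real assume e: "0 < e"
      have "Cauchy (\<lambda>n. (norm (r n))\<^sup>2)" using l by (rule LIMSEQ_imp_Cauchy)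
      then obtain M where M: "\<And>m n. m \<ge> M \<Longrightarrow> n \<ge> M \<Longrightarrow> \<bar>(norm (r m))\<^sup>2 - (norm (r n))\<^sup>2\<bar> < e\<^sup>2"
        using CauchyD[of "\<lambda>n. (norm (r n))\<^sup>2" "e\<^sup>2"] e by auto
      have "norm (r m - r n) < e" if "m \<ge> M" "n \<ge> M" for m n
      proof -
        have "(norm (r m - r n))\<^sup>2 \<le> \<bar>(norm (r m))\<^sup>2 - (norm (r n))\<^sup>2\<bar>"
          using key2[of m n] key2[of n m] by (cases "m \<le> n") (auto simp: norm_minus_commute)
        also have "\<dots> < e\<^sup>2" using M that by auto
        finally show ?thesis using e by (simp add: power2_less_imp_less)
      qed
      then show "\<exists>M. \<forall>m\<ge>M. \<forall>n\<ge>M. norm (r m - r n) < e" by blast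
    qed
    then obtain p where p: "r \<longlonglongrightarrow> p"
      using Cauchy_convergent convergent_def by blast
    have xp: "x \<longlonglongrightarrow> y - p"
      using tendsto_diff[OF tendsto_const p, of y] by (simp add: r_def)
    have orth: "0 \<le> inner p (y - p - z)" if z: "z \<in> D" for z
    proof -
      have pos: "0 \<le> inner (r n - inverse (real (Suc n)) *\<^sub>R A z) (x n - z)" for n
      proof -
        have "0 \<le> inner (A (x n - z)) (x n - z)"
          using x(1) z D by (intro A_pos) (simp add: subspace_diff)
        also have "A (x n - z) = real (Suc n) *\<^sub>R (r n - inverse (real (Suc n)) *\<^sub>R A z)"
          using x(1) z by (simp add: A_diff Ax scaleR_diff_right del: of_nat_Suc)
        finally show ?thesis by (simp add: zero_le_mult_iff del: of_nat_Suc)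
      qed
      have "(\<lambda>n. inner (r n - inverse (real (Suc n)) *\<^sub>R A z) (x n - z)) \<longlonglongrightarrow>
          inner (p - 0 *\<^sub>R A z) (y - p - z)"
        by (intro tendsto_intros p xp LIMSEQ_inverse_real_of_nat)
      then show ?thesis
        using pos by (intro LIMSEQ_le_const) (auto simp del: of_nat_Suc)
    qed
    have orth0: "inner p z = 0" if z: "z \<in> D" for z
    proof -
      (* D is a subspace: a linear functional that is bounded below on the line through z vanishes there *)
      have *: "0 \<le> inner p (y - p) - s * inner p z" for s
        using orth[of "s *\<^sub>R z"] z D by (simp add: subspace_scale inner_diff_right)
      show ?thesis
      proof (rule ccontr)
        assume n: "inner p z \<noteq> 0"
        then show False
          using *[of "(inner p (y - p) + 1) / inner p z"] by simp
      qed
    qed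
    obtain w where w: "w \<in> D" "w + A w = p" using A_onto by blast
    then have "inner (w + A w) w = 0" using orth0 by simp
    then have "(norm w)\<^sup>2 \<le> 0"
      using A_pos[OF w(1)] by (simp add: inner_add_left power2_norm_eq_inner)
    then have "w = 0" by simp
    then have "p = 0" using w A_sc[OF w(1), of 0] by simp
    then have "x \<longlonglongrightarrow> y" using xp by simp
    then show ?thesis using x(1) closure_sequential by blast
  qed
  then show ?thesis by auto
qed

section \<open>Differential equations with a bounded operator\<close>

lemma has_vector_derivative_uniform_limit:
  fixes u :: "nat \<Rightarrow> real \<Rightarrow> 'a::banach"
  assumes "convex S"
    and der: "\<And>n t. t \<in> S \<Longrightarrow> (u n has_vector_derivative u' n t) (at t within S)"
    and lim': "uniform_limit S u' v sequentially"
    and lim: "\<And>t. t \<in> S \<Longrightarrow> (\<lambda>n. u n t) \<longlonglongrightarrow> l t"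
    and t: "t \<in> S"
  shows "(l has_vector_derivative v t) (at t within S)"
proof -
  have "\<exists>g. \<forall>x\<in>S. (\<lambda>n. u n x) \<longlonglongrightarrow> g x \<and> (g has_derivative (\<lambda>h. h *\<^sub>R v x)) (at x within S)"
  proof (rule has_derivative_sequence[where f = u and f' = "\<lambda>n x h. h *\<^sub>R u' n x" and g' = "\<lambda>x h. h *\<^sub>R v x" and l = "l t",
        OF \<open>convex S\<close> _ _ t lim[OF t]])
    show "(u n has_derivative (\<lambda>h. h *\<^sub>R u' n x)) (at x within S)" if "x \<in> S" for n x
      using der[OF that] by (simp add: has_vector_derivative_def)
    fix e :: real assume "0 < e"
    then have "\<forall>\<^sub>F n in sequentially. \<forall>x\<in>S. dist (u' n x) (v x) < e"
      using lim' by (simp add: uniform_limit_iff)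
    then show "\<forall>\<^sub>F n in sequentially. \<forall>x\<in>S. \<forall>h. norm (h *\<^sub>R u' n x - h *\<^sub>R v x) \<le> e * norm h"
    proof eventually_elim
      case (elim n)
      show ?case
      proof (intro ballI allI)
        fix x h assume "x \<in> S"
        then have "norm (u' n x - v x) \<le> e" using elim by (auto simp: dist_norm intro: less_imp_le)
        then show "norm (h *\<^sub>R u' n x - h *\<^sub>R v x) \<le> e * norm h"
          using mult_right_mono[of "norm (u' n x - v x)" e "norm h"]
          by (simp add: scaleR_diff_right[symmetric] mult.commute)
      qed
    qed
  qed
  then obtain g where g: "\<And>x. x \<in> S \<Longrightarrow> (\<lambda>n. u n x) \<longlonglongrightarrow> g x"
    and gd: "\<And>x. x \<in> S \<Longrightarrow> (g has_derivative (\<lambda>h. h *\<^sub>R v x)) (at x within S)"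
    by blast
  have "g x = l x" if "x \<in> S" for x
    using g[OF that] lim[OF that] by (rule LIMSEQ_unique)
  then show ?thesis
    using gd[OF t] t unfolding has_vector_derivative_def
    by (metis has_derivative_transform)
qed

text \<open>The exponential series, applied to \<open>x\<close> term by term. The derivative of a partial sum is \<open>L\<close> applied to the previous
  one, and the partial sums converge uniformly on bounded intervals.\<close>

lemma bounded_ode_solution_exists:
  fixes L :: "'a::banach \<Rightarrow>\<^sub>L 'a"
  shows "\<exists>u. u 0 = x \<and> (\<forall>t. (u has_vector_derivative L (u t)) (at t))"
proof -
  define c where "c k = ((blinfun_apply L) ^^ k) x" for k
  define f where "f k t = (t ^ k / fact k) *\<^sub>R c k" for k :: nat and t :: real
  define u where "u t = (\<Sum>k. f k t)" for t
  have c_norm: "norm (c k) \<le> norm L ^ k * norm x" for k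
  proof (induction k)
    case (Suc k)
    have "norm (c (Suc k)) \<le> norm L * norm (c k)"
      by (simp add: c_def norm_blinfun)
    also have "\<dots> \<le> norm L * (norm L ^ k * norm x)"
      by (intro mult_left_mono Suc) auto
    finally show ?case by (simp add: mult.assoc)
  qed (simp add: c_def)
  have f_der: "((\<lambda>t. \<Sum>k<Suc n. f k t) has_vector_derivative L (\<Sum>k<n. f k t)) (at t within S)" for n t S
  proof (induction n)
    case 0
    then show ?case by (simp add: f_def)
  next
    case (Suc n)
    have "((\<lambda>t. f (Suc n) t) has_vector_derivative L (f n t)) (at t within S)"
    proof -
      have "((\<lambda>t. t ^ Suc n / fact (Suc n)) has_real_derivative t ^ n / fact n) (at t within S)"
        using DERIV_cdivide[OF DERIV_pow[of "Suc n" t S], of "fact (Suc n)"] by (simp del: of_nat_Suc)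
      then have "((\<lambda>t. (t ^ Suc n / fact (Suc n)) *\<^sub>R c (Suc n)) has_vector_derivative (t ^ n / fact n) *\<^sub>R c (Suc n)) (at t within S)"
        using has_vector_derivative_scaleR[of "\<lambda>t. t ^ Suc n / fact (Suc n)" _ t S "\<lambda>_. c (Suc n)" 0] by simp
      then show ?thesis by (simp add: f_def blinfun.scaleR_right c_def)
    qed
    from has_vector_derivative_add[OF Suc this]
    show ?case by (simp add: blinfun.add_right add_ac)
  qed
  have unif: "uniform_limit {-R..R} (\<lambda>n t. \<Sum>k<n. f k t) u sequentially" for R
    unfolding u_def
  proof (rule Weierstrass_m_test)
    let ?M = "\<lambda>k. norm x * ((\<bar>R\<bar> * norm L) ^ k /\<^sub>R fact k)"
    show "norm (f k t) \<le> ?M k" if "t \<in> {-R..R}" for k t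
    proof -
      have "norm (f k t) = \<bar>t\<bar> ^ k / fact k * norm (c k)"
        by (simp add: f_def power_abs)
      also have "\<dots> \<le> \<bar>R\<bar> ^ k / fact k * (norm L ^ k * norm x)"
        using that by (intro mult_mono divide_right_mono power_mono c_norm) auto
      finally show ?thesis by (simp add: power_mult_distrib divide_simps mult_ac)
    qed
    show "summable ?M" by (intro summable_mult summable_exp_generic)
  qed
  have "(u has_vector_derivative L (u t)) (at t)" for t
  proof -
    let ?R = "\<bar>t\<bar> + 1"
    have "(u has_vector_derivative L (u t)) (at t within {-?R..?R})"
    proof (rule has_vector_derivative_uniform_limit[OF _ f_der])
      show "uniform_limit {-?R..?R} (\<lambda>n t. L (\<Sum>k<n. f k t)) (\<lambda>t. L (u t)) sequentially"
        by (rule bounded_linear.uniform_limit[OF blinfun.bounded_linear_right unif])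
      show "(\<lambda>n. \<Sum>k<Suc n. f k t) \<longlonglongrightarrow> u t" if "t \<in> {-?R..?R}" for t
        using tendsto_uniform_limitI[OF unif that] by (rule LIMSEQ_Suc)
    qed auto
    moreover have "at t within {-?R..?R} = at t"
      by (rule at_within_interior) (auto simp: interior_atLeastAtMost_real)
    ultimately show ?thesis by simp
  qed
  moreover have "u 0 = x"
  proof -
    have "u 0 = (\<Sum>k\<in>{0}. f k 0)"
      unfolding u_def by (rule suminf_finite) (auto simp: f_def)
    then show ?thesis by (simp add: f_def c_def)
  qed
  ultimately show ?thesis by blast
qed

section \<open>Energy estimates\<close>

text \<open>All estimates are carried out in the inner product \<open>b\<close>, whose norm is equivalent to the given one with
  constants that depend on \<open>bmin\<close> and \<open>bmax\<close> only.\<close>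

locale coercive_weight =
  fixes B :: "'a::{real_inner,banach} sa_op" and bmin bmax :: real
  assumes bmin_pos: "0 < bmin" and bmin_le: "bmin \<le> bmax" and B_dom: "B \<in> param_domain bmin bmax"
begin

abbreviation b :: "'a \<Rightarrow> 'a \<Rightarrow> real" where
  "b x y \<equiv> inner (blinfun_apply (blinfun_of B) x) y"

lemma b_sym: "b x y = b y x"
  using blinfun_of[of B] by (simp add: inner_commute)

lemma b_lower: "bmin * (norm x)\<^sup>2 \<le> b x x" and b_upper: "b x x \<le> bmax * (norm x)\<^sup>2"
  using B_dom by (auto simp: param_domain_def)

lemma b_nonneg: "0 \<le> b x x"
  using b_lower[of x] bmin_pos by (smt (verit) mult_nonneg_nonneg zero_le_power2)

lemma b_zeroD: "b x x \<le> 0 \<Longrightarrow> x = 0"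
  using b_lower[of x] bmin_pos by (smt (verit) mult_pos_pos zero_less_norm_iff zero_less_power)

lemma b_young:
  assumes "0 < c"
  shows "2 * b x y \<le> c * b x x + b y y / c"
proof -
  have "0 \<le> b (c *\<^sub>R x - y) (c *\<^sub>R x - y)" by (rule b_nonneg)
  also have "\<dots> = c\<^sup>2 * b x x - 2 * c * b x y + b y y"
    by (simp add: blinfun.diff_right blinfun.scaleR_right inner_diff_left inner_diff_right b_sym[of y x]
        power2_eq_square algebra_simps)
  finally have "2 * b x y * c \<le> c\<^sup>2 * b x x + b y y" by (simp add: mult_ac)
  then show ?thesis using assms by (simp add: field_simps power2_eq_square)
qed

lemma norm_le_of_b:
  assumes "b x x \<le> K * b y y" "0 \<le> K"
  shows "norm x \<le> sqrt (K * bmax / bmin) * norm y"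
proof -
  have "bmin * (norm x)\<^sup>2 \<le> K * (bmax * (norm y)\<^sup>2)"
    using b_lower[of x] assms(1) mult_left_mono[OF b_upper[of y] assms(2)] by linarith
  then have "(norm x)\<^sup>2 \<le> K * bmax / bmin * (norm y)\<^sup>2"
    using bmin_pos by (simp add: field_simps)
  then have "sqrt ((norm x)\<^sup>2) \<le> sqrt (K * bmax / bmin * (norm y)\<^sup>2)"
    by (rule real_sqrt_le_mono)
  then show ?thesis by (simp only: real_sqrt_mult[of _ "(norm y)\<^sup>2"] real_sqrt_abs abs_norm_cancel)
qed

text \<open>Gronwall's inequality for the energy: the function \<open>exp (- a s) b (w s) (w s) - c s\<close> is
  nonincreasing.\<close>

lemma energy_estimate:
  assumes a: "0 \<le> a" and c: "0 \<le> c" and cont: "continuous_on {0..\<tau>} w"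
    and der: "\<And>s. 0 < s \<Longrightarrow> s < \<tau> \<Longrightarrow> (w has_vector_derivative w' s) (at s)"
    and ineq: "\<And>s. 0 < s \<Longrightarrow> s < \<tau> \<Longrightarrow> 2 * b (w' s) (w s) \<le> a * b (w s) (w s) + c"
    and t: "0 \<le> t" "t \<le> \<tau>"
  shows "b (w t) (w t) \<le> exp (a * t) * (b (w 0) (w 0) + c * t)"
proof -
  let ?\<psi> = "\<lambda>s. exp (- a * s) * b (w s) (w s) - c * s"
  have "?\<psi> t \<le> ?\<psi> 0"
  proof (rule DERIV_nonpos_imp_decreasing_open[where f = ?\<psi> and a = 0 and b = t])
    have "continuous_on {0..t} w" using cont t by (elim continuous_on_subset) auto
    then show "continuous_on {0..t} ?\<psi>" by (intro continuous_intros)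
    fix s assume s: "0 < s" "s < t"
    have wd: "(w has_derivative (\<lambda>h. h *\<^sub>R w' s)) (at s)"
      using der[of s] s t by (simp add: has_vector_derivative_def)
    have "((\<lambda>s. b (w s) (w s)) has_derivative (\<lambda>h. b (w s) (h *\<^sub>R w' s) + b (h *\<^sub>R w' s) (w s))) (at s)"
      by (rule has_derivative_inner[OF bounded_linear.has_derivative[OF blinfun.bounded_linear_right[of "blinfun_of B"] wd] wd])
    then have "((\<lambda>s. b (w s) (w s)) has_real_derivative 2 * b (w' s) (w s)) (at s)"
      by (rule has_derivative_imp_has_field_derivative)
        (simp add: blinfun.scaleR_right b_sym[of "w s"] mult.commute)
    moreover have "((\<lambda>s. exp (- a * s)) has_real_derivative exp (- a * s) * - a) (at s)"
      by (auto intro!: derivative_eq_intros)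
    ultimately have "((\<lambda>s. exp (- a * s) * b (w s) (w s)) has_real_derivative
        exp (- a * s) * - a * b (w s) (w s) + 2 * b (w' s) (w s) * exp (- a * s)) (at s)"
      by (intro DERIV_mult)
    then have "(?\<psi> has_real_derivative
        exp (- a * s) * - a * b (w s) (w s) + 2 * b (w' s) (w s) * exp (- a * s) - c) (at s)"
      by (intro DERIV_diff) (auto intro!: derivative_eq_intros)
    then have "(?\<psi> has_real_derivative exp (- a * s) * (2 * b (w' s) (w s) - a * b (w s) (w s)) - c) (at s)"
      by (rule DERIV_cong) (simp add: algebra_simps)
    moreover have "exp (- a * s) * (2 * b (w' s) (w s) - a * b (w s) (w s)) - c \<le> 0"
    proof -
      have "exp (- a * s) * (2 * b (w' s) (w s) - a * b (w s) (w s)) \<le> exp (- a * s) * c"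
        using ineq[of s] s t by (intro mult_left_mono) auto
      also have "\<dots> \<le> 1 * c" using a c s by (intro mult_right_mono) auto
      finally show ?thesis by simp
    qed
    ultimately show "\<exists>y. (?\<psi> has_real_derivative y) (at s) \<and> y \<le> 0" by blast
  qed (use t in auto)
  then have "exp (a * t) * (exp (- a * t) * b (w t) (w t)) \<le> exp (a * t) * (b (w 0) (w 0) + c * t)"
    by (intro mult_left_mono) auto
  then show ?thesis by (simp add: mult.assoc[symmetric] exp_add[symmetric])
qed

end

section \<open>Resolvents and Yosida approximations\<close>

text \<open>The hypotheses of the theorem of Lumer and Phillips for an operator that is dissipative
  for \<open>b\<close> after subtracting \<open>\<omega>\<close>.\<close>

locale dissipative = coercive_weight B bmin bmax
  for B :: "'a::{real_inner,banach} sa_op" and bmin bmax +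
  fixes D :: "'a set" and G :: "'a \<Rightarrow> 'a" and \<omega> :: real
  assumes \<omega>: "0 \<le> \<omega>" and D: "subspace D"
    and G_add: "\<And>x y. x \<in> D \<Longrightarrow> y \<in> D \<Longrightarrow> G (x + y) = G x + G y"
    and G_scale: "\<And>c x. x \<in> D \<Longrightarrow> G (c *\<^sub>R x) = c *\<^sub>R G x"
    and diss: "\<And>x. x \<in> D \<Longrightarrow> b (G x) x \<le> \<omega> * b x x"
    and onto: "\<And>l y. \<omega> < l \<Longrightarrow> \<exists>x\<in>D. l *\<^sub>R x - G x = y"
    and dense: "closure D = UNIV"
begin

lemma G_diff: "x \<in> D \<Longrightarrow> y \<in> D \<Longrightarrow> G (x - y) = G x - G y"
  using G_add[of x "(-1) *\<^sub>R y"] G_scale[of y "-1"] D by (simp add: subspace_neg)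

definition resolvent :: "real \<Rightarrow> 'a \<Rightarrow> 'a" where
  "resolvent l y = (SOME x. x \<in> D \<and> l *\<^sub>R x - G x = y)"

lemma resolvent: "\<omega> < l \<Longrightarrow> resolvent l y \<in> D" "\<omega> < l \<Longrightarrow> l *\<^sub>R resolvent l y - G (resolvent l y) = y"
  using someI_ex[of "\<lambda>x. x \<in> D \<and> l *\<^sub>R x - G x = y"] onto[of l y] by (auto simp: resolvent_def)

lemma resolvent_bound_aux:
  assumes "x \<in> D" and l: "\<omega> < l"
  shows "b x x \<le> (1 / (l - \<omega>)\<^sup>2) * b (l *\<^sub>R x - G x) (l *\<^sub>R x - G x)"
proof -
  let ?y = "l *\<^sub>R x - G x" and ?d = "l - \<omega>"
  have "?d * b x x \<le> b ?y x"
    using diss[OF assms(1)] by (simp add: blinfun.diff_right blinfun.scaleR_right inner_diff_left algebra_simps)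
  moreover have "2 * b ?y x \<le> (1 / ?d) * b ?y ?y + b x x / (1 / ?d)"
    using l by (intro b_young) auto
  ultimately have *: "?d * b x x \<le> b ?y ?y / ?d" by (simp add: mult.commute)
  have "0 < ?d" using l by simp
  then show ?thesis using mult_left_mono[OF *, of "1 / ?d"] by (simp add: power2_eq_square)
qed

lemma resolvent_unique:
  assumes x: "x \<in> D" "l *\<^sub>R x - G x = y" and l: "\<omega> < l"
  shows "resolvent l y = x"
proof -
  let ?z = "resolvent l y - x"
  have "?z \<in> D" using resolvent(1)[OF l] x D by (simp add: subspace_diff)
  moreover have "l *\<^sub>R ?z - G ?z = (l *\<^sub>R resolvent l y - G (resolvent l y)) - (l *\<^sub>R x - G x)"
    using G_diff[OF resolvent(1)[OF l] x(1)] by (simp add: scaleR_diff_right)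
  then have "l *\<^sub>R ?z - G ?z = 0"
    using resolvent(2)[OF l] x(2) by simp
  ultimately have "b ?z ?z \<le> 0" using resolvent_bound_aux[of ?z l] l by simp
  then show ?thesis using b_zeroD by force
qed

lemma resolvent_add: "\<omega> < l \<Longrightarrow> resolvent l (x + y) = resolvent l x + resolvent l y"
proof (rule resolvent_unique)
  assume l: "\<omega> < l"
  show "l *\<^sub>R (resolvent l x + resolvent l y) - G (resolvent l x + resolvent l y) = x + y"
    using resolvent(2)[OF l, of x] resolvent(2)[OF l, of y] resolvent(1)[OF l]
    by (simp add: G_add scaleR_add_right add_diff_add)
qed (use resolvent(1) D in \<open>auto simp: subspace_add\<close>)

lemma resolvent_scale: "\<omega> < l \<Longrightarrow> resolvent l (c *\<^sub>R x) = c *\<^sub>R resolvent l x"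
proof (rule resolvent_unique)
  assume l: "\<omega> < l"
  have "l *\<^sub>R c *\<^sub>R resolvent l x - G (c *\<^sub>R resolvent l x) = c *\<^sub>R (l *\<^sub>R resolvent l x - G (resolvent l x))"
    using resolvent(1)[OF l] by (simp add: G_scale scaleR_diff_right)
  then show "l *\<^sub>R c *\<^sub>R resolvent l x - G (c *\<^sub>R resolvent l x) = c *\<^sub>R x"
    using resolvent(2)[OF l] by simp
qed (use resolvent(1) D in \<open>auto simp: subspace_scale\<close>)

definition norm_ratio :: real where "norm_ratio = sqrt (bmax / bmin)"

lemma resolvent_bound: "\<omega> < l \<Longrightarrow> norm (resolvent l y) \<le> norm_ratio / (l - \<omega>) * norm y"
  using norm_le_of_b[of "resolvent l y" "1 / (l - \<omega>)\<^sup>2" y] resolvent_bound_aux[OF resolvent(1), of l l y] resolvent(2)[of l y]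
  by (simp add: norm_ratio_def real_sqrt_divide real_sqrt_mult mult.commute)

lemma resolvent_bounded_linear: "\<omega> < l \<Longrightarrow> bounded_linear (resolvent l)"
  by (intro bounded_linear_intro[where K = "norm_ratio / (l - \<omega>)"])
    (use resolvent_bound[of l] in \<open>auto simp: resolvent_add resolvent_scale mult.commute\<close>)

text \<open>For \<open>l \<noteq> m\<close> this follows from the resolvent identity, whose left side is antisymmetric in \<open>l\<close> and \<open>m\<close>.\<close>

lemma resolvent_commute:
  assumes "\<omega> < l" "\<omega> < m"
  shows "resolvent l (resolvent m y) = resolvent m (resolvent l y)"
proof (cases "l = m")
  case False
  have *: "resolvent l y - resolvent m y = (m - l) *\<^sub>R resolvent l (resolvent m y)" if "\<omega> < l" "\<omega> < m" for l m
  proof -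
    have "resolvent l ((m - l) *\<^sub>R resolvent m y) = resolvent l y - resolvent m y"
    proof (rule resolvent_unique)
      show "l *\<^sub>R (resolvent l y - resolvent m y) - G (resolvent l y - resolvent m y) = (m - l) *\<^sub>R resolvent m y"
        using resolvent(2)[OF that(1), of y] resolvent(2)[OF that(2), of y] resolvent(1) that
        by (simp add: G_diff algebra_simps)
    qed (use resolvent(1) D that in \<open>auto simp: subspace_diff\<close>)
    then show ?thesis using resolvent_scale that by simp
  qed
  have "(m - l) *\<^sub>R resolvent l (resolvent m y) = - (resolvent m y - resolvent l y)"
    using *[OF assms] by simp
  also have "\<dots> = (m - l) *\<^sub>R resolvent m (resolvent l y)"
    using *[OF assms(2,1)] by (simp add: algebra_simps)
  finally show ?thesis using False by simp
qed simp

definition yosida :: "real \<Rightarrow> 'a \<Rightarrow>\<^sub>L 'a" where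
  "yosida l = l\<^sup>2 *\<^sub>R Blinfun (resolvent l) - l *\<^sub>R id_blinfun"

lemma yosida_apply: "\<omega> < l \<Longrightarrow> yosida l x = l\<^sup>2 *\<^sub>R resolvent l x - l *\<^sub>R x"
  by (simp add: yosida_def blinfun.diff_left blinfun.scaleR_left bounded_linear_Blinfun_apply resolvent_bounded_linear)

lemma yosida_commute:
  assumes "\<omega> < l" "\<omega> < m"
  shows "yosida l (yosida m x) = yosida m (yosida l x)"
proof -
  have d: "resolvent k (u - v) = resolvent k u - resolvent k v" if "\<omega> < k" for k u v
    using resolvent_bounded_linear[OF that] by (simp add: linear_diff bounded_linear.linear)
  show ?thesis
    using assms by (simp add: yosida_apply d resolvent_scale resolvent_commute[of l m] scaleR_diff_right mult.commute)
qed

text \<open>The Yosida approximation is dissipative up to \<open>l \<omega> / (l - \<omega>)\<close>. The restriction on \<open>l\<close> makes \<open>2 \<omega>\<close> a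
  bound for all approximations at once.\<close>

lemma yosida_diss:
  assumes "2 * \<omega> < l"
  shows "b (yosida l x) x \<le> 2 * \<omega> * b x x"
proof -
  have l: "\<omega> < l" "0 < l" using assms \<omega> by auto
  let ?d = "l - \<omega>" and ?r = "resolvent l x"
  have d: "0 < ?d" using l by simp
  have "2 * b ?r x \<le> ?d * b ?r ?r + b x x / ?d" using d by (rule b_young)
  moreover have "?d * b ?r ?r \<le> b x x / ?d"
    using mult_left_mono[OF resolvent_bound_aux[OF resolvent(1)[OF l(1), of x] l(1)], of ?d] l d
    by (simp add: resolvent(2) power2_eq_square)
  ultimately have "b ?r x \<le> b x x / ?d" by simp
  then have "l\<^sup>2 * b ?r x \<le> l\<^sup>2 * (b x x / ?d)" by (intro mult_left_mono) auto
  then have "b (yosida l x) x \<le> (l\<^sup>2 / ?d - l) * b x x"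
    using l by (simp add: yosida_apply blinfun.diff_right blinfun.scaleR_right inner_diff_left algebra_simps)
  also have "\<dots> \<le> (2 * \<omega>) * b x x"
  proof (intro mult_right_mono b_nonneg)
    have "l * \<omega> \<le> 2 * \<omega> * (l - \<omega>)"
      using \<omega> assms mult_left_mono[of "2 * \<omega>" l \<omega>] by (simp add: algebra_simps)
    then show "l\<^sup>2 / ?d - l \<le> 2 * \<omega>" using d by (simp add: field_simps power2_eq_square)
  qed
  finally show ?thesis .
qed

lemma yosida_on_D: "\<omega> < l \<Longrightarrow> x \<in> D \<Longrightarrow> yosida l x = l *\<^sub>R resolvent l (G x)"
proof -
  assume l: "\<omega> < l" and x: "x \<in> D"
  have "x = resolvent l (l *\<^sub>R x - G x)" using resolvent_unique[OF x refl l] by simp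
  also have "\<dots> = l *\<^sub>R resolvent l x - resolvent l (G x)"
    using l by (simp add: linear_diff[OF bounded_linear.linear[OF resolvent_bounded_linear]] resolvent_scale)
  finally have "l *\<^sub>R x = l *\<^sub>R (l *\<^sub>R resolvent l x - resolvent l (G x))" by (rule arg_cong)
  then show ?thesis using l by (simp add: yosida_apply power2_eq_square scaleR_diff_right)
qed

text \<open>The parameters of the approximating sequence exceed \<open>2 \<omega>\<close> from the start, as \<open>yosida_diss\<close> requires.\<close>

definition \<mu> :: "nat \<Rightarrow> real" where "\<mu> n = 2 * \<omega> + 1 + real n"

lemma \<mu>: "2 * \<omega> < \<mu> n" "\<omega> < \<mu> n" "0 < \<mu> n"
  using \<omega> by (auto simp: \<mu>_def)

lemma norm_ratio_nonneg: "0 \<le> norm_ratio"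
  using bmin_pos bmin_le by (simp add: norm_ratio_def)

end

section \<open>Construction of the semigroup\<close>

lemma has_vector_derivative_iff_tendsto:
  "(f has_vector_derivative y) (at x within S) \<longleftrightarrow>
    ((\<lambda>t. (f t - f x) /\<^sub>R (t - x)) \<longlongrightarrow> y) (at x within S)"
proof -
  have "(f has_vector_derivative y) (at x within S) \<longleftrightarrow>
      ((\<lambda>t. norm (f t - f x - (t - x) *\<^sub>R y) / norm (t - x)) \<longlongrightarrow> 0) (at x within S)"
    by (simp add: has_vector_derivative_def has_derivative_iff_norm bounded_linear_scaleR_left)
  also have "\<dots> \<longleftrightarrow> ((\<lambda>t. norm ((f t - f x) /\<^sub>R (t - x) - y)) \<longlongrightarrow> 0) (at x within S)"
  proof (rule tendsto_cong)
    have "norm (f t - f x - (t - x) *\<^sub>R y) / norm (t - x) = norm ((f t - f x) /\<^sub>R (t - x) - y)"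
      if "t \<noteq> x" for t
    proof -
      have "(f t - f x) /\<^sub>R (t - x) - y = (f t - f x - (t - x) *\<^sub>R y) /\<^sub>R (t - x)"
        using that by (simp add: scaleR_diff_right)
      then show ?thesis by (simp add: divide_inverse_commute)
    qed
    then show "\<forall>\<^sub>F t in at x within S. norm (f t - f x - (t - x) *\<^sub>R y) / norm (t - x)
        = norm ((f t - f x) /\<^sub>R (t - x) - y)"
      by (simp add: eventually_at_filter)
  qed
  also have "\<dots> \<longleftrightarrow> ((\<lambda>t. (f t - f x) /\<^sub>R (t - x)) \<longlongrightarrow> y) (at x within S)"
    by (simp add: tendsto_norm_zero_iff LIM_zero_iff)
  finally show ?thesis .
qed

text \<open>The three-epsilon argument that carries the convergence of the flows from the domain to the whole space.\<close>

lemma uniformly_Cauchy_on_dense: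
  fixes f :: "nat \<Rightarrow> 'a::real_normed_vector \<Rightarrow> 'c \<Rightarrow> 'b::real_normed_vector"
  assumes dense: "closure D = UNIV"
    and lip: "\<And>n t x y. t \<in> S \<Longrightarrow> norm (f n x t - f n y t) \<le> K * norm (x - y)"
    and conv: "\<And>x. x \<in> D \<Longrightarrow> uniformly_Cauchy_on S (\<lambda>n. f n x)"
  shows "uniformly_Cauchy_on S (\<lambda>n. f n x)"
  unfolding uniformly_Cauchy_on_def
proof (intro allI impI)
  fix e :: real assume e: "0 < e"
  define K' where "K' = \<bar>K\<bar> + 1"
  have K': "0 < K'" "K \<le> K'" by (auto simp: K'_def)
  have "0 < e / (3 * K')" using e K' by simp
  then obtain y where y: "y \<in> D" "dist y x < e / (3 * K')"
    using dense closure_approachable[of x D] by blast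
  have near: "norm (f n x t - f n y t) < e / 3" if "t \<in> S" for n t
  proof -
    have "norm (f n x t - f n y t) \<le> K' * norm (x - y)"
      using lip[OF that, of n x y] K'(2) mult_right_mono[OF K'(2), of "norm (x - y)"] by simp
    also have "\<dots> < e / 3"
      using y(2) K'(1) by (simp add: dist_norm norm_minus_commute field_simps)
    finally show ?thesis .
  qed
  have "0 < e / 3" using e by simp
  then obtain M where M: "\<And>t m n. t \<in> S \<Longrightarrow> m \<ge> M \<Longrightarrow> n \<ge> M \<Longrightarrow> dist (f m y t) (f n y t) < e / 3"
    using conv[OF y(1)] unfolding uniformly_Cauchy_on_def by meson
  have "dist (f m x t) (f n x t) < e" if "t \<in> S" "m \<ge> M" "n \<ge> M" for t m n
    using near[OF that(1), of m] near[OF that(1), of n] M[OF that]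
      dist_triangle[of "f m x t" "f n x t" "f m y t"] dist_triangle[of "f m y t" "f n x t" "f n y t"]
    by (simp add: dist_norm[symmetric] dist_commute)
  then show "\<exists>M. \<forall>t\<in>S. \<forall>m\<ge>M. \<forall>n\<ge>M. dist (f m x t) (f n x t) < e" by blast
qed

context dissipative
begin

lemma resolvent_limit: "(\<lambda>n. \<mu> n *\<^sub>R resolvent (\<mu> n) y) \<longlonglongrightarrow> y"
proof -
  let ?J = "\<lambda>n y. \<mu> n *\<^sub>R resolvent (\<mu> n) y"
  have "(\<lambda>n. 1 / (\<mu> n - \<omega>)) \<longlonglongrightarrow> 0"
  proof (intro tendsto_divide_0[OF tendsto_const] filterlim_at_top_imp_at_infinity)
    have "filterlim (\<lambda>n. (\<omega> + 1) + real n) at_top sequentially"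
      by (rule filterlim_tendsto_add_at_top[OF tendsto_const filterlim_real_sequentially])
    then show "filterlim (\<lambda>n. \<mu> n - \<omega>) at_top sequentially"
      by (simp add: \<mu>_def algebra_simps)
  qed
  then have small: "(\<lambda>n. norm_ratio / (\<mu> n - \<omega>) * c) \<longlonglongrightarrow> 0" for c
    using tendsto_mult_left[of "\<lambda>n. 1 / (\<mu> n - \<omega>)" 0 sequentially "norm_ratio * c"] by (simp add: mult.commute mult.assoc)
  have J_diff: "?J n u - ?J n v = ?J n (u - v)" for n u v
    using resolvent_bounded_linear[OF \<mu>(2)] by (simp add: linear_diff bounded_linear.linear scaleR_diff_right)
  have J_bound: "norm (?J n u) \<le> 2 * norm_ratio * norm u" for n u
  proof -
    have "norm (?J n u) \<le> \<mu> n * (norm_ratio / (\<mu> n - \<omega>) * norm u)"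
      using mult_left_mono[OF resolvent_bound[OF \<mu>(2), of n u], of "\<mu> n"] \<mu>(3)[of n] by simp
    also have "\<dots> = (\<mu> n / (\<mu> n - \<omega>)) * (norm_ratio * norm u)" by simp
    also have "\<dots> \<le> 2 * (norm_ratio * norm u)"
      using \<mu>(1)[of n] \<omega> norm_ratio_nonneg by (intro mult_right_mono) (auto simp: field_simps)
    finally show ?thesis by simp
  qed
  have on_D: "(\<lambda>n. ?J n y - y) \<longlonglongrightarrow> 0" if y: "y \<in> D" for y
  proof (rule Lim_null_comparison[OF always_eventually small[of "norm (G y)"]], rule allI)
    fix n
    have J_lin: "resolvent (\<mu> n) (\<mu> n *\<^sub>R y - G y) = ?J n y - resolvent (\<mu> n) (G y)"
      using resolvent_bounded_linear[OF \<mu>(2)] by (simp add: linear_diff bounded_linear.linear resolvent_scale \<mu>(2))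
    have "y = resolvent (\<mu> n) (\<mu> n *\<^sub>R y - G y)" using resolvent_unique[OF y refl \<mu>(2)] by simp
    then have "?J n y - y = resolvent (\<mu> n) (G y)"
      by (metis J_lin diff_diff_eq2 add_diff_cancel_left')
    then show "norm (?J n y - y) \<le> norm_ratio / (\<mu> n - \<omega>) * norm (G y)"
      using resolvent_bound[OF \<mu>(2)] by simp
  qed
  show ?thesis
  proof (rule LIMSEQ_I)
    fix e :: real assume e: "0 < e"
    let ?C = "2 * norm_ratio + 1"
    have C: "0 < ?C" using norm_ratio_nonneg by simp
    have "0 < e / (2 * ?C)" using e C by simp
    then obtain z where z: "z \<in> D" "dist z y < e / (2 * ?C)"
      using dense closure_approachable[of y D] by blast
    then have z2: "?C * norm (z - y) < e / 2" using C by (simp add: dist_norm field_simps)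
    obtain N where N: "\<And>n. n \<ge> N \<Longrightarrow> norm (?J n z - z) < e / 2"
      using LIMSEQ_D[OF on_D[OF z(1)], of "e / 2"] e by auto
    have "norm (?J n y - y) < e" if "n \<ge> N" for n
    proof -
      have "?J n y - y = (?J n z - z) + ((z - y) - ?J n (z - y))"
        by (simp add: J_diff[symmetric])
      then have "norm (?J n y - y) \<le> norm (?J n z - z) + (norm (z - y) + norm (?J n (z - y)))"
        by (metis norm_triangle_mono norm_triangle_ineq4 order_refl)
      also have "\<dots> \<le> norm (?J n z - z) + ?C * norm (z - y)"
        using J_bound[of n "z - y"] by (simp add: algebra_simps)
      also have "\<dots> < e" using N[OF that] z2 by simp
      finally show ?thesis .
    qed
    then show "\<exists>N. \<forall>n\<ge>N. norm (?J n y - y) < e" by blast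
  qed
qed

lemma yosida_limit: "x \<in> D \<Longrightarrow> (\<lambda>n. yosida (\<mu> n) x) \<longlonglongrightarrow> G x"
  using resolvent_limit[of "G x"] by (simp add: yosida_on_D \<mu>(2))

text \<open>The growth rate of the energy: \<open>4 \<omega>\<close> comes from \<open>yosida_diss\<close>, the summand \<open>1\<close> absorbs an inhomogeneity
  through Young's inequality.\<close>

definition \<kappa> :: real where "\<kappa> = 4 * \<omega> + 1"

lemma \<kappa>_pos: "0 < \<kappa>"
  using \<omega> by (simp add: \<kappa>_def)

lemma yosida_energy:
  assumes l: "2 * \<omega> < l" and c: "0 \<le> c"
    and der: "\<And>t. (w has_vector_derivative yosida l (w t) + g t) (at t)"
    and g: "\<And>t. 0 \<le> t \<Longrightarrow> t \<le> \<tau> \<Longrightarrow> b (g t) (g t) \<le> c"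
    and t: "0 \<le> t" "t \<le> \<tau>"
  shows "b (w t) (w t) \<le> exp (\<kappa> * t) * (b (w 0) (w 0) + c * t)"
proof (rule energy_estimate[OF _ c _ der _ t])
  show "continuous_on {0..\<tau>} w"
    using der by (meson continuous_at_imp_continuous_on has_vector_derivative_continuous)
  show "2 * b (yosida l (w s) + g s) (w s) \<le> \<kappa> * b (w s) (w s) + c" if "0 < s" "s < \<tau>" for s
    using yosida_diss[OF l, of "w s"] b_young[of 1 "g s" "w s"] g[of s] that
    by (simp add: blinfun.add_right inner_add_left \<kappa>_def algebra_simps)
qed (use \<kappa>_pos in auto)

definition flow :: "nat \<Rightarrow> 'a \<Rightarrow> real \<Rightarrow> 'a" where
  "flow n x = (SOME u. u 0 = x \<and> (\<forall>t. (u has_vector_derivative yosida (\<mu> n) (u t)) (at t)))"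

lemma flow: "flow n x 0 = x" "(flow n x has_vector_derivative yosida (\<mu> n) (flow n x t)) (at t)"
  using someI_ex[OF bounded_ode_solution_exists[of x "yosida (\<mu> n)"]] by (auto simp: flow_def)

lemma flow_unique:
  assumes "u 0 = x" "\<And>t. (u has_vector_derivative yosida (\<mu> n) (u t)) (at t)" "0 \<le> t"
  shows "flow n x t = u t"
proof -
  let ?w = "\<lambda>t. flow n x t - u t"
  have "b (?w t) (?w t) \<le> exp (\<kappa> * t) * (b (?w 0) (?w 0) + 0 * t)"
  proof (rule yosida_energy[where g = "\<lambda>_. 0"])
    show "(?w has_vector_derivative yosida (\<mu> n) (?w s) + 0) (at s)" for s
      using has_vector_derivative_diff[OF flow(2)[of n x s] assms(2)] by (simp add: blinfun.diff_right)
  qed (use \<mu> assms in auto)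
  then have "b (?w t) (?w t) \<le> 0" using assms(1) flow(1) by simp
  then show ?thesis using b_zeroD by force
qed

lemma flow_add: "0 \<le> t \<Longrightarrow> flow n (x + y) t = flow n x t + flow n y t"
  by (rule flow_unique) (auto simp: flow(1) blinfun.add_right intro!: has_vector_derivative_add flow(2))

lemma flow_scale: "0 \<le> t \<Longrightarrow> flow n (c *\<^sub>R x) t = c *\<^sub>R flow n x t"
  by (rule flow_unique)
    (auto simp: flow(1) blinfun.scaleR_right intro!: bounded_linear.has_vector_derivative[OF bounded_linear_scaleR_right] flow(2))

lemma flow_diff: "0 \<le> t \<Longrightarrow> flow n (x - y) t = flow n x t - flow n y t"
  by (rule flow_unique) (auto simp: flow(1) blinfun.diff_right intro!: has_vector_derivative_diff flow(2))

lemma flow_yosida: "0 \<le> t \<Longrightarrow> flow n (yosida (\<mu> n) x) t = yosida (\<mu> n) (flow n x t)"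
  by (rule flow_unique)
    (auto simp: flow(1) intro!: bounded_linear.has_vector_derivative[OF blinfun.bounded_linear_right] flow(2))

lemma flow_shift:
  assumes "0 \<le> t"
  shows "flow n (flow n x s) t = flow n x (s + t)"
proof (rule flow_unique[OF _ _ assms])
  fix t
  have "((flow n x \<circ> (\<lambda>t. s + t)) has_vector_derivative 1 *\<^sub>R yosida (\<mu> n) (flow n x (s + t))) (at t)"
    by (rule vector_diff_chain_at) (auto intro!: derivative_eq_intros flow(2))
  then show "((\<lambda>t. flow n x (s + t)) has_vector_derivative yosida (\<mu> n) (flow n x (s + t))) (at t)"
    by (simp add: o_def)
qed simp

lemma flow_b: "0 \<le> t \<Longrightarrow> b (flow n x t) (flow n x t) \<le> exp (\<kappa> * t) * b x x"
  using yosida_energy[OF \<mu>(1), of 0 "flow n x" n "\<lambda>_. 0" t t] flow by simp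

definition orbit_bound :: "real \<Rightarrow> real" where "orbit_bound \<tau> = sqrt (exp (\<kappa> * \<tau>) * bmax / bmin)"

lemma norm_of_growth:
  assumes "b y y \<le> exp (\<kappa> * t) * b x x" "t \<le> \<tau>"
  shows "norm y \<le> orbit_bound \<tau> * norm x"
  unfolding orbit_bound_def
proof (rule norm_le_of_b)
  show "b y y \<le> exp (\<kappa> * \<tau>) * b x x"
    using assms \<kappa>_pos b_nonneg[of x] by (smt (verit) exp_le_cancel_iff mult_left_mono mult_right_mono)
qed simp

lemma flow_norm: "0 \<le> t \<Longrightarrow> t \<le> \<tau> \<Longrightarrow> norm (flow n x t) \<le> orbit_bound \<tau> * norm x"
  using norm_of_growth flow_b by blast

text \<open>The difference of two flows solves the equation of the first one with the inhomogeneity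
  \<open>(yosida n - yosida m) (flow m x)\<close>. As Yosida approximations commute, this inhomogeneity is
  itself an orbit of the second flow and is controlled by its initial value.\<close>

lemma flow_compare:
  assumes t: "0 \<le> t" "t \<le> \<tau>"
  shows "norm (flow n x t - flow m x t) \<le>
    sqrt (exp (\<kappa> * \<tau>) * exp (\<kappa> * \<tau>) * \<tau> * bmax / bmin) * norm (yosida (\<mu> n) x - yosida (\<mu> m) x)"
proof (rule norm_le_of_b)
  let ?w = "\<lambda>t. flow n x t - flow m x t"
  let ?g = "\<lambda>t. yosida (\<mu> n) (flow m x t) - yosida (\<mu> m) (flow m x t)"
  let ?d = "yosida (\<mu> n) x - yosida (\<mu> m) x"
  let ?c = "exp (\<kappa> * \<tau>) * b ?d ?d"
  have "b (?w t) (?w t) \<le> exp (\<kappa> * t) * (b (?w 0) (?w 0) + ?c * t)"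
  proof (rule yosida_energy[OF \<mu>(1)[of n] _ _ _ t])
    show "0 \<le> ?c" by (simp add: b_nonneg)
    show "(?w has_vector_derivative yosida (\<mu> n) (?w s) + ?g s) (at s)" for s
      using has_vector_derivative_diff[OF flow(2)[of n x s] flow(2)[of m x s]] by (simp add: blinfun.diff_right)
    show "b (?g s) (?g s) \<le> ?c" if "0 \<le> s" "s \<le> \<tau>" for s
    proof -
      have "(?g has_vector_derivative yosida (\<mu> m) (?g r)) (at r)" for r
        using has_vector_derivative_diff[OF
            bounded_linear.has_vector_derivative[OF blinfun.bounded_linear_right[of "yosida (\<mu> n)"] flow(2)[of m x r]]
            bounded_linear.has_vector_derivative[OF blinfun.bounded_linear_right[of "yosida (\<mu> m)"] flow(2)[of m x r]]]
        by (simp add: blinfun.diff_right yosida_commute[OF \<mu>(2) \<mu>(2), of n m])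
      then have "?g s = flow m ?d s"
        using flow_unique[of ?g ?d m s] that by (simp add: flow(1))
      then have "b (?g s) (?g s) \<le> exp (\<kappa> * s) * b ?d ?d" using flow_b[of s m ?d] that by simp
      also have "\<dots> \<le> ?c" using that \<kappa>_pos by (intro mult_right_mono b_nonneg) auto
      finally show ?thesis .
    qed
  qed
  also have "\<dots> = (exp (\<kappa> * t) * exp (\<kappa> * \<tau>) * t) * b ?d ?d" by (simp add: flow(1) blinfun.zero_right)
  also have "\<dots> \<le> (exp (\<kappa> * \<tau>) * exp (\<kappa> * \<tau>) * \<tau>) * b ?d ?d"
    using t \<kappa>_pos by (intro mult_right_mono mult_mono b_nonneg) auto
  finally show "b (?w t) (?w t) \<le> \<dots>" .
qed (use t in auto)

definition flow_lim :: "'a \<Rightarrow> real \<Rightarrow> 'a" where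
  "flow_lim x t = lim (\<lambda>n. flow n x t)"

lemma flow_uniform_limit: "uniform_limit {0..\<tau>} (\<lambda>n. flow n x) (flow_lim x) sequentially"
proof -
  have "uniformly_Cauchy_on {0..\<tau>} (\<lambda>n. flow n x)"
  proof (rule uniformly_Cauchy_on_dense[OF dense])
    show "norm (flow n x t - flow n y t) \<le> orbit_bound \<tau> * norm (x - y)" if "t \<in> {0..\<tau>}" for n t x y
      using that flow_norm[of t \<tau> n "x - y"] by (simp add: flow_diff)
    fix x assume x: "x \<in> D"
    show "uniformly_Cauchy_on {0..\<tau>} (\<lambda>n. flow n x)"
      unfolding uniformly_Cauchy_on_def
    proof (intro allI impI)
      fix e :: real assume e: "0 < e"
      define C where "C = sqrt (exp (\<kappa> * \<tau>) * exp (\<kappa> * \<tau>) * \<bar>\<tau>\<bar> * bmax / bmin) + 1"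
      have C: "0 < C" using bmin_pos bmin_le by (auto simp: C_def intro!: add_nonneg_pos)
      have "Cauchy (\<lambda>n. yosida (\<mu> n) x)"
        using yosida_limit[OF x] by (rule LIMSEQ_imp_Cauchy)
      then obtain N where N: "\<And>m n. m \<ge> N \<Longrightarrow> n \<ge> N \<Longrightarrow> norm (yosida (\<mu> m) x - yosida (\<mu> n) x) < e / C"
        using CauchyD[of _ "e / C"] e C by (metis divide_pos_pos)
      have "dist (flow m x t) (flow n x t) < e" if "t \<in> {0..\<tau>}" "m \<ge> N" "n \<ge> N" for t m n
      proof -
        have "dist (flow m x t) (flow n x t) \<le> (C - 1) * norm (yosida (\<mu> m) x - yosida (\<mu> n) x)"
          using flow_compare[of t \<tau> m x n] that by (simp add: dist_norm C_def)
        also have "\<dots> \<le> C * norm (yosida (\<mu> m) x - yosida (\<mu> n) x)"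
          by (intro mult_right_mono) auto
        also have "\<dots> < e" using N[OF that(2,3)] C by (simp add: field_simps)
        finally show ?thesis .
      qed
      then show "\<exists>M. \<forall>t\<in>{0..\<tau>}. \<forall>m\<ge>M. \<forall>n\<ge>M. dist (flow m x t) (flow n x t) < e" by blast
    qed
  qed
  then show ?thesis
    unfolding flow_lim_def
    using Cauchy_uniformly_convergent uniformly_convergent_uniform_limit_iff by blast
qed

lemma flow_limit: "0 \<le> t \<Longrightarrow> (\<lambda>n. flow n x t) \<longlonglongrightarrow> flow_lim x t"
  using tendsto_uniform_limitI[OF flow_uniform_limit[where \<tau> = t and x = x], of t] by simp

lemma flow_lim_b:
  assumes "0 \<le> t"
  shows "b (flow_lim x t) (flow_lim x t) \<le> exp (\<kappa> * t) * b x x"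
proof (rule LIMSEQ_le_const2)
  show "(\<lambda>n. b (flow n x t) (flow n x t)) \<longlonglongrightarrow> b (flow_lim x t) (flow_lim x t)"
    by (intro tendsto_intros flow_limit assms)
qed (use flow_b assms in blast)

definition propagator :: "real \<Rightarrow> 'a \<Rightarrow>\<^sub>L 'a" where
  "propagator t = Blinfun (\<lambda>x. flow_lim x t)"

lemma propagator_apply:
  assumes t: "0 \<le> t"
  shows "propagator t x = flow_lim x t"
proof -
  have "bounded_linear (\<lambda>x. flow_lim x t)"
  proof (rule bounded_linear_intro)
    show "flow_lim (x + y) t = flow_lim x t + flow_lim y t" for x y
      using tendsto_add[OF flow_limit[OF t, of x] flow_limit[OF t, of y]] flow_limit[OF t, of "x + y"]
      by (simp add: flow_add t LIMSEQ_unique)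
    show "flow_lim (c *\<^sub>R x) t = c *\<^sub>R flow_lim x t" for c x
      using tendsto_scaleR[OF tendsto_const flow_limit[OF t, of x], of c] flow_limit[OF t, of "c *\<^sub>R x"]
      by (simp add: flow_scale t LIMSEQ_unique)
    show "norm (flow_lim x t) \<le> norm x * orbit_bound t" for x
      using norm_of_growth[OF flow_lim_b[OF t], of t x] by (simp add: mult.commute)
  qed
  then show ?thesis by (simp add: propagator_def bounded_linear_Blinfun_apply)
qed

lemma propagator_b: "0 \<le> t \<Longrightarrow> b (propagator t x) (propagator t x) \<le> exp (\<kappa> * t) * b x x"
  by (simp add: propagator_apply flow_lim_b)

lemma propagator_norm: "0 \<le> t \<Longrightarrow> t \<le> \<tau> \<Longrightarrow> norm (propagator t x) \<le> orbit_bound \<tau> * norm x"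
  using norm_of_growth propagator_b by blast

lemma flow_propagator_uniform_limit: "uniform_limit {0..\<tau>} (\<lambda>n. flow n x) (\<lambda>t. propagator t x) sequentially"
  using flow_uniform_limit[where \<tau> = \<tau> and x = x] by (rule uniform_limit_cong'[THEN iffD1, rotated -1]) (auto simp: propagator_apply)

lemma propagator_continuous: "continuous_on {0..\<tau>} (\<lambda>t. propagator t x)"
proof (rule uniform_limit_theorem[OF always_eventually flow_propagator_uniform_limit])
  show "\<forall>n. continuous_on {0..\<tau>} (flow n x)"
    using flow(2) by (meson continuous_at_imp_continuous_on has_vector_derivative_continuous)
qed simp

lemma propagator_zero: "propagator 0 = id_blinfun"
proof (rule blinfun_eqI)
  show "propagator 0 x = id_blinfun x" for x
    using flow_limit[of 0 x] by (simp add: propagator_apply flow(1) LIMSEQ_const_iff)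
qed

lemma propagator_add:
  assumes "0 \<le> s" "0 \<le> t"
  shows "propagator (s + t) x = propagator s (propagator t x)"
proof -
  have "(\<lambda>n. flow n (flow n x t - propagator t x) s) \<longlonglongrightarrow> 0"
  proof (rule Lim_null_comparison)
    show "\<forall>\<^sub>F n in sequentially. norm (flow n (flow n x t - propagator t x) s) \<le> orbit_bound s * norm (flow n x t - propagator t x)"
      using flow_norm[OF assms(1)] by simp
    have "(\<lambda>n. norm (flow n x t - propagator t x)) \<longlonglongrightarrow> 0"
      using flow_limit[OF assms(2), of x] by (simp add: propagator_apply assms tendsto_norm_zero_iff LIM_zero_iff)
    then show "(\<lambda>n. orbit_bound s * norm (flow n x t - propagator t x)) \<longlonglongrightarrow> 0"
      using tendsto_mult_right_zero by blast
  qed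
  from tendsto_add[OF this flow_limit[OF assms(1), of "propagator t x"]]
  have "(\<lambda>n. flow n x (s + t)) \<longlonglongrightarrow> propagator s (propagator t x)"
    using assms by (simp add: flow_diff flow_shift propagator_apply add.commute)
  moreover have "(\<lambda>n. flow n x (s + t)) \<longlonglongrightarrow> propagator (s + t) x"
    using flow_limit[of "s + t" x] assms by (simp add: propagator_apply)
  ultimately show ?thesis by (rule LIMSEQ_unique[symmetric])
qed

text \<open>On the domain the derivatives \<open>flow n (yosida n x)\<close> of the approximate orbits converge uniformly to
  \<open>propagator t (G x)\<close>, because \<open>yosida n x\<close> tends to \<open>G x\<close>.\<close>

lemma propagator_derivative:
  assumes x: "x \<in> D" and t: "t \<in> {0..\<tau>}"
  shows "((\<lambda>t. propagator t x) has_vector_derivative propagator t (G x)) (at t within {0..\<tau>})"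
proof (rule has_vector_derivative_uniform_limit[OF _ _ _ _ t])
  show "(flow n x has_vector_derivative yosida (\<mu> n) (flow n x s)) (at s within {0..\<tau>})" for n s
    using flow(2) by (rule has_vector_derivative_at_within)
  show "(\<lambda>n. flow n x s) \<longlonglongrightarrow> propagator s x" if "s \<in> {0..\<tau>}" for s
    using flow_limit[of s x] that by (simp add: propagator_apply)
  have "uniform_limit {0..\<tau>} (\<lambda>n. flow n (yosida (\<mu> n) x - G x)) (\<lambda>_. 0) sequentially"
  proof (rule uniform_limitI)
    fix e :: real assume e: "0 < e"
    have "(\<lambda>n. orbit_bound \<tau> * norm (yosida (\<mu> n) x - G x)) \<longlonglongrightarrow> 0"
      using yosida_limit[OF x] by (intro tendsto_mult_right_zero) (simp add: tendsto_norm_zero_iff LIM_zero_iff)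
    then have "\<forall>\<^sub>F n in sequentially. orbit_bound \<tau> * norm (yosida (\<mu> n) x - G x) < e"
      using e by (rule order_tendstoD)
    then show "\<forall>\<^sub>F n in sequentially. \<forall>s\<in>{0..\<tau>}. dist (flow n (yosida (\<mu> n) x - G x) s) 0 < e"
      by eventually_elim (auto intro: le_less_trans[OF flow_norm])
  qed
  from uniform_limit_add[OF this flow_propagator_uniform_limit[where \<tau> = \<tau> and x = "G x"]]
  have "uniform_limit {0..\<tau>} (\<lambda>n s. flow n (yosida (\<mu> n) x - G x) s + flow n (G x) s)
      (\<lambda>s. propagator s (G x)) sequentially" by simp
  then show "uniform_limit {0..\<tau>} (\<lambda>n s. yosida (\<mu> n) (flow n x s)) (\<lambda>s. propagator s (G x)) sequentially"
    by (rule uniform_limit_cong'[THEN iffD1, rotated -1]) (auto simp: flow_diff flow_yosida)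
qed auto

text \<open>The generator extends \<open>G\<close>. If it takes the value \<open>y\<close> at \<open>x\<close>, let \<open>x0\<close> solve \<open>l x0 - G x0 = l x - y\<close>.
  Then \<open>z = x - x0\<close> is an eigenvector of the generator with eigenvalue \<open>l\<close>, which exceeds the growth rate
  \<open>\<kappa>/2\<close> of the semigroup, so \<open>z = 0\<close>.\<close>

lemma generates_propagator: "generates D G propagator"
  unfolding generates_def
proof (intro conjI allI iffI)
  have lim0: "at_right 0 = at (0::real) within {0..1}"
    by (simp add: at_within_Icc_at_right)
  show "C0_semigroup propagator"
    unfolding C0_semigroup_def
  proof (intro conjI allI impI)
    show "propagator 0 = id_blinfun" by (rule propagator_zero)
    show "propagator (s + t) = propagator s o\<^sub>L propagator t" if "0 \<le> s" "0 \<le> t" for s t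
      using that by (intro blinfun_eqI) (simp add: propagator_add)
    show "((\<lambda>t. propagator t x) \<longlongrightarrow> x) (at_right 0)" for x
      using propagator_continuous[where \<tau> = 1 and x = x] by (auto simp: continuous_on_def propagator_zero lim0 dest: bspec[where x = 0])
  qed
  have gen: "((\<lambda>h. (propagator h x - x) /\<^sub>R h) \<longlongrightarrow> G x) (at_right 0)" if "x \<in> D" for x
    using propagator_derivative[OF that, where t = 0 and \<tau> = 1] by (simp add: has_vector_derivative_iff_tendsto propagator_zero lim0)
  show "((\<lambda>h. (propagator h x - x) /\<^sub>R h) \<longlongrightarrow> y) (at_right 0)" if "x \<in> D \<and> y = G x" for x y
    using gen that by simp
  fix x y assume y: "((\<lambda>h. (propagator h x - x) /\<^sub>R h) \<longlongrightarrow> y) (at_right 0)"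
  define l where "l = \<omega> + \<kappa>"
  have l: "\<omega> < l" "\<kappa> < 2 * l" using \<kappa>_pos \<omega> by (auto simp: l_def)
  define x0 where "x0 = resolvent l (l *\<^sub>R x - y)"
  have x0: "x0 \<in> D" "l *\<^sub>R x0 - G x0 = l *\<^sub>R x - y"
    unfolding x0_def using resolvent l by auto
  define z where "z = x - x0"
  have "((\<lambda>h. (propagator h x - x) /\<^sub>R h - (propagator h x0 - x0) /\<^sub>R h) \<longlongrightarrow> y - G x0) (at_right 0)"
    by (intro tendsto_diff y gen x0)
  moreover have "y - G x0 = l *\<^sub>R z" using x0(2) by (simp add: z_def algebra_simps)
  moreover have "(propagator h x - x) /\<^sub>R h - (propagator h x0 - x0) /\<^sub>R h = (propagator h z - z) /\<^sub>R h" for h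
    by (simp add: z_def blinfun.diff_right scaleR_diff_right algebra_simps)
  ultimately have lim_z: "((\<lambda>h. (propagator h z - z) /\<^sub>R h) \<longlongrightarrow> l *\<^sub>R z) (at_right 0)" by simp
  have "2 * b (l *\<^sub>R z) z \<le> \<kappa> * b z z"
  proof (rule tendsto_le)
    show "((\<lambda>h. 2 * b ((propagator h z - z) /\<^sub>R h) z) \<longlongrightarrow> 2 * b (l *\<^sub>R z) z) (at_right 0)"
      by (intro tendsto_intros lim_z)
    have "((\<lambda>h. exp (\<kappa> * h)) has_vector_derivative \<kappa>) (at 0)"
      by (auto intro!: derivative_eq_intros simp: has_real_derivative_iff_has_vector_derivative[symmetric])
    then have "((\<lambda>h. exp (\<kappa> * h)) has_vector_derivative \<kappa>) (at_right 0)"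
      by (rule has_vector_derivative_at_within)
    then have "((\<lambda>h. (exp (\<kappa> * h) - 1) / h) \<longlongrightarrow> \<kappa>) (at_right 0)"
      by (simp add: has_vector_derivative_iff_tendsto divide_inverse_commute)
    then show "((\<lambda>h. (exp (\<kappa> * h) - 1) / h * b z z) \<longlongrightarrow> \<kappa> * b z z) (at_right 0)"
      by (intro tendsto_intros)
    have "2 * b ((propagator h z - z) /\<^sub>R h) z \<le> (exp (\<kappa> * h) - 1) / h * b z z" if "0 < h" for h
    proof -
      have "2 * b (propagator h z - z) z \<le> (exp (\<kappa> * h) - 1) * b z z"
        using b_young[of 1 "propagator h z" z] propagator_b[of h z] that
        by (simp add: blinfun.diff_right inner_diff_left algebra_simps)
      then show ?thesis using that
        by (simp add: blinfun.scaleR_right divide_inverse_commute mult_left_mono mult_ac)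
    qed
    then show "\<forall>\<^sub>F h in at_right 0. 2 * b ((propagator h z - z) /\<^sub>R h) z \<le> (exp (\<kappa> * h) - 1) / h * b z z"
      by (auto simp: eventually_at_filter)
  qed simp
  then have "(2 * l - \<kappa>) * b z z \<le> 0" by (simp add: blinfun.scaleR_right algebra_simps)
  then have "b z z \<le> 0" using l by (simp add: mult_le_0_iff)
  then have "z = 0" by (rule b_zeroD)
  then have "x = x0" by (simp add: z_def)
  then show "x \<in> D" "y = G x" using x0 by (auto simp: algebra_simps)
qed

end

section \<open>Uniqueness of the semigroup\<close>

text \<open>The definition of a semigroup requires continuity at zero only. Boundedness on bounded intervals, and with it
  continuity from the left, comes from the uniform boundedness principle.\<close>

lemma C0_semigroup_bounded_near_0:
  fixes S :: "real \<Rightarrow> 'a::banach \<Rightarrow>\<^sub>L 'a"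
  assumes S: "C0_semigroup S"
  obtains \<delta> C where "0 < \<delta>" "1 \<le> C" "\<And>t. 0 \<le> t \<Longrightarrow> t \<le> \<delta> \<Longrightarrow> norm (S t) \<le> C"
proof -
  have "\<exists>\<delta> C. 0 < \<delta> \<and> 1 \<le> C \<and> (\<forall>t. 0 \<le> t \<and> t \<le> \<delta> \<longrightarrow> norm (S t) \<le> C)"
  proof (rule ccontr)
    assume neg: "\<not> ?thesis"
    have "\<exists>t. 0 \<le> t \<and> t \<le> inverse (real (Suc n)) \<and> real (Suc n) < norm (S t)" for n
      using neg by (smt (verit) inverse_positive_iff_positive of_nat_0_less_iff zero_less_Suc of_nat_Suc of_nat_0_le_iff)
    then obtain t where t: "\<And>n. 0 \<le> t n" "\<And>n. t n \<le> inverse (real (Suc n))" "\<And>n. real (Suc n) < norm (S (t n))"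
      by metis
    have t0: "t \<longlonglongrightarrow> 0"
      using t(1,2) by (intro tendsto_sandwich[OF _ _ tendsto_const LIMSEQ_inverse_real_of_nat]) auto
    have "bounded (range (\<lambda>n. S (t n) x))" for x
    proof -
      have "((\<lambda>t. S t x) \<longlongrightarrow> S 0 x) (at 0 within {0..})"
        using S by (simp add: C0_semigroup_def at_within_Ici_at_right)
      then have "continuous (at 0 within {0..}) (\<lambda>t. S t x)"
        by (simp add: continuous_within)
      then have "(\<lambda>n. S (t n) x) \<longlonglongrightarrow> S 0 x"
        using t(1) t0 by (auto simp: continuous_within_sequentially o_def)
      then show ?thesis by (rule convergent_imp_bounded)
    qed
    then have "bounded (range (\<lambda>n. S (t n)))" by (rule uniform_boundedness)
    then obtain K where "\<And>n. norm (S (t n)) \<le> K" by (auto simp: bounded_iff)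
    moreover obtain n :: nat where "K < real n" using reals_Archimedean2 by blast
    ultimately show False using t(3)[of n] by (smt (verit) of_nat_Suc)
  qed
  then show thesis using that by blast
qed

text \<open>Boundedness near zero propagates by the semigroup law in steps of length \<open>\<delta>\<close>.\<close>

lemma C0_semigroup_bounded:
  fixes S :: "real \<Rightarrow> 'a::banach \<Rightarrow>\<^sub>L 'a"
  assumes S: "C0_semigroup S"
  obtains C where "0 \<le> C" "\<And>t. 0 \<le> t \<Longrightarrow> t \<le> \<tau> \<Longrightarrow> norm (S t) \<le> C"
proof -
  obtain \<delta> C where \<delta>: "0 < \<delta>" and C: "1 \<le> C" "\<And>t. 0 \<le> t \<Longrightarrow> t \<le> \<delta> \<Longrightarrow> norm (S t) \<le> C"
    by (rule C0_semigroup_bounded_near_0[OF S]) blast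
  have pow: "0 \<le> t \<Longrightarrow> t \<le> real k * \<delta> \<Longrightarrow> norm (S t) \<le> C ^ Suc k" for k t
  proof (induction k arbitrary: t)
    case 0
    then show ?case using C \<delta> by simp
  next
    case (Suc k)
    define r where "r = min t \<delta>"
    have "0 \<le> real k * \<delta>" using \<delta> by simp
    then have r: "0 \<le> r" "r \<le> \<delta>" "0 \<le> t - r" "t - r \<le> real k * \<delta>"
      using Suc.prems \<delta> unfolding r_def min_def by (auto simp: algebra_simps)
    have "S t = S r o\<^sub>L S (t - r)"
      using S r unfolding C0_semigroup_def by (metis add_diff_cancel_left' add.commute diff_add_cancel)
    then have "norm (S t) \<le> norm (S r) * norm (S (t - r))" by (simp add: norm_blinfun_compose)
    also have "\<dots> \<le> C * C ^ Suc k"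
      using C r Suc.IH[of "t - r"] by (intro mult_mono) auto
    finally show ?case by simp
  qed
  obtain k :: nat where "\<tau> / \<delta> < real k" using reals_Archimedean2 by blast
  then have "\<tau> \<le> real k * \<delta>" using \<delta> by (simp add: field_simps)
  then show thesis using that[of "C ^ Suc k"] pow C by fastforce
qed

lemma C0_semigroup_continuous:
  fixes S :: "real \<Rightarrow> 'a::banach \<Rightarrow>\<^sub>L 'a"
  assumes S: "C0_semigroup S"
  shows "continuous_on {0..} (\<lambda>t. S t x)"
proof -
  have cont: "continuous_on {0..\<tau>} (\<lambda>t. S t x)" for \<tau>
  proof -
    obtain C where C: "0 \<le> C" "\<And>t. 0 \<le> t \<Longrightarrow> t \<le> \<tau> \<Longrightarrow> norm (S t) \<le> C"
      by (rule C0_semigroup_bounded[OF S, of \<tau>]) blast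
    have step: "norm (S (s + h) x - S s x) \<le> C * norm (S h x - x)" if "0 \<le> s" "0 \<le> h" "s \<le> \<tau>" for s h
    proof -
      have "S (s + h) x - S s x = S s (S h x - x)"
        using S that by (simp add: C0_semigroup_def blinfun.diff_right)
      then have "norm (S (s + h) x - S s x) \<le> norm (S s) * norm (S h x - x)"
        by (simp add: norm_blinfun)
      also have "\<dots> \<le> C * norm (S h x - x)"
        using C that by (intro mult_right_mono) auto
      finally show ?thesis .
    qed
    have lim: "((\<lambda>t. C * norm (S t x - x)) \<longlongrightarrow> C * norm (x - x)) (at_right 0)"
      using S by (intro tendsto_intros) (simp add: C0_semigroup_def)
    show ?thesis
      unfolding continuous_on_iff
    proof (intro ballI allI impI)
      fix s e :: real assume s: "s \<in> {0..\<tau>}" and e: "0 < e"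
      have "\<forall>\<^sub>F t in at_right 0. C * norm (S t x - x) < e"
        using order_tendstoD(2)[OF lim, of e] e by simp
      then obtain d where d: "0 < d" "\<And>h. 0 < h \<Longrightarrow> h < d \<Longrightarrow> C * norm (S h x - x) < e"
        by (auto simp: eventually_at_right_field)
      have "dist (S t x) (S s x) < e" if t: "t \<in> {0..\<tau>}" "dist t s < d" for t
      proof (cases t s rule: linorder_cases)
        case less
        then show ?thesis using step[of t "s - t"] d(2)[of "s - t"] s t
          by (simp add: dist_norm norm_minus_commute dist_real_def)
      next
        case equal
        then show ?thesis using e by simp
      next
        case greater
        then show ?thesis using step[of s "t - s"] d(2)[of "t - s"] s t
          by (simp add: dist_norm dist_real_def)
      qed
      then show "\<exists>d>0. \<forall>t\<in>{0..\<tau>}. dist t s < d \<longrightarrow> dist (S t x) (S s x) < e"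
        using d(1) by blast
    qed
  qed
  show ?thesis
    unfolding continuous_on_eq_continuous_within
  proof
    fix t :: real assume t: "t \<in> {0..}"
    have "continuous (at t within {0..t + 1}) (\<lambda>t. S t x)"
      using cont[of "t + 1"] t by (auto simp: continuous_on_eq_continuous_within)
    moreover have "at t within {0..t + 1} = at t within {0..}"
      using t by (intro at_within_nhd[of t "{..<t + 1}"]) auto
    ultimately show "continuous (at t within {0..}) (\<lambda>t. S t x)"
      by (metis continuous_within)
  qed
qed

lemma generator_invariant:
  fixes S :: "real \<Rightarrow> 'a::banach \<Rightarrow>\<^sub>L 'a"
  assumes gen: "generates D G S" and x: "x \<in> D" and t: "0 \<le> t"
  shows "S t x \<in> D \<and> G (S t x) = S t (G x)"
    and "((\<lambda>h. (S (t + h) x - S t x) /\<^sub>R h) \<longlongrightarrow> S t (G x)) (at_right 0)"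
proof -
  have S: "C0_semigroup S"
    and iff: "\<And>x y. ((\<lambda>h. (S h x - x) /\<^sub>R h) \<longlongrightarrow> y) (at_right 0) \<longleftrightarrow> x \<in> D \<and> y = G x"
    using gen by (auto simp: generates_def)
  have "((\<lambda>h. (S h x - x) /\<^sub>R h) \<longlongrightarrow> G x) (at_right 0)" using iff x by simp
  then have lim: "((\<lambda>h. S t ((S h x - x) /\<^sub>R h)) \<longlongrightarrow> S t (G x)) (at_right 0)"
    by (rule bounded_linear.tendsto[OF blinfun.bounded_linear_right])
  have eq: "\<forall>\<^sub>F h in at_right 0. S t ((S h x - x) /\<^sub>R h) = (S (t + h) x - S t x) /\<^sub>R h"
    using S t by (auto simp: eventually_at_filter C0_semigroup_def blinfun.diff_right blinfun.scaleR_right)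
  show lim1: "((\<lambda>h. (S (t + h) x - S t x) /\<^sub>R h) \<longlongrightarrow> S t (G x)) (at_right 0)"
    using lim tendsto_cong[OF eq] by simp
  have "\<forall>\<^sub>F h in at_right 0. (S (t + h) x - S t x) /\<^sub>R h = (S h (S t x) - S t x) /\<^sub>R h"
    using S t by (auto simp: eventually_at_filter C0_semigroup_def add.commute[of t])
  from tendsto_cong[OF this] lim1
  have "((\<lambda>h. (S h (S t x) - S t x) /\<^sub>R h) \<longlongrightarrow> S t (G x)) (at_right 0)" by simp
  then show "S t x \<in> D \<and> G (S t x) = S t (G x)" using iff by simp
qed

text \<open>The right derivative is part of \<open>generator_invariant\<close>. The left difference quotient at \<open>t\<close> is \<open>S (t - h)\<close> applied to
  the difference quotient at zero, and converges because \<open>S\<close> is bounded near \<open>t\<close>.\<close>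

lemma generates_derivative:
  fixes S :: "real \<Rightarrow> 'a::banach \<Rightarrow>\<^sub>L 'a"
  assumes gen: "generates D G S" and x: "x \<in> D" and t: "0 < t"
  shows "((\<lambda>t. S t x) has_vector_derivative S t (G x)) (at t)"
  unfolding has_vector_derivative_iff_tendsto
proof (rule filterlim_split_at)
  have S: "C0_semigroup S" using gen by (simp add: generates_def)
  show "((\<lambda>s. (S s x - S t x) /\<^sub>R (s - t)) \<longlongrightarrow> S t (G x)) (at_right t)"
    using generator_invariant(2)[OF gen x, of t] t
    by (subst filterlim_at_right_to_0) (simp add: add.commute)
  obtain C where C: "0 \<le> C" "\<And>s. 0 \<le> s \<Longrightarrow> s \<le> t \<Longrightarrow> norm (S s) \<le> C"
    by (rule C0_semigroup_bounded[OF S, of t]) blast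
  have lim_q: "((\<lambda>h. (S h x - x) /\<^sub>R h) \<longlongrightarrow> G x) (at_right 0)"
    using gen x by (auto simp: generates_def)
  have near: "\<forall>\<^sub>F h in at_right 0. 0 < h \<and> h < t"
    using t by (auto simp: eventually_at_right_field)
  have "((\<lambda>h. S (t - h) ((S h x - x) /\<^sub>R h - G x)) \<longlongrightarrow> 0) (at_right 0)"
  proof (rule Lim_null_comparison)
    show "\<forall>\<^sub>F h in at_right 0. norm (S (t - h) ((S h x - x) /\<^sub>R h - G x)) \<le> C * norm ((S h x - x) /\<^sub>R h - G x)"
      using near
    proof eventually_elim
      case (elim h)
      then show ?case
        using norm_blinfun[of "S (t - h)" "(S h x - x) /\<^sub>R h - G x"] C(2)[of "t - h"]
        by (smt (verit) mult_right_mono norm_ge_zero)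
    qed
    show "((\<lambda>h. C * norm ((S h x - x) /\<^sub>R h - G x)) \<longlongrightarrow> 0) (at_right 0)"
      using lim_q by (intro tendsto_mult_right_zero) (simp add: tendsto_norm_zero_iff LIM_zero_iff)
  qed
  moreover have "((\<lambda>h. S (t - h) (G x)) \<longlongrightarrow> S t (G x)) (at_right 0)"
  proof -
    have "isCont (\<lambda>s. S s (G x)) t"
      using C0_semigroup_continuous[OF S, of "G x"] t
      by (intro continuous_on_interior[of "{0..}"]) auto
    moreover have "((\<lambda>h. t - h) \<longlongrightarrow> t - 0) (at_right 0)" by (intro tendsto_intros)
    then have "((\<lambda>h. t - h) \<longlongrightarrow> t) (at_right 0)" by simp
    ultimately show ?thesis by (rule isCont_tendsto_compose)
  qed
  ultimately have "((\<lambda>h. S (t - h) ((S h x - x) /\<^sub>R h - G x) + S (t - h) (G x)) \<longlongrightarrow> 0 + S t (G x)) (at_right 0)"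
    by (rule tendsto_add)
  moreover have "\<forall>\<^sub>F h in at_right 0. S (t - h) ((S h x - x) /\<^sub>R h - G x) + S (t - h) (G x)
      = (S (t - h) x - S t x) /\<^sub>R ((t - h) - t)"
    using near
  proof eventually_elim
    case (elim h)
    then have "S (t - h) (S h x) = S (t - h + h) x"
      using S unfolding C0_semigroup_def by (metis blinfun_apply_blinfun_compose diff_ge_0_iff_ge less_imp_le)
    then show ?case
      by (simp add: blinfun.diff_right blinfun.scaleR_right scaleR_diff_right)
  qed
  ultimately have "((\<lambda>h. (S (t - h) x - S t x) /\<^sub>R ((t - h) - t)) \<longlongrightarrow> S t (G x)) (at_right 0)"
    by (simp add: tendsto_cong)
  then show "((\<lambda>s. (S s x - S t x) /\<^sub>R (s - t)) \<longlongrightarrow> S t (G x)) (at_left t)"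
    by (subst filterlim_at_left_to_right, subst filterlim_at_right_to_0) simp
qed

context dissipative
begin

text \<open>The difference of two orbits that start at the same point of \<open>D\<close> solves \<open>w' = G w\<close> with \<open>w 0 = 0\<close>, so
  its energy vanishes. The general case follows by density.\<close>

lemma generates_unique:
  assumes gen: "generates D G S" and t: "0 \<le> t"
  shows "S t = propagator t"
proof -
  have S: "C0_semigroup S" using gen by (simp add: generates_def)
  have propagator: "C0_semigroup propagator" using generates_propagator by (simp add: generates_def)
  have on_D: "S t x = propagator t x" if x: "x \<in> D" for x
  proof -
    let ?w = "\<lambda>t. S t x - propagator t x"
    have "b (?w t) (?w t) \<le> exp (2 * \<omega> * t) * (b (?w 0) (?w 0) + 0 * t)"
    proof (rule energy_estimate)
      show "continuous_on {0..t} ?w"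
        by (intro continuous_intros continuous_on_subset[OF C0_semigroup_continuous[OF S]]
            continuous_on_subset[OF C0_semigroup_continuous[OF propagator]]) auto
      fix s assume s: "0 < s" "s < t"
      show "(?w has_vector_derivative S s (G x) - propagator s (G x)) (at s)"
        using generates_derivative[OF gen x s(1)] generates_derivative[OF generates_propagator x s(1)]
        by (rule has_vector_derivative_diff)
      have "S s x \<in> D" "propagator s x \<in> D" "S s (G x) - propagator s (G x) = G (S s x - propagator s x)"
        using generator_invariant(1)[OF gen x, of s] generator_invariant(1)[OF generates_propagator x, of s] s
        by (auto simp: G_diff)
      then show "2 * b (S s (G x) - propagator s (G x)) (?w s) \<le> 2 * \<omega> * b (?w s) (?w s) + 0"
        using diss[of "?w s"] D by (simp add: subspace_diff)
    qed (use \<omega> t in auto)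
    also have "\<dots> = 0"
      using S propagator by (simp add: C0_semigroup_def)
    finally show ?thesis using b_zeroD by force
  qed
  have "closed {x. S t x = propagator t x}"
    by (intro closed_Collect_eq continuous_intros)
  then have "closure D \<subseteq> {x. S t x = propagator t x}"
    using on_D by (intro closure_minimal) auto
  then show ?thesis using dense by (intro blinfun_eqI) auto
qed

lemma propagator_jointly_continuous:
  assumes r: "continuous_on X r" and y: "continuous_on X y" and pos: "\<And>s. s \<in> X \<Longrightarrow> 0 \<le> r s"
  shows "continuous_on X (\<lambda>s. propagator (r s) (y s))"
  unfolding continuous_on_def
proof
  fix s assume s: "s \<in> X"
  let ?F = "at s within X"
  have propagator: "C0_semigroup propagator" using generates_propagator by (simp add: generates_def)
  have r': "(r \<longlongrightarrow> r s) ?F" and y': "(y \<longlongrightarrow> y s) ?F"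
    using r y s by (auto simp: continuous_on_def)
  have "((\<lambda>p. propagator (r p) (y p - y s)) \<longlongrightarrow> 0) ?F"
  proof (rule Lim_null_comparison)
    have "\<forall>\<^sub>F p in ?F. r p < r s + 1" using r' by (rule order_tendstoD) simp
    moreover have "\<forall>\<^sub>F p in ?F. p \<in> X" by (simp add: eventually_at_filter)
    ultimately show "\<forall>\<^sub>F p in ?F. norm (propagator (r p) (y p - y s)) \<le> orbit_bound (r s + 1) * norm (y p - y s)"
      by eventually_elim (use pos in \<open>auto intro: propagator_norm\<close>)
    show "((\<lambda>p. orbit_bound (r s + 1) * norm (y p - y s)) \<longlongrightarrow> 0) ?F"
      using y' by (intro tendsto_mult_right_zero) (simp add: tendsto_norm_zero_iff LIM_zero_iff)
  qed
  moreover have "((\<lambda>p. propagator (r p) (y s)) \<longlongrightarrow> propagator (r s) (y s)) ?F"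
  proof -
    have "continuous_on X (\<lambda>p. propagator (r p) (y s))"
      using pos by (intro continuous_on_compose2[OF C0_semigroup_continuous[OF propagator, of "y s"] r]) auto
    then show ?thesis using s by (simp add: continuous_on_def)
  qed
  ultimately have "((\<lambda>p. propagator (r p) (y p - y s) + propagator (r p) (y s)) \<longlongrightarrow> 0 + propagator (r s) (y s)) ?F"
    by (rule tendsto_add)
  then show "((\<lambda>p. propagator (r p) (y p)) \<longlongrightarrow> propagator (r s) (y s)) ?F"
    by (simp add: blinfun.diff_right)
qed

section \<open>The formula of Duhamel\<close>

definition duhamel :: "(real \<Rightarrow> 'a) \<Rightarrow> real \<Rightarrow> 'a" where
  "duhamel k t = integral {0..t} (\<lambda>s. propagator (t - s) (k s))"

lemma duhamel_zero: "t \<le> 0 \<Longrightarrow> duhamel k t = 0"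
  by (cases "t = 0") (auto simp: duhamel_def)

lemma duhamel_integrable:
  assumes "continuous_on {0..t} k"
  shows "(\<lambda>s. propagator (t - s) (k s)) integrable_on {0..t}"
  by (intro integrable_continuous_real propagator_jointly_continuous continuous_intros assms) auto

text \<open>For a function \<open>k\<close> that vanishes for nonpositive times, the integral may be taken over a fixed interval, with \<open>k\<close>
  instead of the semigroup carrying the dependence on \<open>t\<close>. Smoothness of \<open>k\<close> then passes to the
  solution by differentiation under the integral.\<close>

lemma duhamel_reflect:
  assumes k: "continuous_on UNIV k" "\<And>t. t \<le> 0 \<Longrightarrow> k t = 0" and t: "t \<le> R" "0 \<le> R"
  shows "duhamel k t = integral {0..R} (\<lambda>r. propagator r (k (t - r)))"
proof (cases "0 \<le> t")
  case True
  have cont: "continuous_on {a..c} (\<lambda>r. propagator r (k (t - r)))" if "0 \<le> a" for a c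
    using that by (intro propagator_jointly_continuous continuous_intros continuous_on_compose2[OF k(1)]) auto
  have "integral {0..R} (\<lambda>r. propagator r (k (t - r)))
      = integral {0..t} (\<lambda>r. propagator r (k (t - r))) + integral {t..R} (\<lambda>r. propagator r (k (t - r)))"
    using True t cont[of 0 R] by (intro Henstock_Kurzweil_Integration.integral_combine[symmetric] integrable_continuous_real) auto
  also have "integral {t..R} (\<lambda>r. propagator r (k (t - r))) = integral {t..R} (\<lambda>_. 0)"
    by (rule integral_cong) (simp add: k(2) blinfun.zero_right)
  also have "integral {0..t} (\<lambda>r. propagator r (k (t - r))) = duhamel k t"
  proof -
    have "integral {0..t} (\<lambda>r. propagator r (k (t - r))) = integral {-t..-0} (\<lambda>r. propagator (- r) (k (t - - r)))"
      by (rule Henstock_Kurzweil_Integration.integral_reflect_real[symmetric])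
    also have "\<dots> = integral {-t - - t..0 - - t} (\<lambda>s. propagator (- (s + - t)) (k (t - - (s + - t))))"
      using integral_shift_real_ivl[of "-t" "-t" 0 "\<lambda>r. propagator (- r) (k (t - - r))"] by simp
    also have "\<dots> = duhamel k t"
      by (simp add: duhamel_def algebra_simps)
    finally show ?thesis .
  qed
  finally show ?thesis by simp
next
  case False
  have "integral {0..R} (\<lambda>r. propagator r (k (t - r))) = integral {0..R} (\<lambda>_. 0)"
    using False by (intro integral_cong) (simp add: k(2) blinfun.zero_right)
  then show ?thesis using False by (simp add: duhamel_zero)
qed

lemma duhamel_norm_integral:
  assumes k: "continuous_on {0..t} k" and t: "t \<le> \<tau>"
  shows "norm (duhamel k t) \<le> orbit_bound \<tau> * integral {0..t} (\<lambda>s. norm (k s))"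
proof -
  have "norm (duhamel k t) \<le> integral {0..t} (\<lambda>s. orbit_bound \<tau> * norm (k s))"
    unfolding duhamel_def
  proof (rule Henstock_Kurzweil_Integration.integral_norm_bound_integral)
    show "(\<lambda>s. orbit_bound \<tau> * norm (k s)) integrable_on {0..t}"
      by (intro integrable_continuous_real continuous_intros k)
    show "norm (propagator (t - s) (k s)) \<le> orbit_bound \<tau> * norm (k s)" if "s \<in> {0..t}" for s
      using that t by (intro propagator_norm) auto
  qed (rule duhamel_integrable[OF k])
  then show ?thesis by simp
qed

lemma duhamel_continuous:
  assumes k: "continuous_on UNIV k" "\<And>t. t \<le> 0 \<Longrightarrow> k t = 0"
  shows "continuous_on UNIV (duhamel k)"
proof -
  have "continuous_on {..<real n} (duhamel k)" for n
  proof -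
    have "continuous_on ({..<real n} \<times> cbox 0 (real n)) (\<lambda>(t, r). propagator r (k (t - r)))"
      unfolding case_prod_beta
      by (intro propagator_jointly_continuous continuous_intros continuous_on_compose2[OF k(1)]) auto
    then have "continuous_on {..<real n} (\<lambda>t. integral (cbox 0 (real n)) (\<lambda>r. propagator r (k (t - r))))"
      by (rule integral_continuous_on_param)
    then show ?thesis
      by (rule continuous_on_eq) (simp add: duhamel_reflect[OF k, of _ "real n"])
  qed
  then have "continuous_on (\<Union>n. {..<real n}) (duhamel k)"
    by (intro continuous_on_open_UN) auto
  moreover have "(\<Union>n. {..<real n}) = UNIV"
    using reals_Archimedean2 by auto
  ultimately show ?thesis by simp
qed

lemma duhamel_derivative:
  assumes k: "continuous_on UNIV k" "\<And>t. t \<le> 0 \<Longrightarrow> k t = 0"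
    and k': "continuous_on UNIV k'" "\<And>t. t \<le> 0 \<Longrightarrow> k' t = 0"
    and der: "\<And>t. (k has_vector_derivative k' t) (at t)"
  shows "(duhamel k has_vector_derivative duhamel k' t) (at t)"
proof -
  define R where "R = \<bar>t\<bar> + 1"
  have R: "0 \<le> R" "t < R" by (auto simp: R_def)
  have "((\<lambda>t. integral (cbox 0 R) (\<lambda>r. propagator r (k (t - r)))) has_vector_derivative
      integral (cbox 0 R) (\<lambda>r. propagator r (k' (t - r)))) (at t within {..<R})"
  proof (rule leibniz_rule_vector_derivative)
    fix s r :: real
    have "((k \<circ> (\<lambda>s. s - r)) has_vector_derivative 1 *\<^sub>R k' (s - r)) (at s)"
      by (rule vector_diff_chain_at) (auto intro!: derivative_eq_intros der)
    then have "((\<lambda>s. k (s - r)) has_vector_derivative k' (s - r)) (at s within {..<R})"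
      by (auto simp: o_def intro: has_vector_derivative_at_within)
    then show "((\<lambda>s. propagator r (k (s - r))) has_vector_derivative propagator r (k' (s - r))) (at s within {..<R})"
      by (rule bounded_linear.has_vector_derivative[OF blinfun.bounded_linear_right])
    show "(\<lambda>r. propagator r (k (s - r))) integrable_on cbox 0 R"
      by (intro integrable_continuous propagator_jointly_continuous continuous_intros continuous_on_compose2[OF k(1)]) auto
    show "continuous_on ({..<R} \<times> cbox 0 R) (\<lambda>(t, r). propagator r (k' (t - r)))"
      unfolding case_prod_beta
      by (intro propagator_jointly_continuous continuous_intros continuous_on_compose2[OF k'(1)]) auto
  qed (use R in auto)
  then have "((\<lambda>t. integral {0..R} (\<lambda>r. propagator r (k (t - r)))) has_vector_derivative duhamel k' t) (at t within {..<R})"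
    using R by (simp add: duhamel_reflect[OF k', of t R])
  then have "(duhamel k has_vector_derivative duhamel k' t) (at t within {..<R})"
    using R by (elim has_vector_derivative_transform[rotated 2]) (auto simp: duhamel_reflect[OF k, of _ R])
  then show ?thesis
    using R by (simp add: at_within_open[of t "{..<R}"])
qed

text \<open>Applying \<open>propagator e\<close> to the solution at time \<open>t\<close> gives the solution at time \<open>t + e\<close> without the contribution of
  \<open>[t, t + e]\<close>. In the limit this contribution produces \<open>k t\<close>. Only differentiability of the
  solution itself is assumed, so that the lemma also covers right-hand sides that are not \<open>C\<^sup>1\<close>.\<close>

lemma duhamel_generator:
  assumes k: "continuous_on UNIV k" "\<And>t. t \<le> 0 \<Longrightarrow> k t = 0"
    and der: "(duhamel k has_vector_derivative w) (at t)" and w: "t \<le> 0 \<Longrightarrow> w = 0"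
  shows "duhamel k t \<in> D \<and> G (duhamel k t) = w - k t"
proof (cases "t \<le> 0")
  case True
  have "G 0 = 0" using G_scale[of 0 0] D by (simp add: subspace_0)
  then show ?thesis using True D by (simp add: duhamel_zero k(2) w subspace_0)
next
  case False
  let ?z = "duhamel k"
  define avg where "avg e = integral {t..t + e} (\<lambda>s. propagator (t + e - s) (k s))" for e
  have quot: "(propagator e (?z t) - ?z t) /\<^sub>R e = (?z (t + e) - ?z t) /\<^sub>R e - avg e /\<^sub>R e" if e: "0 < e" for e
  proof -
    have int: "(\<lambda>s. propagator (t + e - s) (k s)) integrable_on {0..t + e}"
      by (rule duhamel_integrable[OF continuous_on_subset[OF k(1)]]) auto
    have "?z (t + e) = integral {0..t} (\<lambda>s. propagator (t + e - s) (k s)) + avg e"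
      unfolding duhamel_def avg_def using False e
      by (intro Henstock_Kurzweil_Integration.integral_combine[OF _ _ int, symmetric]) auto
    also have "integral {0..t} (\<lambda>s. propagator (t + e - s) (k s)) = integral {0..t} (\<lambda>s. propagator e (propagator (t - s) (k s)))"
    proof (rule integral_cong)
      fix s assume "s \<in> {0..t}"
      then show "propagator (t + e - s) (k s) = propagator e (propagator (t - s) (k s))"
        using e propagator_add[of e "t - s" "k s"] by (simp add: algebra_simps)
    qed
    also have "\<dots> = propagator e (?z t)"
      using integral_linear[OF duhamel_integrable[OF continuous_on_subset[OF k(1)]] blinfun.bounded_linear_right[of "propagator e"]]
      by (simp add: o_def duhamel_def)
    finally show ?thesis by (simp add: scaleR_diff_right[symmetric])
  qed
  have lim1: "((\<lambda>e. (?z (t + e) - ?z t) /\<^sub>R e) \<longlongrightarrow> w) (at_right 0)"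
  proof -
    have "((\<lambda>s. (?z s - ?z t) /\<^sub>R (s - t)) \<longlongrightarrow> w) (at_right t)"
      using has_vector_derivative_at_within[OF der]
      by (simp add: has_vector_derivative_iff_tendsto)
    then show ?thesis by (subst (asm) filterlim_at_right_to_0) (simp add: add.commute)
  qed
  have lim2: "((\<lambda>e. avg e /\<^sub>R e) \<longlongrightarrow> k t) (at_right 0)"
  proof (rule tendstoI)
    fix d :: real assume d: "0 < d"
    have "continuous_on ({0..} \<times> UNIV) (\<lambda>p. propagator (fst p) (k (snd p)))"
      by (intro propagator_jointly_continuous continuous_intros continuous_on_compose2[OF k(1)]) auto
    then obtain \<delta> where \<delta>: "0 < \<delta>"
      "\<And>p. p \<in> {0..} \<times> UNIV \<Longrightarrow> dist p (0, t) < \<delta> \<Longrightarrow> dist (propagator (fst p) (k (snd p))) (propagator 0 (k t)) < d / 2"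
      using d unfolding continuous_on_iff by (metis (no_types, lifting) SigmaI UNIV_I atLeast_iff fst_conv half_gt_zero order_refl snd_conv)
    have close: "norm (propagator r (k s) - k t) \<le> d / 2" if "0 \<le> r" "r < \<delta> / 2" "\<bar>s - t\<bar> < \<delta> / 2" for r s
    proof -
      have "dist (r, s) (0, t) \<le> \<bar>r\<bar> + \<bar>s - t\<bar>"
        using sqrt_sum_squares_le_sum_abs[of r "s - t"] by (simp add: dist_Pair_Pair dist_real_def)
      also have "\<dots> < \<delta>" using that by simp
      finally show ?thesis
        using \<delta>(2)[of "(r, s)"] that by (simp add: dist_norm propagator_zero)
    qed
    have "dist (avg e /\<^sub>R e) (k t) < d" if e: "0 < e" "e < \<delta> / 2" for e
    proof -
      have int: "(\<lambda>s. propagator (t + e - s) (k s)) integrable_on {t..t + e}"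
        by (intro integrable_continuous_real propagator_jointly_continuous continuous_intros continuous_on_subset[OF k(1)]) auto
      have "norm (integral {t..t + e} (\<lambda>s. propagator (t + e - s) (k s) - k t)) \<le> integral {t..t + e} (\<lambda>_. d / 2)"
        using e by (intro Henstock_Kurzweil_Integration.integral_norm_bound_integral close integrable_diff int) auto
      moreover have "integral {t..t + e} (\<lambda>s. propagator (t + e - s) (k s) - k t) = avg e - e *\<^sub>R k t"
        using e by (simp add: avg_def Henstock_Kurzweil_Integration.integral_diff[OF int integrable_const_ivl])
      ultimately have "norm (avg e - e *\<^sub>R k t) \<le> e * (d / 2)" using e by simp
      then have "inverse e * norm (avg e - e *\<^sub>R k t) \<le> d / 2"
        using e by (simp add: field_simps)
      moreover have "avg e /\<^sub>R e - k t = (avg e - e *\<^sub>R k t) /\<^sub>R e"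
        using e by (simp add: scaleR_diff_right)
      ultimately show ?thesis using e d by (simp add: dist_norm)
    qed
    then show "\<forall>\<^sub>F e in at_right 0. dist (avg e /\<^sub>R e) (k t) < d"
      using \<delta>(1) by (auto simp: eventually_at_right_field intro!: exI[of _ "\<delta> / 2"])
  qed
  have "((\<lambda>e. (propagator e (?z t) - ?z t) /\<^sub>R e) \<longlongrightarrow> w - k t) (at_right 0)"
    using tendsto_diff[OF lim1 lim2]
    by (rule Lim_transform_eventually) (auto simp: eventually_at_filter quot)
  then show ?thesis using generates_propagator by (auto simp: generates_def)
qed

end

section \<open>Causal functions\<close>

definition time_deriv :: "(real \<Rightarrow> 'a::real_normed_vector) \<Rightarrow> real \<Rightarrow> 'a" where
  "time_deriv h t = vector_derivative h (at t)"

lemma time_deriv_eq: "(\<And>t. (h has_vector_derivative h' t) (at t)) \<Longrightarrow> time_deriv h = h'"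
  by (rule ext) (simp add: time_deriv_def vector_derivative_at)

text \<open>The functions on the real line that vanish for nonpositive times and are \<open>k\<close> times continuously differentiable, with all
  derivatives bounded by \<open>K\<close> up to time \<open>T\<close>. Working on the whole line makes all derivatives two-sided,
  and the vanishing for \<open>t \<le> 0\<close> encodes the initial values of all derivatives.\<close>

fun causal :: "real \<Rightarrow> nat \<Rightarrow> real \<Rightarrow> (real \<Rightarrow> 'a::real_normed_vector) \<Rightarrow> bool" where
  "causal T 0 K h \<longleftrightarrow> continuous_on UNIV h \<and> (\<forall>t\<le>0. h t = 0) \<and> (\<forall>t\<le>T. norm (h t) \<le> K)"
| "causal T (Suc k) K h \<longleftrightarrow> causal T 0 K h \<and> (\<forall>t. h differentiable at t) \<and> causal T k K (time_deriv h)"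

lemma causal_0: "causal T k K h \<Longrightarrow> causal T 0 K h"
  by (cases k) auto

lemma causal_continuous: "causal T k K h \<Longrightarrow> continuous_on UNIV h"
  and causal_zero: "causal T k K h \<Longrightarrow> t \<le> 0 \<Longrightarrow> h t = 0"
  and causal_bound: "causal T k K h \<Longrightarrow> t \<le> T \<Longrightarrow> norm (h t) \<le> K"
  using causal_0[of T k K h] by auto

lemma causal_derivative: "causal T (Suc k) K h \<Longrightarrow> (h has_vector_derivative time_deriv h t) (at t)"
  by (simp add: time_deriv_def vector_derivative_works[symmetric])

lemma causal_lower: "causal T (Suc k) K h \<Longrightarrow> causal T k K h"
  by (induction k arbitrary: h) auto

lemma causal_le: "causal T k K h \<Longrightarrow> j \<le> k \<Longrightarrow> causal T j K h"
proof (induction k)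
  case (Suc k)
  then show ?case using causal_lower[of T k K h] by (cases "j = Suc k") auto
qed simp

lemma causal_mono: "causal T k K h \<Longrightarrow> K \<le> K' \<Longrightarrow> causal T k K' h"
  by (induction k arbitrary: h) (auto intro: order_trans)

lemma causal_SucI:
  assumes "causal T 0 K h" "\<And>t. (h has_vector_derivative h' t) (at t)" "causal T k K h'"
  shows "causal T (Suc k) K h"
  using assms time_deriv_eq[OF assms(2)] differentiableI_vector[OF assms(2)] by simp

lemma causal_K_nonneg: "causal T k K h \<Longrightarrow> 0 \<le> T \<Longrightarrow> 0 \<le> K"
  using causal_bound[of T k K h T] norm_ge_zero order_trans by blast

lemma causal_blinfun:
  assumes "0 \<le> T" "causal T k K h"
  shows "causal T k (norm L * K) (\<lambda>t. blinfun_apply L (h t))"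
  using assms(2)
proof (induction k arbitrary: h)
  case 0
  show ?case
    using 0 by (auto intro!: continuous_intros order_trans[OF norm_blinfun] mult_left_mono simp: blinfun.zero_right)
next
  case (Suc k)
  show ?case
  proof (rule causal_SucI)
    show "causal T 0 (norm L * K) (\<lambda>t. L (h t))"
      using causal_0[OF Suc.prems]
      by (auto intro!: continuous_intros order_trans[OF norm_blinfun] mult_left_mono simp: blinfun.zero_right)
    show "((\<lambda>t. L (h t)) has_vector_derivative L (time_deriv h t)) (at t)" for t
      using causal_derivative[OF Suc.prems] by (rule bounded_linear.has_vector_derivative[OF blinfun.bounded_linear_right])
    show "causal T k (norm L * K) (\<lambda>t. L (time_deriv h t))"
      using Suc by simp
  qed
qed

lemma causal_add:
  assumes "causal T k K h" "causal T k K' g"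
  shows "causal T k (K + K') (\<lambda>t. h t + g t)"
  using assms
proof (induction k arbitrary: h g)
  case 0
  then show ?case by (auto intro!: continuous_intros norm_triangle_mono)
next
  case (Suc k)
  show ?case
  proof (rule causal_SucI)
    show "causal T 0 (K + K') (\<lambda>t. h t + g t)"
      using causal_0[OF Suc.prems(1)] causal_0[OF Suc.prems(2)] by (auto intro!: continuous_intros norm_triangle_mono)
    show "((\<lambda>t. h t + g t) has_vector_derivative time_deriv h t + time_deriv g t) (at t)" for t
      using causal_derivative[OF Suc.prems(1)] causal_derivative[OF Suc.prems(2)] by (rule has_vector_derivative_add)
    show "causal T k (K + K') (\<lambda>t. time_deriv h t + time_deriv g t)"
      using Suc by simp
  qed
qed

lemma causal_uminus:
  assumes "causal T k K h"
  shows "causal T k K (\<lambda>t. - h t)"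
  using assms
proof (induction k arbitrary: h)
  case 0
  then show ?case by (auto intro!: continuous_intros)
next
  case (Suc k)
  show ?case
  proof (rule causal_SucI)
    show "causal T 0 K (\<lambda>t. - h t)"
      using causal_0[OF Suc.prems(1)] by (auto intro!: continuous_intros)
    show "((\<lambda>t. - h t) has_vector_derivative - time_deriv h t) (at t)" for t
      using causal_derivative[OF Suc.prems(1)] by (rule has_vector_derivative_minus)
    show "causal T k K (\<lambda>t. - time_deriv h t)"
      using Suc by simp
  qed
qed

section \<open>The evolution equation for a fixed parameter\<close>

locale evolution_problem =
  fixes D :: "'a::{real_inner,banach} set" and A :: "'a \<Rightarrow> 'a" and Q :: "'a \<Rightarrow>\<^sub>L 'a"
    and bmin bmax :: real
  assumes A: "maximal_monotone D A" and bmin: "0 < bmin" and bmin_le: "bmin \<le> bmax"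
begin

abbreviation PD :: "'a sa_op set" where "PD \<equiv> param_domain bmin bmax"

definition gen :: "'a sa_op \<Rightarrow> 'a \<Rightarrow> 'a" where
  "gen B x = - (inv (blinfun_of B) (A x) + Q x)"

text \<open>The shift that makes \<open>- (B\<inverse> A + Q)\<close> dissipative, see \<open>BQ_bound\<close>. It does not depend on \<open>B\<close>.\<close>

definition \<omega> :: real where "\<omega> = bmax * ((norm Q)\<^sup>2 + 1) / (2 * bmin)"

lemma weight: "B \<in> PD \<Longrightarrow> coercive_weight B bmin bmax"
  using bmin bmin_le by unfold_locales auto

lemma B_surj: "B \<in> PD \<Longrightarrow> \<exists>x. blinfun_of B x = y"
proof -
  assume B: "B \<in> PD"
  have "maximal_monotone UNIV (\<lambda>_::'a. 0::'a)" by (simp add: maximal_monotone_def)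
  from coercive_plus_maximal_monotone_onto[OF this bmin coercive_weight.b_lower[OF weight[OF B]], of y]
  show ?thesis by auto
qed

lemma B_inj:
  assumes B: "B \<in> PD"
  shows "inj (blinfun_of B)"
proof (rule injI)
  fix x y assume "blinfun_of B x = blinfun_of B y"
  then have "inner (blinfun_of B (x - y)) (x - y) \<le> 0" by (simp add: blinfun.diff_right)
  then show "x = y" using coercive_weight.b_zeroD[OF weight[OF B]] by force
qed

lemma B_inv: "B \<in> PD \<Longrightarrow> blinfun_of B (inv (blinfun_of B) y) = y" "B \<in> PD \<Longrightarrow> inv (blinfun_of B) (blinfun_of B x) = x"
  using B_surj B_inj by (auto intro!: f_inv_into_f simp: image_iff) (metis)

lemma B_inv_norm:
  assumes B: "B \<in> PD"
  shows "norm (inv (blinfun_of B) y) \<le> 1 / bmin * norm y"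
proof -
  let ?x = "inv (blinfun_of B) y"
  have "bmin * (norm ?x)\<^sup>2 \<le> inner y ?x"
    using coercive_weight.b_lower[OF weight[OF B], of ?x] B_inv(1)[OF B] by simp
  also have "\<dots> \<le> norm y * norm ?x" by (rule norm_cauchy_schwarz)
  finally have "bmin * norm ?x * norm ?x \<le> norm y * norm ?x"
    by (simp add: power2_eq_square mult.assoc)
  then have "bmin * norm ?x \<le> norm y"
    by (cases "norm ?x = 0") (simp, simp add: mult_le_cancel_right)
  then show ?thesis using bmin by (simp add: field_simps)
qed

lemma B_inv_linear:
  assumes B: "B \<in> PD"
  shows "bounded_linear (inv (blinfun_of B))"
proof (rule bounded_linear_intro)
  show "inv (blinfun_of B) (x + y) = inv (blinfun_of B) x + inv (blinfun_of B) y" for x y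
    using B_inv[OF B] by (metis blinfun.add_right)
  show "inv (blinfun_of B) (c *\<^sub>R x) = c *\<^sub>R inv (blinfun_of B) x" for c x
    using B_inv[OF B] by (metis blinfun.scaleR_right)
  show "norm (inv (blinfun_of B) y) \<le> norm y * (1 / bmin)" for y
    using B_inv_norm[OF B] by (simp add: mult.commute)
qed

definition Binv :: "'a sa_op \<Rightarrow> 'a \<Rightarrow>\<^sub>L 'a" where
  "Binv B = Blinfun (inv (blinfun_of B))"

lemma Binv_apply: "B \<in> PD \<Longrightarrow> Binv B x = inv (blinfun_of B) x"
  by (simp add: Binv_def bounded_linear_Blinfun_apply B_inv_linear)

lemma Binv: "B \<in> PD \<Longrightarrow> blinfun_of B (Binv B y) = y" "B \<in> PD \<Longrightarrow> Binv B (blinfun_of B x) = x"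
  by (simp_all add: Binv_apply B_inv)

lemma B_gen: "B \<in> PD \<Longrightarrow> blinfun_of B (gen B x) = - A x - blinfun_of B (Q x)"
  by (simp add: gen_def blinfun.minus_right blinfun.add_right blinfun.diff_right B_inv)

lemma \<omega>: "0 \<le> \<omega>"
  using bmin bmin_le by (simp add: \<omega>_def)

lemma BQ_bound:
  assumes B: "B \<in> PD"
  shows "- inner (blinfun_of B (Q x)) x \<le> \<omega> * inner (blinfun_of B x) x"
proof -
  interpret coercive_weight B bmin bmax using B by (rule weight)
  have "2 * b (Q x) (- x) \<le> 1 * b (Q x) (Q x) + b (- x) (- x) / 1"
    by (rule b_young) simp
  also have "\<dots> = b (Q x) (Q x) + b x x" by (simp add: blinfun.minus_right)
  also have "\<dots> \<le> bmax * (norm Q * norm x)\<^sup>2 + bmax * (norm x)\<^sup>2"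
  proof (intro add_mono b_upper)
    have "b (Q x) (Q x) \<le> bmax * (norm (Q x))\<^sup>2" by (rule b_upper)
    also have "\<dots> \<le> bmax * (norm Q * norm x)\<^sup>2"
      using bmin bmin_le by (intro mult_left_mono power_mono norm_blinfun) auto
    finally show "b (Q x) (Q x) \<le> \<dots>" .
  qed
  also have "\<dots> = 2 * \<omega> * (bmin * (norm x)\<^sup>2)"
    using bmin by (simp add: \<omega>_def field_simps)
  also have "\<dots> \<le> 2 * \<omega> * b x x"
    using \<omega> by (intro mult_left_mono b_lower) auto
  finally show ?thesis by simp
qed

lemma A_lin: "x \<in> D \<Longrightarrow> y \<in> D \<Longrightarrow> A (x + y) = A x + A y" "x \<in> D \<Longrightarrow> A (c *\<^sub>R x) = c *\<^sub>R A x"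
  and A_pos: "x \<in> D \<Longrightarrow> 0 \<le> inner (A x) x" and D: "subspace D"
  using A by (auto simp: maximal_monotone_def)

text \<open>After multiplication by \<open>B\<close>, the range condition concerns \<open>l B + B Q + A\<close>, where
  \<open>l B + B Q\<close> is bounded and coercive for \<open>l > \<omega>\<close>.\<close>

lemma dissipative: "B \<in> PD \<Longrightarrow> dissipative B bmin bmax D (gen B) \<omega>"
proof -
  assume B: "B \<in> PD"
  interpret coercive_weight B bmin bmax using B by (rule weight)
  interpret I: bounded_linear "inv (blinfun_of B)" using B by (rule B_inv_linear)
  show ?thesis
  proof unfold_locales
    show "closure D = UNIV" using A by (rule maximal_monotone_dense)
    show "b (gen B x) x \<le> \<omega> * b x x" if "x \<in> D" for x
      using BQ_bound[OF B, of x] A_pos[OF that] by (simp add: B_gen[OF B] inner_diff_left)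
    show "gen B (x + y) = gen B x + gen B y" if "x \<in> D" "y \<in> D" for x y
      using that by (simp add: gen_def A_lin I.add blinfun.add_right)
    show "gen B (c *\<^sub>R x) = c *\<^sub>R gen B x" if "x \<in> D" for c x
      using that by (simp add: gen_def A_lin I.scaleR blinfun.scaleR_right scaleR_add_right scaleR_diff_right)
    fix l y assume l: "\<omega> < l"
    let ?P = "l *\<^sub>R blinfun_of B + (blinfun_of B o\<^sub>L Q)"
    have "\<exists>x\<in>D. ?P x + A x = blinfun_of B y"
    proof (rule coercive_plus_maximal_monotone_onto[OF A])
      show "0 < (l - \<omega>) * bmin" using l bmin by simp
      fix x
      have "(l - \<omega>) * bmin * (norm x)\<^sup>2 \<le> (l - \<omega>) * b x x"
        using l mult_left_mono[OF b_lower[of x], of "l - \<omega>"] by (simp add: mult.assoc)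
      also have "\<dots> \<le> inner (?P x) x"
        using BQ_bound[OF B, of x] by (simp add: blinfun.add_left blinfun.scaleR_left inner_add_left algebra_simps)
      finally show "(l - \<omega>) * bmin * (norm x)\<^sup>2 \<le> inner (?P x) x" .
    qed
    then obtain x where x: "x \<in> D" "l *\<^sub>R blinfun_of B x + blinfun_of B (Q x) + A x = blinfun_of B y"
      by (auto simp: blinfun.add_left blinfun.scaleR_left)
    then have "blinfun_of B (l *\<^sub>R x - gen B x) = blinfun_of B y"
      by (simp add: blinfun.diff_right blinfun.scaleR_right B_gen[OF B] algebra_simps)
    then have "l *\<^sub>R x - gen B x = y" using B_inj[OF B] by (auto dest: injD)
    then show "\<exists>x\<in>D. l *\<^sub>R x - gen B x = y" using x(1) by blast
  qed (use D \<omega> in auto)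
qed

text \<open>The constant \<open>orbit_bound\<close> of the semigroup, written out to show that it is the same for all parameters.\<close>

definition growth :: "real \<Rightarrow> real" where
  "growth \<tau> = sqrt (exp ((4 * \<omega> + 1) * \<tau>) * bmax / bmin)"

text \<open>The mild solution with initial value zero.\<close>

definition sol :: "'a sa_op \<Rightarrow> (real \<Rightarrow> 'a) \<Rightarrow> real \<Rightarrow> 'a" where
  "sol B h = dissipative.duhamel D (gen B) \<omega> (\<lambda>s. Binv B (h s))"

lemma growth_nonneg: "0 \<le> growth \<tau>"
  using bmin bmin_le by (simp add: growth_def)

lemma growth_eq: "B \<in> PD \<Longrightarrow> dissipative.orbit_bound bmin bmax \<omega> \<tau> = growth \<tau>"
  by (simp add: growth_def dissipative.orbit_bound_def[OF dissipative] dissipative.\<kappa>_def[OF dissipative])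

lemma sol_zero: "B \<in> PD \<Longrightarrow> t \<le> 0 \<Longrightarrow> sol B h t = 0"
  by (simp add: sol_def dissipative.duhamel_zero[OF dissipative])

text \<open>The estimate by the \<open>L\<^sup>1\<close> norm of the right-hand side, which is what a right-hand side in \<open>W\<^sup>1\<^sup>,\<^sup>1\<close> needs.\<close>

lemma sol_norm_integral:
  assumes B: "B \<in> PD" and h: "continuous_on {0..t} h" and t: "t \<le> \<tau>"
  shows "norm (sol B h t) \<le> growth \<tau> / bmin * integral {0..t} (\<lambda>s. norm (h s))"
proof -
  have "norm (sol B h t) \<le> growth \<tau> * integral {0..t} (\<lambda>s. norm (Binv B (h s)))"
    unfolding sol_def growth_eq[OF B, symmetric]
    by (rule dissipative.duhamel_norm_integral[OF dissipative[OF B] _ t]) (intro continuous_intros h)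
  also have "\<dots> \<le> growth \<tau> * integral {0..t} (\<lambda>s. 1 / bmin * norm (h s))"
  proof (intro mult_left_mono Henstock_Kurzweil_Integration.integral_le growth_nonneg)
    show "norm (Binv B (h s)) \<le> 1 / bmin * norm (h s)" for s
      using B_inv_norm[OF B] by (simp add: Binv_apply[OF B])
  qed (intro integrable_continuous_real continuous_intros h)+
  finally show ?thesis by simp
qed

definition sol_const :: "real \<Rightarrow> real" where
  "sol_const T = growth T / bmin * T"

lemma sol_const_nonneg: "0 \<le> T \<Longrightarrow> 0 \<le> sol_const T"
  using growth_nonneg[of T] bmin by (simp add: sol_const_def)

lemma sol_bound:
  assumes B: "B \<in> PD" and h: "continuous_on UNIV h" and K: "\<And>s. s \<le> T \<Longrightarrow> norm (h s) \<le> K"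
    and t: "t \<le> T" and T: "0 \<le> T"
  shows "norm (sol B h t) \<le> sol_const T * K"
proof (cases "0 \<le> t")
  case True
  have K0: "0 \<le> K" using K[OF t] norm_ge_zero order_trans by blast
  have h': "continuous_on {0..t} h" using h by (rule continuous_on_subset) auto
  have "integral {0..t} (\<lambda>s. norm (h s)) \<le> integral {0..t} (\<lambda>_. K)"
    using t K by (intro Henstock_Kurzweil_Integration.integral_le integrable_continuous_real continuous_intros h') auto
  also have "\<dots> \<le> T * K" using True t K0 by (simp add: mult_right_mono)
  finally have "growth T / bmin * integral {0..t} (\<lambda>s. norm (h s)) \<le> growth T / bmin * (T * K)"
    using growth_nonneg bmin by (intro mult_left_mono) auto
  with sol_norm_integral[OF B h' t] show ?thesis by (simp add: sol_const_def)
next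
  case False
  have K0: "0 \<le> K" using K[OF t] norm_ge_zero order_trans by blast
  show ?thesis using False K0 sol_const_nonneg[OF T] by (simp add: sol_zero[OF B])
qed

lemma sol_continuous:
  assumes B: "B \<in> PD" and h: "causal T 0 K h"
  shows "continuous_on UNIV (sol B h)"
  unfolding sol_def using h
  by (intro dissipative.duhamel_continuous[OF dissipative[OF B]] continuous_intros) (auto simp: blinfun.zero_right)

lemma sol_derivative:
  assumes B: "B \<in> PD" and h: "causal T (Suc 0) K h"
  shows "(sol B h has_vector_derivative sol B (time_deriv h) t) (at t)"
proof -
  have h': "causal T 0 K (time_deriv h)" using h by simp
  show ?thesis
    unfolding sol_def
    by (rule dissipative.duhamel_derivative[OF dissipative[OF B]])
      (auto intro!: continuous_intros causal_continuous[OF h] causal_continuous[OF h']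
        bounded_linear.has_vector_derivative[OF blinfun.bounded_linear_right causal_derivative[OF h]]
        simp: causal_zero[OF h] causal_zero[OF h'] blinfun.zero_right)
qed

lemma time_deriv_sol: "B \<in> PD \<Longrightarrow> causal T (Suc 0) K h \<Longrightarrow> time_deriv (sol B h) = sol B (time_deriv h)"
  by (rule time_deriv_eq[OF sol_derivative])

lemma sol_equation_of_derivative:
  assumes B: "B \<in> PD" and h: "causal T 0 K h"
    and der: "(sol B h has_vector_derivative w) (at t)" and w: "t \<le> 0 \<Longrightarrow> w = 0"
  shows "sol B h t \<in> D"
    and "blinfun_of B w + A (sol B h t) + blinfun_of B (Q (sol B h t)) = h t"
proof -
  have *: "sol B h t \<in> D \<and> gen B (sol B h t) = w - Binv B (h t)"
    using der w unfolding sol_def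
    by (intro dissipative.duhamel_generator[OF dissipative[OF B]] continuous_intros causal_continuous[OF h])
      (auto simp: causal_zero[OF h] blinfun.zero_right)
  then show "sol B h t \<in> D" by simp
  have "blinfun_of B (gen B (sol B h t)) = blinfun_of B w - h t"
    using * by (simp add: blinfun.diff_right Binv[OF B])
  then show "blinfun_of B w + A (sol B h t) + blinfun_of B (Q (sol B h t)) = h t"
    by (simp add: B_gen[OF B] algebra_simps)
qed

lemma sol_equation:
  assumes B: "B \<in> PD" and h: "causal T (Suc 0) K h"
  shows "sol B h t \<in> D"
    and "blinfun_of B (time_deriv (sol B h) t) + A (sol B h t) + blinfun_of B (Q (sol B h t)) = h t"
  using sol_equation_of_derivative[OF B causal_0[OF h] sol_derivative[OF B h, of t] sol_zero[OF B]]
  by (simp_all add: time_deriv_sol[OF B h])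

text \<open>Time derivatives commute with the solution operator on causal functions, so the bound for the solution applies to each
  derivative.\<close>

lemma causal_sol:
  assumes B: "B \<in> PD" and T: "0 \<le> T"
  shows "causal T k K h \<Longrightarrow> causal T k (sol_const T * K) (sol B h)"
proof (induction k arbitrary: h)
  case 0
  then show ?case
    using sol_continuous[OF B 0] sol_bound[OF B _ _ _ T, of h K] by (simp add: sol_zero[OF B])
next
  case (Suc k)
  have h1: "causal T (Suc 0) K h" using Suc.prems by (rule causal_le) simp
  have h0: "causal T 0 K h" using Suc.prems by (rule causal_0)
  show ?case
  proof (rule causal_SucI)
    show "(sol B h has_vector_derivative sol B (time_deriv h) t) (at t)" for t
      using sol_derivative[OF B h1] .
    show "causal T k (sol_const T * K) (sol B (time_deriv h))" using Suc by simp
    show "causal T 0 (sol_const T * K) (sol B h)"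
      using sol_continuous[OF B h0] sol_bound[OF B causal_continuous[OF h0] causal_bound[OF h0] _ T]
      by (simp add: sol_zero[OF B])
  qed
qed

lemma sol_lin:
  assumes B: "B \<in> PD" and h: "continuous_on UNIV h" and g: "continuous_on UNIV g"
  shows "sol B (\<lambda>t. h t + g t) t = sol B h t + sol B g t"
    and "sol B (\<lambda>t. c *\<^sub>R h t) t = c *\<^sub>R sol B h t"
proof -
  note dis = dissipative[OF B]
  have int: "(\<lambda>s. dissipative.propagator D (gen B) \<omega> (t - s) (Binv B (h s))) integrable_on {0..t}"
    if "continuous_on UNIV h" for h
    by (intro dissipative.duhamel_integrable[OF dis] continuous_intros continuous_on_subset[OF that]) auto
  show "sol B (\<lambda>t. h t + g t) t = sol B h t + sol B g t"
    unfolding sol_def dissipative.duhamel_def[OF dis]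
    by (simp add: blinfun.add_right Henstock_Kurzweil_Integration.integral_add[OF int[OF h] int[OF g]])
  show "sol B (\<lambda>t. c *\<^sub>R h t) t = c *\<^sub>R sol B h t"
    unfolding sol_def dissipative.duhamel_def[OF dis]
    by (simp add: blinfun.scaleR_right)
qed

lemma classical_unique:
  assumes B: "B \<in> PD" and t: "0 \<le> t" "t \<le> \<tau>"
    and z: "continuous_on {0..\<tau>} z" "\<And>s. 0 < s \<Longrightarrow> s < \<tau> \<Longrightarrow> (z has_vector_derivative z' s) (at s)"
      "\<And>s. 0 < s \<Longrightarrow> s < \<tau> \<Longrightarrow> z s \<in> D"
      "\<And>s. 0 < s \<Longrightarrow> s < \<tau> \<Longrightarrow> blinfun_of B (z' s) + A (z s) + blinfun_of B (Q (z s)) = h s"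
    and w: "continuous_on {0..\<tau>} w" "\<And>s. 0 < s \<Longrightarrow> s < \<tau> \<Longrightarrow> (w has_vector_derivative w' s) (at s)"
      "\<And>s. 0 < s \<Longrightarrow> s < \<tau> \<Longrightarrow> w s \<in> D"
      "\<And>s. 0 < s \<Longrightarrow> s < \<tau> \<Longrightarrow> blinfun_of B (w' s) + A (w s) + blinfun_of B (Q (w s)) = h s"
    and 0: "z 0 = w 0"
  shows "z t = w t"
proof -
  interpret dissipative B bmin bmax D "gen B" \<omega> using B by (rule dissipative)
  let ?d = "\<lambda>s. z s - w s"
  have "b (?d t) (?d t) \<le> exp (2 * \<omega> * t) * (b (?d 0) (?d 0) + 0 * t)"
  proof (rule energy_estimate)
    show "continuous_on {0..\<tau>} ?d" by (intro continuous_intros z w)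
    fix s assume s: "0 < s" "s < \<tau>"
    show "(?d has_vector_derivative z' s - w' s) (at s)"
      using z(2)[OF s] w(2)[OF s] by (rule has_vector_derivative_diff)
    have "blinfun_of B (z' s - w' s) = blinfun_of B (gen B (z s) - gen B (w s))"
    proof -
      have "blinfun_of B (z' s) = h s - A (z s) - blinfun_of B (Q (z s))"
        and "blinfun_of B (w' s) = h s - A (w s) - blinfun_of B (Q (w s))"
        using z(4)[OF s] w(4)[OF s] by (auto simp: algebra_simps)
      then show ?thesis by (simp add: blinfun.diff_right B_gen[OF B])
    qed
    then have "b (z' s - w' s) (?d s) = b (gen B (?d s)) (?d s)"
      using z(3)[OF s] w(3)[OF s] by (simp add: G_diff)
    moreover have "?d s \<in> D" using z(3)[OF s] w(3)[OF s] D by (simp add: subspace_diff)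
    ultimately show "2 * b (z' s - w' s) (?d s) \<le> 2 * \<omega> * b (?d s) (?d s) + 0"
      using diss[of "?d s"] by simp
  qed (use \<omega> t in auto)
  then have "b (?d t) (?d t) \<le> 0" using 0 by simp
  then show ?thesis using b_zeroD by force
qed

text \<open>The factor of \<open>B\<close> in the equation, and hence the quantity on which a change of the parameter acts.\<close>

definition velocity :: "'a sa_op \<Rightarrow> (real \<Rightarrow> 'a) \<Rightarrow> real \<Rightarrow> 'a" where
  "velocity B h t = time_deriv (sol B h) t + Q (sol B h t)"

definition vel_const :: "real \<Rightarrow> real" where
  "vel_const T = sol_const T * (1 + norm Q)"

lemma vel_const_nonneg: "0 \<le> T \<Longrightarrow> 0 \<le> vel_const T"
  using sol_const_nonneg[of T] by (simp add: vel_const_def)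

lemma causal_velocity:
  assumes B: "B \<in> PD" and T: "0 \<le> T" and h: "causal T (Suc k) K h"
  shows "causal T k (vel_const T * K) (velocity B h)"
proof -
  have "causal T k (sol_const T * K + norm Q * (sol_const T * K)) (\<lambda>t. time_deriv (sol B h) t + Q (sol B h t))"
    using causal_sol[OF B T h] causal_lower[OF causal_sol[OF B T h]]
    by (intro causal_add causal_blinfun T) simp_all
  then show ?thesis by (simp add: velocity_def[abs_def] vel_const_def algebra_simps)
qed

lemma velocity_lin:
  assumes B: "B \<in> PD" and h: "causal T (Suc 0) K h" and g: "causal T (Suc 0) K' g"
  shows "velocity B (\<lambda>t. h t + g t) t = velocity B h t + velocity B g t"
    and "velocity B (\<lambda>t. c *\<^sub>R h t) t = c *\<^sub>R velocity B h t"
proof -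
  have hg: "sol B (\<lambda>t. h t + g t) = (\<lambda>t. sol B h t + sol B g t)"
    and ch: "sol B (\<lambda>t. c *\<^sub>R h t) = (\<lambda>t. c *\<^sub>R sol B h t)"
    using sol_lin[OF B causal_continuous[OF h] causal_continuous[OF g]] by auto
  have dh: "(sol B h has_vector_derivative time_deriv (sol B h) t) (at t)"
    and dg: "(sol B g has_vector_derivative time_deriv (sol B g) t) (at t)" for t
    using sol_derivative[OF B h] sol_derivative[OF B g] time_deriv_sol[OF B h] time_deriv_sol[OF B g] by simp_all
  have "time_deriv (\<lambda>t. sol B h t + sol B g t) = (\<lambda>t. time_deriv (sol B h) t + time_deriv (sol B g) t)"
    by (rule time_deriv_eq, rule has_vector_derivative_add[OF dh dg])
  then show "velocity B (\<lambda>t. h t + g t) t = velocity B h t + velocity B g t"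
    by (simp add: velocity_def hg blinfun.add_right)
  have "time_deriv (\<lambda>t. c *\<^sub>R sol B h t) = (\<lambda>t. c *\<^sub>R time_deriv (sol B h) t)"
    by (rule time_deriv_eq, rule bounded_linear.has_vector_derivative[OF bounded_linear_scaleR_right dh])
  then show "velocity B (\<lambda>t. c *\<^sub>R h t) t = c *\<^sub>R velocity B h t"
    by (simp add: velocity_def ch blinfun.scaleR_right scaleR_add_right)
qed

text \<open>Moving the change of \<open>B\<close> to the right-hand side turns the equation for \<open>B'\<close> into one for \<open>B\<close>. The new right-hand
  side contains a derivative of the solution, so \<open>h\<close> must be \<open>C\<^sup>2\<close> for both solutions to be classical.\<close>

lemma sol_perturbation:
  assumes B: "B \<in> PD" and B': "B' \<in> PD" and T: "0 \<le> T" and h: "causal T (Suc (Suc 0)) K h"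
  shows "sol B' h = sol B (\<lambda>t. h t + - blinfun_of (B' - B) (velocity B' h t))"
proof
  let ?g = "\<lambda>t. h t + - blinfun_of (B' - B) (velocity B' h t)"
  have h1: "causal T (Suc 0) K h" using h by (rule causal_lower)
  have g: "causal T (Suc 0) (K + norm (blinfun_of (B' - B)) * (vel_const T * K)) ?g"
    by (intro causal_add h1 causal_uminus causal_blinfun T causal_velocity[OF B' T h])
  fix t
  show "sol B' h t = sol B ?g t"
  proof (cases "t \<le> 0")
    case False
    show ?thesis
    proof (rule classical_unique[OF B, of t t _ "time_deriv (sol B' h)" ?g _ "time_deriv (sol B ?g)"])
      show "continuous_on {0..t} (sol B' h)" "continuous_on {0..t} (sol B ?g)"
        using sol_continuous[OF B' causal_0[OF h]] sol_continuous[OF B causal_0[OF g]]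
        by (auto intro: continuous_on_subset)
      fix s
      show "(sol B' h has_vector_derivative time_deriv (sol B' h) s) (at s)"
        using sol_derivative[OF B' h1] unfolding time_deriv_sol[OF B' h1] .
      show "(sol B ?g has_vector_derivative time_deriv (sol B ?g) s) (at s)"
        using sol_derivative[OF B g] unfolding time_deriv_sol[OF B g] .
      show "sol B' h s \<in> D" "sol B ?g s \<in> D"
        using sol_equation(1)[OF B' h1] sol_equation(1)[OF B g] by auto
      show "blinfun_of B (time_deriv (sol B ?g) s) + A (sol B ?g s) + blinfun_of B (Q (sol B ?g s)) = ?g s"
        by (rule sol_equation(2)[OF B g])
      show "blinfun_of B (time_deriv (sol B' h) s) + A (sol B' h s) + blinfun_of B (Q (sol B' h s)) = ?g s"
        using sol_equation(2)[OF B' h1, of s]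
        by (simp add: velocity_def minus_sa_op.rep_eq blinfun.diff_left blinfun.add_right algebra_simps)
    qed (use False in \<open>auto simp: sol_zero B B'\<close>)
  qed (simp add: sol_zero B B')
qed

lemma velocity_perturbation:
  assumes "B \<in> PD" "B' \<in> PD" "0 \<le> T" "causal T (Suc (Suc 0)) K h"
  shows "velocity B' h = velocity B (\<lambda>t. h t + - blinfun_of (B' - B) (velocity B' h t))"
  using sol_perturbation[OF assms] unfolding velocity_def[abs_def] by metis

end

section \<open>Approximation of integrable functions by continuous ones\<close>

lemma borel_measurable_continuous_lebesgue_on:
  assumes "continuous_on {0..T} h"
  shows "h \<in> borel_measurable (lebesgue_on {0..T::real})"
proof -
  have "h \<in> borel_measurable (restrict_space borel {0..T})"
    using assms by (rule borel_measurable_continuous_on_restrict)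
  then show ?thesis
    by (rule borel_measurable_subalgebra[rotated 2]) (auto simp: space_restrict_space sets_restrict_space)
qed

text \<open>Regularity of Lebesgue measure gives a closed set inside and an open set around the set \<open>A\<close>, and Urysohn's lemma interpolates.
  The open interval \<open>(0, T)\<close> replaces \<open>[0, T]\<close> at the cost of two points, so that the approximant vanishes outside.\<close>

lemma indicator_approx_continuous:
  fixes A :: "real set"
  assumes A: "A \<in> sets lebesgue" and e: "0 < e"
  obtains \<phi> :: "real \<Rightarrow> real" where "continuous_on UNIV \<phi>" "\<And>t. t \<le> 0 \<or> T \<le> t \<Longrightarrow> \<phi> t = 0"
    "(\<integral>\<^sup>+x. ennreal \<bar>indicator A x - \<phi> x\<bar> \<partial>lebesgue_on {0..T}) \<le> ennreal e"
proof -
  define A' where "A' = A \<inter> {0<..<T}"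
  have A': "A' \<in> sets lebesgue" unfolding A'_def using A by (intro sets.Int) auto
  have e2: "0 < e / 2" using e by simp
  obtain U where U: "open U" "A' \<subseteq> U" "U - A' \<in> lmeasurable" "emeasure lebesgue (U - A') < ennreal (e / 2)"
    by (rule sets_lebesgue_outer_open[OF A' e2]) blast
  obtain C where C: "closed C" "C \<subseteq> A'" "A' - C \<in> lmeasurable" "emeasure lebesgue (A' - C) < ennreal (e / 2)"
    by (rule sets_lebesgue_inner_closed[OF A' e2]) blast
  define V where "V = U \<inter> {0<..<T}"
  have V: "open V" "A' \<subseteq> V" using U by (auto simp: V_def A'_def)
  obtain \<phi> :: "real \<Rightarrow> real" where \<phi>: "continuous_on UNIV \<phi>" "\<And>x. \<phi> x \<in> closed_segment 0 1"
    "\<And>x. x \<in> - V \<Longrightarrow> \<phi> x = 0" "\<And>x. x \<in> C \<Longrightarrow> \<phi> x = 1"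
    using C V by (elim Urysohn[of "- V" C 0 "1::real", rotated 3]) auto
  have \<phi>01: "0 \<le> \<phi> x" "\<phi> x \<le> 1" for x
    using \<phi>(2)[of x] by (auto simp: closed_segment_eq_real_ivl)
  show thesis
  proof
    show "\<phi> t = 0" if "t \<le> 0 \<or> T \<le> t" for t
      using that by (intro \<phi>(3)) (auto simp: V_def)
    let ?Z = "{0, T}"
    have pt: "ennreal \<bar>indicator A x - \<phi> x\<bar> * indicator {0..T} x
        \<le> indicator (U - A') x + indicator (A' - C) x + indicator ?Z x" for x
    proof (cases "x \<in> {0..T}")
      case True
      have le1: "ennreal \<bar>indicator A x - \<phi> x\<bar> \<le> 1"
        using \<phi>01[of x] by (auto simp: indicator_def ennreal_le_1)
      consider "x \<in> ?Z" | "x \<in> {0<..<T}" "x \<in> C" | "x \<in> A' - C" | "x \<in> {0<..<T}" "x \<notin> A" "x \<in> U" | "x \<in> {0<..<T}" "x \<notin> A" "x \<notin> U"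
        using True C(2) by (fastforce simp: A'_def)
      then show ?thesis
      proof cases
        case 2
        then have "x \<in> A" using C(2) by (auto simp: A'_def)
        then show ?thesis using 2 \<phi>(4)[of x] by simp
      next
        case 5
        then have "\<phi> x = 0" by (intro \<phi>(3)) (simp add: V_def)
        then show ?thesis using 5 by simp
      next
        case 1
        have "ennreal \<bar>indicator A x - \<phi> x\<bar> * indicator {0..T} x \<le> 1" using le1 True by simp
        also have "1 \<le> indicator (U - A') x + indicator (A' - C) x + (indicator ?Z x :: ennreal)"
          using 1 by (intro add_increasing) auto
        finally show ?thesis .
      next
        case 3
        have "ennreal \<bar>indicator A x - \<phi> x\<bar> * indicator {0..T} x \<le> 1" using le1 True by simp
        also have "1 \<le> indicator (U - A') x + indicator (A' - C) x + (indicator ?Z x :: ennreal)"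
          using 3 by (intro add_increasing2 add_increasing) auto
        finally show ?thesis .
      next
        case 4
        then have x: "x \<in> U - A'" by (auto simp: A'_def)
        have "ennreal \<bar>indicator A x - \<phi> x\<bar> * indicator {0..T} x \<le> 1" using le1 True by simp
        also have "1 \<le> indicator (U - A') x + indicator (A' - C) x + (indicator ?Z x :: ennreal)"
          using x by (intro add_increasing2) auto
        finally show ?thesis .
      qed
    qed simp
    have sets: "U - A' \<in> sets lebesgue" "A' - C \<in> sets lebesgue" "?Z \<in> sets lebesgue"
      using U C by (auto dest: fmeasurableD)
    have "(\<integral>\<^sup>+x. ennreal \<bar>indicator A x - \<phi> x\<bar> \<partial>lebesgue_on {0..T})
        = (\<integral>\<^sup>+x. ennreal \<bar>indicator A x - \<phi> x\<bar> * indicator {0..T} x \<partial>lebesgue)"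
      by (rule nn_integral_restrict_space) simp
    also have "\<dots> \<le> (\<integral>\<^sup>+x. indicator (U - A') x + indicator (A' - C) x + indicator ?Z x \<partial>lebesgue)"
      by (intro nn_integral_mono pt)
    also have "\<dots> = emeasure lebesgue (U - A') + emeasure lebesgue (A' - C) + emeasure lebesgue ?Z"
      by (simp only: nn_integral_add borel_measurable_add borel_measurable_indicator nn_integral_indicator sets)
    also have "emeasure lebesgue ?Z = 0" by (simp add: emeasure_lborel_countable)
    also have "emeasure lebesgue (U - A') + emeasure lebesgue (A' - C) + 0 \<le> ennreal (e / 2) + ennreal (e / 2)"
      using U(4) C(4) by (simp add: add_mono)
    also have "\<dots> = ennreal e" using e by (simp add: ennreal_plus[symmetric] del: ennreal_plus)
    finally show "(\<integral>\<^sup>+x. ennreal \<bar>indicator A x - \<phi> x\<bar> \<partial>lebesgue_on {0..T}) \<le> ennreal e" .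
  qed (rule \<phi>(1))
qed

text \<open>Each value \<open>y\<close> of \<open>s\<close> contributes an error of at most \<open>norm y * d y\<close>. The weights \<open>d y\<close> are chosen such that these
  errors sum to at most \<open>e\<close>.\<close>

lemma simple_function_approx_continuous:
  fixes s :: "real \<Rightarrow> 'a::real_normed_vector"
  assumes s: "simple_function (lebesgue_on {0..T}) s" and e: "0 < e"
  obtains \<psi> where "continuous_on UNIV \<psi>" "\<And>t. t \<le> 0 \<or> T \<le> t \<Longrightarrow> \<psi> t = 0"
    "(\<integral>\<^sup>+x. ennreal (norm (s x - \<psi> x)) \<partial>lebesgue_on {0..T}) \<le> ennreal e"
proof -
  let ?M = "lebesgue_on {0..T}"
  define Y where "Y = s ` {0..T}"
  have Y: "finite Y" using simple_functionD(1)[OF s] by (simp add: Y_def)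
  define S where "S y = s -` {y} \<inter> {0..T}" for y
  have S: "S y \<in> sets lebesgue" for y
    using simple_functionD(2)[OF s, of "{y}"] by (simp add: S_def sets_restrict_space_iff)
  define d where "d y = e / ((real (card Y) + 1) * (norm y + 1))" for y :: 'a
  have d: "0 < d y" for y using e by (auto simp: d_def intro!: divide_pos_pos mult_pos_pos add_nonneg_pos)
  have "\<exists>\<phi>::real \<Rightarrow> real. continuous_on UNIV \<phi> \<and> (\<forall>t. t \<le> 0 \<or> T \<le> t \<longrightarrow> \<phi> t = 0) \<and>
      (\<integral>\<^sup>+x. ennreal \<bar>indicator (S y) x - \<phi> x\<bar> \<partial>?M) \<le> ennreal (d y)" for y
    by (rule indicator_approx_continuous[OF S d, where T = T]) blast
  then obtain \<phi> :: "'a \<Rightarrow> real \<Rightarrow> real" where \<phi>: "\<And>y. continuous_on UNIV (\<phi> y)"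
    "\<And>y t. t \<le> 0 \<or> T \<le> t \<Longrightarrow> \<phi> y t = 0"
    "\<And>y. (\<integral>\<^sup>+x. ennreal \<bar>indicator (S y) x - \<phi> y x\<bar> \<partial>?M) \<le> ennreal (d y)"
    by metis
  define \<psi> where "\<psi> t = (\<Sum>y\<in>Y. \<phi> y t *\<^sub>R y)" for t
  have s_sum: "s x = (\<Sum>y\<in>Y. indicator (S y) x *\<^sub>R y)" if "x \<in> {0..T}" for x
  proof -
    have "(\<Sum>y\<in>Y. indicator (S y) x *\<^sub>R y) = (\<Sum>y\<in>Y. if y = s x then y else 0)"
      using that by (intro sum.cong) (auto simp: S_def indicator_def)
    also have "\<dots> = s x" using Y that by (simp add: Y_def)
    finally show ?thesis by simp
  qed
  have meas: "(\<lambda>x. ennreal \<bar>indicator (S y) x - \<phi> y x\<bar>) \<in> borel_measurable ?M" for y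
  proof -
    have "(\<lambda>x. indicator (S y) x :: real) \<in> borel_measurable ?M"
      using S[of y] by (intro measurable_restrict_space1 borel_measurable_indicator)
    moreover have "\<phi> y \<in> borel_measurable ?M"
      by (intro borel_measurable_continuous_lebesgue_on continuous_on_subset[OF \<phi>(1)]) simp
    ultimately show ?thesis by measurable
  qed
  show thesis
  proof
    show "continuous_on UNIV \<psi>" unfolding \<psi>_def by (intro continuous_intros \<phi>)
    show "\<psi> t = 0" if "t \<le> 0 \<or> T \<le> t" for t using \<phi>(2)[OF that] by (simp add: \<psi>_def)
    have "(\<integral>\<^sup>+x. ennreal (norm (s x - \<psi> x)) \<partial>?M)
        \<le> (\<integral>\<^sup>+x. (\<Sum>y\<in>Y. ennreal (norm y) * ennreal \<bar>indicator (S y) x - \<phi> y x\<bar>) \<partial>?M)"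
    proof (rule nn_integral_mono)
      fix x assume "x \<in> space ?M"
      then have x: "x \<in> {0..T}" by simp
      have "norm (s x - \<psi> x) = norm (\<Sum>y\<in>Y. (indicator (S y) x - \<phi> y x) *\<^sub>R y)"
        by (simp add: s_sum[OF x] \<psi>_def sum_subtractf[symmetric] scaleR_diff_left)
      also have "\<dots> \<le> (\<Sum>y\<in>Y. norm y * \<bar>indicator (S y) x - \<phi> y x\<bar>)"
        by (intro order_trans[OF norm_sum] sum_mono) (simp add: mult.commute)
      finally show "ennreal (norm (s x - \<psi> x)) \<le> (\<Sum>y\<in>Y. ennreal (norm y) * ennreal \<bar>indicator (S y) x - \<phi> y x\<bar>)"
        by (simp add: ennreal_mult[symmetric] sum_ennreal ennreal_leI)
    qed
    also have "\<dots> = (\<Sum>y\<in>Y. ennreal (norm y) * (\<integral>\<^sup>+x. ennreal \<bar>indicator (S y) x - \<phi> y x\<bar> \<partial>?M))"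
      using meas by (simp add: nn_integral_sum nn_integral_cmult)
    also have "\<dots> \<le> (\<Sum>y\<in>Y. ennreal (norm y) * ennreal (d y))"
      by (intro sum_mono mult_left_mono \<phi>(3)) simp
    also have "\<dots> = ennreal (\<Sum>y\<in>Y. norm y * d y)"
      using d by (simp add: ennreal_mult[symmetric] less_imp_le sum_ennreal)
    also have "\<dots> \<le> ennreal e"
    proof (rule ennreal_leI)
      have "(\<Sum>y\<in>Y. norm y * d y) \<le> (\<Sum>y\<in>Y. e / (real (card Y) + 1))"
      proof (rule sum_mono)
        fix y
        have "norm y * d y = (e / (real (card Y) + 1)) * (norm y / (norm y + 1))"
          by (simp add: d_def)
        also have "\<dots> \<le> (e / (real (card Y) + 1)) * 1"
        proof (intro mult_left_mono)
          show "norm y / (norm y + 1) \<le> 1" by (smt (verit) divide_le_eq_1 norm_ge_zero)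
        qed (use e in auto)
        finally show "norm y * d y \<le> e / (real (card Y) + 1)" by simp
      qed
      also have "\<dots> \<le> e" using e by (simp add: field_simps)
      finally show "(\<Sum>y\<in>Y. norm y * d y) \<le> e" .
    qed
    finally show "(\<integral>\<^sup>+x. ennreal (norm (s x - \<psi> x)) \<partial>?M) \<le> ennreal e" .
  qed
qed

lemma continuous_simple_approx:
  fixes h :: "real \<Rightarrow> 'a::real_normed_vector"
  assumes h: "continuous_on {0..T} h" and e: "0 < e"
  obtains s where "simple_function (lebesgue_on {0..T}) s" "\<And>x. x \<in> {0..T} \<Longrightarrow> norm (h x - s x) < e"
proof -
  let ?M = "lebesgue_on {0..T}"
  have "uniformly_continuous_on {0..T} h" using h by (simp add: compact_uniformly_continuous)
  then obtain d where d: "0 < d" "\<And>x y. x \<in> {0..T} \<Longrightarrow> y \<in> {0..T} \<Longrightarrow> dist y x < d \<Longrightarrow> dist (h y) (h x) < e"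
    using e unfolding uniformly_continuous_on_def by metis
  define r where "r x = d * real_of_int \<lfloor>x / d\<rfloor>" for x
  have r: "0 \<le> r x" "r x \<le> x" "x - r x < d" if "0 \<le> x" for x
  proof -
    have "real_of_int \<lfloor>x / d\<rfloor> \<le> x / d" "x / d < real_of_int \<lfloor>x / d\<rfloor> + 1" by linarith+
    then show "x - r x < d" using d(1) by (simp add: r_def field_simps)
    show "r x \<le> x" using mult_left_mono[OF \<open>real_of_int \<lfloor>x / d\<rfloor> \<le> x / d\<close>, of d] d(1) by (simp add: r_def)
    show "0 \<le> r x" using that d(1) by (simp add: r_def)
  qed
  have "simple_function ?M r"
  proof (rule simple_function_borel_measurable)
    have "r \<in> borel_measurable borel" unfolding r_def by measurable
    then show "r \<in> borel_measurable ?M"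
      by (intro measurable_restrict_space1 measurable_completion) simp
    have "r ` space ?M \<subseteq> (\<lambda>k. d * real_of_int k) ` {0..\<lfloor>T / d\<rfloor>}"
      using d(1) by (auto simp: r_def intro!: imageI floor_mono divide_right_mono)
    then show "finite (r ` space ?M)" by (rule finite_subset) simp
  qed
  then have "simple_function ?M (\<lambda>x. h (r x))" by (rule simple_function_compose1)
  moreover have "norm (h x - h (r x)) < e" if "x \<in> {0..T}" for x
    using d(2)[of "r x" x] r[of x] that by (auto simp: dist_norm)
  ultimately show thesis by (rule that)
qed

text \<open>The difference of two Borel functions need not be measurable when the range is not separable. It is harmless if one of
  them has finitely many values, or is a uniform limit of such functions.\<close>

lemma measurable_norm_diff_simple:
  fixes g :: "'b \<Rightarrow> 'a::real_normed_vector"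
  assumes g: "g \<in> borel_measurable M" and s: "simple_function M s"
  shows "(\<lambda>x. norm (g x - s x)) \<in> borel_measurable M"
proof (rule measurable_compose_countable'[where f = "\<lambda>y x. norm (g x - y)" and g = s and I = "s ` space M"])
  have fin: "finite (s ` space M)" using simple_functionD(1)[OF s] .
  then show "countable (s ` space M)" by (rule countable_finite)
  show "s \<in> measurable M (count_space (s ` space M))"
    using measurable_simple_function[OF s] by (auto simp: measurable_def)
  show "(\<lambda>x. norm (g x - y)) \<in> borel_measurable M" for y
    by (rule measurable_compose[OF g]) (intro borel_measurable_continuous_onI continuous_intros)
qed

lemma measurable_norm_diff_continuous:
  fixes g h :: "real \<Rightarrow> 'a::real_normed_vector"
  assumes g: "g \<in> borel_measurable (lebesgue_on {0..T})" and h: "continuous_on {0..T} h"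
  shows "(\<lambda>x. norm (g x - h x)) \<in> borel_measurable (lebesgue_on {0..T})"
proof -
  have "\<exists>s. simple_function (lebesgue_on {0..T}) s \<and> (\<forall>x\<in>{0..T}. norm (h x - s x) < inverse (real (Suc n)))" for n
    by (rule continuous_simple_approx[OF h, of "inverse (real (Suc n))"]) auto
  then obtain s where s: "\<And>n. simple_function (lebesgue_on {0..T}) (s n)"
    "\<And>n x. x \<in> {0..T} \<Longrightarrow> norm (h x - s n x) < inverse (real (Suc n))"
    by metis
  show ?thesis
  proof (rule borel_measurable_LIMSEQ_real)
    show "(\<lambda>x. norm (g x - s n x)) \<in> borel_measurable (lebesgue_on {0..T})" for n
      by (rule measurable_norm_diff_simple[OF g s(1)])
    fix x assume "x \<in> space (lebesgue_on {0..T})"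
    then have x: "x \<in> {0..T}" by simp
    have "(\<lambda>n. s n x - h x) \<longlonglongrightarrow> 0"
      using s(2)[OF x]
      by (intro Lim_null_comparison[OF always_eventually LIMSEQ_inverse_real_of_nat])
        (simp add: norm_minus_commute less_imp_le)
    then have "(\<lambda>n. s n x) \<longlonglongrightarrow> h x" by (simp add: LIM_zero_iff)
    then show "(\<lambda>n. norm (g x - s n x)) \<longlonglongrightarrow> norm (g x - h x)"
      by (intro tendsto_intros)
  qed
qed

lemma L1_on_continuous:
  fixes h :: "real \<Rightarrow> 'a::real_normed_vector"
  assumes h: "continuous_on {0..T} h"
  shows "L1_on T h"
  unfolding L1_on_def
proof
  show "h \<in> borel_measurable (lebesgue_on {0..T})"
    using h by (rule borel_measurable_continuous_lebesgue_on)
  have "\<exists>s. simple_function (lebesgue_on {0..T}) s \<and> (\<forall>x\<in>{0..T}. norm (h x - s x) < inverse (real (Suc n)))" for n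
    by (rule continuous_simple_approx[OF h, of "inverse (real (Suc n))"]) auto
  then obtain s where s: "\<And>n. simple_function (lebesgue_on {0..T}) (s n)"
    "\<And>n x. x \<in> {0..T} \<Longrightarrow> norm (h x - s n x) < inverse (real (Suc n))"
    by metis
  have "(\<lambda>i. \<integral>\<^sup>+x. ennreal (norm (h x - s i x)) \<partial>lebesgue_on {0..T}) \<longlonglongrightarrow> 0"
  proof (rule tendsto_sandwich[OF _ _ tendsto_const])
    have "(\<integral>\<^sup>+x. ennreal (norm (h x - s i x)) \<partial>lebesgue_on {0..T}) \<le> ennreal (inverse (real (Suc i)) * \<bar>T\<bar>)" for i
    proof -
      have "(\<integral>\<^sup>+x. ennreal (norm (h x - s i x)) \<partial>lebesgue_on {0..T})
          \<le> (\<integral>\<^sup>+x. ennreal (inverse (real (Suc i))) \<partial>lebesgue_on {0..T})"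
        using s(2)[of _ i] by (intro nn_integral_mono ennreal_leI) (auto intro: less_imp_le)
      also have "\<dots> = ennreal (inverse (real (Suc i))) * emeasure lebesgue {0..T}"
        by (simp add: emeasure_restrict_space)
      also have "\<dots> \<le> ennreal (inverse (real (Suc i))) * ennreal \<bar>T\<bar>"
        by (intro mult_left_mono) (cases "0 \<le> T", auto)
      also have "\<dots> = ennreal (inverse (real (Suc i)) * \<bar>T\<bar>)"
        by (rule ennreal_mult[symmetric]) auto
      finally show ?thesis .
    qed
    then show "\<forall>\<^sub>F i in sequentially. (\<integral>\<^sup>+x. ennreal (norm (h x - s i x)) \<partial>lebesgue_on {0..T})
        \<le> ennreal (inverse (real (Suc i)) * \<bar>T\<bar>)" by simp
    have "(\<lambda>i. inverse (real (Suc i)) * \<bar>T\<bar>) \<longlonglongrightarrow> 0 * \<bar>T\<bar>"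
      by (intro tendsto_intros LIMSEQ_inverse_real_of_nat)
    then show "(\<lambda>i. ennreal (inverse (real (Suc i)) * \<bar>T\<bar>)) \<longlonglongrightarrow> 0"
      using tendsto_ennrealI by fastforce
  qed simp
  then show "\<exists>s. (\<forall>i. simple_function (lebesgue_on {0..T}) (s i)) \<and>
      (\<lambda>i::nat. \<integral>\<^sup>+x. ennreal (norm (h x - s i x)) \<partial>lebesgue_on {0..T}) \<longlonglongrightarrow> 0"
    using s(1) by blast
qed

lemma L1_on_approx_continuous:
  fixes g :: "real \<Rightarrow> 'a::real_normed_vector"
  assumes g: "L1_on T g" and e: "0 < e"
  obtains \<psi> where "continuous_on UNIV \<psi>" "\<And>t. t \<le> 0 \<or> T \<le> t \<Longrightarrow> \<psi> t = 0"
    "(\<lambda>x. norm (g x - \<psi> x)) integrable_on {0..T}" "integral {0..T} (\<lambda>x. norm (g x - \<psi> x)) \<le> e"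
proof -
  let ?M = "lebesgue_on {0..T}"
  have g_meas: "g \<in> borel_measurable ?M" using g by (simp add: L1_on_def)
  obtain s where s: "\<And>i::nat. simple_function ?M (s i)"
    and lim: "(\<lambda>i. \<integral>\<^sup>+x. ennreal (norm (g x - s i x)) \<partial>?M) \<longlonglongrightarrow> 0"
    using g by (auto simp: L1_on_def)
  have "\<forall>\<^sub>F i in sequentially. (\<integral>\<^sup>+x. ennreal (norm (g x - s i x)) \<partial>?M) < ennreal (e / 2)"
    using order_tendstoD(2)[OF lim, of "ennreal (e / 2)"] e by simp
  then obtain i where i: "(\<integral>\<^sup>+x. ennreal (norm (g x - s i x)) \<partial>?M) < ennreal (e / 2)"
    by (auto simp: eventually_sequentially)
  have e2: "0 < e / 2" using e by simp
  obtain \<psi> where \<psi>: "continuous_on UNIV \<psi>" "\<And>t. t \<le> 0 \<or> T \<le> t \<Longrightarrow> \<psi> t = 0"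
    "(\<integral>\<^sup>+x. ennreal (norm (s i x - \<psi> x)) \<partial>?M) \<le> ennreal (e / 2)"
    by (rule simple_function_approx_continuous[OF s[of i] e2]) blast
  have cont: "continuous_on {0..T} \<psi>" using \<psi>(1) by (rule continuous_on_subset) simp
  have m: "(\<lambda>x. norm (g x - \<psi> x)) \<in> borel_measurable ?M"
    by (rule measurable_norm_diff_continuous[OF g_meas cont])
  have m2: "(\<lambda>x. norm (s i x - \<psi> x)) \<in> borel_measurable ?M"
    using measurable_norm_diff_simple[OF borel_measurable_continuous_lebesgue_on[OF cont] s[of i]]
    by (simp add: norm_minus_commute)
  have "(\<integral>\<^sup>+x. ennreal (norm (g x - \<psi> x)) \<partial>?M)
      \<le> (\<integral>\<^sup>+x. ennreal (norm (g x - s i x)) + ennreal (norm (s i x - \<psi> x)) \<partial>?M)"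
  proof (intro nn_integral_mono)
    fix x
    have "norm (g x - \<psi> x) \<le> norm (g x - s i x) + norm (s i x - \<psi> x)"
      using norm_triangle_ineq[of "g x - s i x" "s i x - \<psi> x"] by simp
    then show "ennreal (norm (g x - \<psi> x)) \<le> ennreal (norm (g x - s i x)) + ennreal (norm (s i x - \<psi> x))"
      by (simp add: ennreal_plus[symmetric] ennreal_leI del: ennreal_plus)
  qed
  also have "\<dots> = (\<integral>\<^sup>+x. ennreal (norm (g x - s i x)) \<partial>?M) + (\<integral>\<^sup>+x. ennreal (norm (s i x - \<psi> x)) \<partial>?M)"
    using measurable_norm_diff_simple[OF g_meas s[of i]] m2 by (intro nn_integral_add) auto
  also have "\<dots> \<le> ennreal (e / 2) + ennreal (e / 2)"
    using i \<psi>(3) by (intro add_mono) auto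
  also have "\<dots> = ennreal e" using e by (simp add: ennreal_plus[symmetric] del: ennreal_plus)
  finally have le: "(\<integral>\<^sup>+x. ennreal (norm (g x - \<psi> x)) \<partial>?M) \<le> ennreal e" .
  have int: "integrable ?M (\<lambda>x. norm (g x - \<psi> x))"
    using m le by (intro integrableI_nonneg) (auto intro: le_less_trans)
  then have hi: "((\<lambda>x. norm (g x - \<psi> x)) has_integral (\<integral>x. norm (g x - \<psi> x) \<partial>?M)) {0..T}"
    by (rule has_integral_integral_lebesgue_on) simp
  have "ennreal (\<integral>x. norm (g x - \<psi> x) \<partial>?M) \<le> ennreal e"
    using le nn_integral_eq_integral[OF int] by simp
  then have "(\<integral>x. norm (g x - \<psi> x) \<partial>?M) \<le> e"
    using e by (simp add: ennreal_le_iff)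
  then show thesis
    using that[OF \<psi>(1,2)] hi by (auto simp: has_integral_iff)
qed

section \<open>Right-hand sides with an integrable derivative\<close>

lemma causal_primitive:
  fixes h :: "real \<Rightarrow> 'a::banach"
  assumes h: "continuous_on UNIV h" "\<And>t. t \<le> 0 \<Longrightarrow> h t = 0"
  shows "((\<lambda>t. integral {0..t} h) has_vector_derivative h t) (at t)"
proof -
  define R where "R = \<bar>t\<bar> + 1"
  have cont: "continuous_on {-R..R} h" using h(1) by (rule continuous_on_subset) simp
  have "((\<lambda>u. integral {-R..u} h) has_vector_derivative h t) (at t within {-R..R})"
    by (rule integral_has_vector_derivative[OF cont]) (auto simp: R_def)
  then have "((\<lambda>u. integral {0..u} h) has_vector_derivative h t) (at t within {-R..R})"
  proof (rule has_vector_derivative_transform[rotated 2])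
    fix u assume u: "u \<in> {-R..R}"
    have z: "integral {-R..v} h = 0" if "v \<le> 0" for v
      using integral_cong[of "{-R..v}" h "\<lambda>_. 0"] h(2) that by auto
    show "integral {0..u} h = integral {-R..u} h"
    proof (cases "0 \<le> u")
      case True
      have "integral {-R..0} h + integral {0..u} h = integral {-R..u} h"
        using u True by (intro Henstock_Kurzweil_Integration.integral_combine integrable_continuous_real
            continuous_on_subset[OF h(1)]) (auto simp: R_def)
      then show ?thesis using z[of 0] by simp
    qed (use z[of u] in simp)
  qed (auto simp: R_def)
  moreover have "at t within {-R..R} = at t"
    by (rule at_within_interior) (auto simp: interior_atLeastAtMost_real R_def)
  ultimately show ?thesis by simp
qed

lemma causal_primitive_continuous:
  fixes h :: "real \<Rightarrow> 'a::banach"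
  assumes h: "continuous_on UNIV h" "\<And>t. t \<le> 0 \<Longrightarrow> h t = 0"
  shows "continuous_on UNIV (\<lambda>t. integral {0..t} h)" "t \<le> 0 \<Longrightarrow> integral {0..t} h = 0"
proof -
  show "continuous_on UNIV (\<lambda>t. integral {0..t} h)"
    using causal_primitive[OF h] by (meson continuous_at_imp_continuous_on has_vector_derivative_continuous)
  show "t \<le> 0 \<Longrightarrow> integral {0..t} h = 0" by (cases "t = 0") auto
qed

lemma causal_bound_exists:
  assumes h: "continuous_on UNIV h" "\<And>t. t \<le> 0 \<Longrightarrow> h t = 0"
  shows "\<exists>K. causal T 0 K h"
proof -
  have "compact (h ` {0..T})"
    using h(1) by (intro compact_continuous_image) (auto intro: continuous_on_subset)
  then obtain K where K: "\<And>t. t \<in> {0..T} \<Longrightarrow> norm (h t) \<le> K"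
    using compact_imp_bounded bounded_iff by (metis imageI)
  have "norm (h t) \<le> max K 0" if "t \<le> T" for t
    using K[of t] h(2)[of t] that by (cases "t \<le> 0") auto
  then show ?thesis using h by auto
qed

lemma integral_norm_support:
  fixes k :: "real \<Rightarrow> 'a::real_normed_vector"
  assumes k: "continuous_on UNIV k" "\<And>t. T \<le> t \<Longrightarrow> k t = 0" and T: "0 \<le> T"
  shows "integral {0..t} (\<lambda>s. norm (k s)) \<le> integral {0..T} (\<lambda>s. norm (k s))"
proof -
  have int: "(\<lambda>s. norm (k s)) integrable_on {a..c}" for a c
    by (intro integrable_continuous_real continuous_intros continuous_on_subset[OF k(1)]) auto
  show ?thesis
  proof (cases "t \<le> T")
    case True
    then show ?thesis using int by (intro integral_subset_le) auto
  next
    case False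
    have "integral {0..T} (\<lambda>s. norm (k s)) + integral {T..t} (\<lambda>s. norm (k s)) = integral {0..t} (\<lambda>s. norm (k s))"
      using False T int by (intro Henstock_Kurzweil_Integration.integral_combine) auto
    moreover have "integral {T..t} (\<lambda>s. norm (k s)) = 0"
      using integral_cong[of "{T..t}" "\<lambda>s. norm (k s)" "\<lambda>_. 0"] k(2) by auto
    ultimately show ?thesis by simp
  qed
qed

text \<open>A primitive \<open>p\<close> of an integrable function is described by continuous functions \<open>\<psi> n\<close> that are Cauchy in \<open>L\<^sup>1\<close> and whose
  primitives converge to \<open>p\<close>. In this form absolute continuity passes to the solutions, by the \<open>L\<^sup>1\<close> estimate
  \<open>sol_norm_integral\<close>.\<close>

lemma W1_approximation:
  fixes g p :: "real \<Rightarrow> 'a::banach"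
  assumes g: "L1_on T g" and T: "0 \<le> T"
    and p: "\<And>t. t \<in> {0..T} \<Longrightarrow> (g has_integral p t) {0..t}" "\<And>t. t \<le> 0 \<Longrightarrow> p t = 0" "\<And>t. T \<le> t \<Longrightarrow> p t = p T"
  obtains \<psi> :: "nat \<Rightarrow> real \<Rightarrow> 'a" where
    "\<And>n. continuous_on UNIV (\<psi> n)" "\<And>n t. t \<le> 0 \<or> T \<le> t \<Longrightarrow> \<psi> n t = 0"
    "\<And>m n. integral {0..T} (\<lambda>s. norm (\<psi> m s - \<psi> n s)) \<le> inverse (real (Suc m)) + inverse (real (Suc n))"
    "\<And>n t. norm (integral {0..t} (\<psi> n) - p t) \<le> inverse (real (Suc n))"
proof -
  have "\<exists>\<psi>. continuous_on UNIV \<psi> \<and> (\<forall>t. t \<le> 0 \<or> T \<le> t \<longrightarrow> \<psi> t = 0) \<and>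
    (\<lambda>x. norm (g x - \<psi> x)) integrable_on {0..T} \<and> integral {0..T} (\<lambda>x. norm (g x - \<psi> x)) \<le> inverse (real (Suc n))" for n
    by (rule L1_on_approx_continuous[OF g, of "inverse (real (Suc n))"]) auto
  then obtain \<psi> :: "nat \<Rightarrow> real \<Rightarrow> 'a" where
    c: "\<And>n. continuous_on UNIV (\<psi> n)" and z: "\<And>n t. t \<le> 0 \<or> T \<le> t \<Longrightarrow> \<psi> n t = 0"
    and i: "\<And>n. (\<lambda>x. norm (g x - \<psi> n x)) integrable_on {0..T}"
    and le: "\<And>n. integral {0..T} (\<lambda>x. norm (g x - \<psi> n x)) \<le> inverse (real (Suc n))"
    by metis
  have int: "(\<psi> n) integrable_on {a..b}" for n a b
    by (intro integrable_continuous_real continuous_on_subset[OF c]) auto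
  show thesis
  proof
    fix m n
    have "integral {0..T} (\<lambda>s. norm (\<psi> m s - \<psi> n s))
        \<le> integral {0..T} (\<lambda>s. norm (g s - \<psi> m s) + norm (g s - \<psi> n s))"
    proof (rule Henstock_Kurzweil_Integration.integral_le)
      show "(\<lambda>s. norm (\<psi> m s - \<psi> n s)) integrable_on {0..T}"
        by (intro integrable_continuous_real continuous_intros continuous_on_subset[OF c]) auto
      show "norm (\<psi> m s - \<psi> n s) \<le> norm (g s - \<psi> m s) + norm (g s - \<psi> n s)" for s
        using norm_triangle_ineq4[of "g s - \<psi> n s" "g s - \<psi> m s"] by simp
    qed (intro Henstock_Kurzweil_Integration.integrable_add i)
    also have "\<dots> = integral {0..T} (\<lambda>s. norm (g s - \<psi> m s)) + integral {0..T} (\<lambda>s. norm (g s - \<psi> n s))"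
      by (rule Henstock_Kurzweil_Integration.integral_add[OF i i])
    finally show "integral {0..T} (\<lambda>s. norm (\<psi> m s - \<psi> n s)) \<le> inverse (real (Suc m)) + inverse (real (Suc n))"
      using le[of m] le[of n] by linarith
  next
    fix n t
    have on: "norm (integral {0..t} (\<psi> n) - p t) \<le> inverse (real (Suc n))" if t: "t \<in> {0..T}" for t
    proof -
      have sub: "(\<lambda>x. norm (g x - \<psi> n x)) integrable_on {0..t}"
        using i by (rule integrable_on_subinterval) (use t in auto)
      have hi: "((\<lambda>x. g x - \<psi> n x) has_integral (p t - integral {0..t} (\<psi> n))) {0..t}"
        using p(1)[OF t] int by (intro has_integral_diff) (auto simp: integrable_integral)
      have "norm (integral {0..t} (\<psi> n) - p t) = norm (integral {0..t} (\<lambda>x. g x - \<psi> n x))"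
        using hi by (simp add: integral_unique norm_minus_commute)
      also have "\<dots> \<le> integral {0..t} (\<lambda>x. norm (g x - \<psi> n x))"
        using hi sub by (intro Henstock_Kurzweil_Integration.integral_norm_bound_integral) (auto simp: has_integral_iff)
      also have "\<dots> \<le> integral {0..T} (\<lambda>x. norm (g x - \<psi> n x))"
        using sub i t by (intro integral_subset_le) auto
      finally show ?thesis using le[of n] by linarith
    qed
    consider "t \<le> 0" | "t \<in> {0..T}" | "T < t" by fastforce
    then show "norm (integral {0..t} (\<psi> n) - p t) \<le> inverse (real (Suc n))"
    proof cases
      case 1
      then show ?thesis by (cases "t = 0") (auto simp: p(2))
    next
      case 3
      have "integral {0..T} (\<psi> n) + integral {T..t} (\<psi> n) = integral {0..t} (\<psi> n)"
        using 3 T int by (intro Henstock_Kurzweil_Integration.integral_combine) auto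
      moreover have "integral {T..t} (\<psi> n) = 0"
        using integral_cong[of "{T..t}" "\<psi> n" "\<lambda>_. 0"] z by auto
      ultimately show ?thesis using on[of T] p(3)[of t] 3 T by simp
    qed (rule on)
  qed (fact c z)+
qed

context evolution_problem
begin

lemma sol_diff:
  assumes B: "B \<in> PD" and h: "continuous_on UNIV h" and g: "continuous_on UNIV g"
  shows "sol B (\<lambda>t. h t - g t) t = sol B h t - sol B g t"
proof -
  have g': "continuous_on UNIV (\<lambda>t. (-1) *\<^sub>R g t)" by (intro continuous_intros g)
  show ?thesis
    using sol_lin(1)[OF B h g', of t] sol_lin(2)[OF B g g, of "-1" t] by simp
qed

text \<open>The solution for the primitive of \<open>\<psi> n\<close> has the derivative \<open>sol B (\<psi> n)\<close>. By the \<open>L\<^sup>1\<close> estimate these derivatives converge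
  uniformly on bounded intervals, so the solution for \<open>p\<close> is \<open>C\<^sup>1\<close>, with a bound that does not depend on \<open>B\<close>.\<close>

lemma causal_sol_W1:
  fixes \<psi> :: "nat \<Rightarrow> real \<Rightarrow> 'a"
  assumes B: "B \<in> PD" and T: "0 \<le> T"
    and p: "causal T 0 Kp p"
    and \<psi>: "\<And>n. continuous_on UNIV (\<psi> n)" "\<And>n t. t \<le> 0 \<or> T \<le> t \<Longrightarrow> \<psi> n t = 0"
    and Cauchy: "\<And>m n. integral {0..T} (\<lambda>s. norm (\<psi> m s - \<psi> n s)) \<le> inverse (real (Suc m)) + inverse (real (Suc n))"
    and lim: "\<And>n t. norm (integral {0..t} (\<psi> n) - p t) \<le> inverse (real (Suc n))"
  shows "causal T 1 (max (sol_const T * Kp)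
      (growth T / bmin * (integral {0..T} (\<lambda>s. norm (\<psi> 0 s)) + 2))) (sol B p)"
proof -
  let ?C = "\<lambda>\<tau>. growth \<tau> / bmin"
  have C: "0 \<le> ?C \<tau>" for \<tau> using growth_nonneg[of \<tau>] bmin by simp
  define P where "P n t = integral {0..t} (\<psi> n)" for n t
  define v where "v n = sol B (\<psi> n)" for n
  define w where "w t = lim (\<lambda>n. v n t)" for t
  have \<psi>_causal: "\<exists>K. causal \<tau> 0 K (\<psi> n)" for n \<tau>
    using \<psi> by (intro causal_bound_exists) auto
  have P_der: "(P n has_vector_derivative \<psi> n t) (at t)" for n t
    unfolding P_def[abs_def] using \<psi> by (intro causal_primitive) auto
  have P_cont: "continuous_on UNIV (P n)" and P_0: "t \<le> 0 \<Longrightarrow> P n t = 0" for n t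
    using causal_primitive_continuous[of "\<psi> n"] \<psi> by (auto simp: P_def[abs_def])
  have solP: "(sol B (P n) has_vector_derivative v n t) (at t)" for n t
  proof -
    obtain K1 K2 where K: "causal T 0 K1 (P n)" "causal T 0 K2 (\<psi> n)"
      using \<psi>_causal[of T n] causal_bound_exists[where h = "P n" and T = T, OF P_cont P_0] by blast
    have "causal T (Suc 0) (max K1 K2) (P n)"
      by (rule causal_SucI[OF causal_mono[OF K(1)] P_der causal_mono[OF K(2)]]) auto
    from sol_derivative[OF B this] show ?thesis
      by (simp add: v_def time_deriv_eq[OF P_der])
  qed
  have v_diff: "norm (v m t - v n t) \<le> ?C \<tau> * (inverse (real (Suc m)) + inverse (real (Suc n)))" if "t \<le> \<tau>" for m n t \<tau>
  proof -
    have cont: "continuous_on UNIV (\<lambda>s. \<psi> m s - \<psi> n s)" by (intro continuous_intros \<psi>)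
    have "norm (v m t - v n t) = norm (sol B (\<lambda>s. \<psi> m s - \<psi> n s) t)"
      by (simp add: v_def sol_diff[OF B \<psi>(1) \<psi>(1)])
    also have "\<dots> \<le> ?C \<tau> * integral {0..t} (\<lambda>s. norm (\<psi> m s - \<psi> n s))"
      by (rule sol_norm_integral[OF B continuous_on_subset[OF cont] that]) simp
    also have "\<dots> \<le> ?C \<tau> * (inverse (real (Suc m)) + inverse (real (Suc n)))"
      using integral_norm_support[OF cont _ T, of t] Cauchy[of m n] \<psi>(2)
      by (intro mult_left_mono C) force
    finally show ?thesis .
  qed
  have unif: "uniform_limit {..\<tau>} v w sequentially" for \<tau>
  proof -
    have "uniformly_Cauchy_on {..\<tau>} v"
      unfolding uniformly_Cauchy_on_def
    proof (intro allI impI)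
      fix e :: real assume e: "0 < e"
      have "(\<lambda>n. ?C \<tau> * (2 * inverse (real (Suc n)))) \<longlonglongrightarrow> ?C \<tau> * (2 * 0)"
        by (intro tendsto_intros LIMSEQ_inverse_real_of_nat)
      then have "\<forall>\<^sub>F n in sequentially. ?C \<tau> * (2 * inverse (real (Suc n))) < e"
        using order_tendstoD(2)[of _ "?C \<tau> * (2 * 0)"] e by simp
      then obtain N where N: "?C \<tau> * (2 * inverse (real (Suc N))) < e"
        by (auto simp: eventually_sequentially)
      have "dist (v m t) (v n t) < e" if "t \<in> {..\<tau>}" "m \<ge> N" "n \<ge> N" for t m n
      proof -
        have inv: "inverse (real (Suc m)) \<le> inverse (real (Suc N))" "inverse (real (Suc n)) \<le> inverse (real (Suc N))"
          using that by (auto intro!: le_imp_inverse_le)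
        have "dist (v m t) (v n t) \<le> ?C \<tau> * (inverse (real (Suc m)) + inverse (real (Suc n)))"
          using v_diff[of t \<tau> m n] that by (simp add: dist_norm)
        also have "\<dots> \<le> ?C \<tau> * (2 * inverse (real (Suc N)))"
          using inv by (intro mult_left_mono C) linarith
        finally show ?thesis using N by linarith
      qed
      then show "\<exists>M. \<forall>x\<in>{..\<tau>}. \<forall>m\<ge>M. \<forall>n\<ge>M. dist (v m x) (v n x) < e" by blast
    qed
    then show ?thesis
      unfolding w_def using Cauchy_uniformly_convergent uniformly_convergent_uniform_limit_iff by blast
  qed
  have v_lim: "(\<lambda>n. v n t) \<longlonglongrightarrow> w t" for t
    using tendsto_uniform_limitI[OF unif[of t]] by simp
  have v_cont: "continuous_on UNIV (v n)" for n
    using sol_continuous[OF B] \<psi>_causal[of T n] unfolding v_def by blast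
  have v_0: "t \<le> 0 \<Longrightarrow> v n t = 0" for n t by (simp add: v_def sol_zero[OF B])
  have solP_lim: "(\<lambda>n. sol B (P n) t) \<longlonglongrightarrow> sol B p t" for t
  proof -
    have "(\<lambda>n. sol B (P n) t - sol B p t) \<longlonglongrightarrow> 0"
    proof (rule Lim_null_comparison[OF always_eventually])
      show "\<forall>n. norm (sol B (P n) t - sol B p t) \<le> sol_const \<bar>t\<bar> * inverse (real (Suc n))"
      proof
        fix n
        have "norm (sol B (\<lambda>s. P n s - p s) t) \<le> sol_const \<bar>t\<bar> * inverse (real (Suc n))"
          using lim by (intro sol_bound[OF B] continuous_intros P_cont causal_continuous[OF p])
            (auto simp: P_def)
        then show "norm (sol B (P n) t - sol B p t) \<le> sol_const \<bar>t\<bar> * inverse (real (Suc n))"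
          by (simp add: sol_diff[OF B P_cont causal_continuous[OF p]])
      qed
      have "(\<lambda>n. sol_const \<bar>t\<bar> * inverse (real (Suc n))) \<longlonglongrightarrow> sol_const \<bar>t\<bar> * 0"
        by (intro tendsto_intros LIMSEQ_inverse_real_of_nat)
      then show "(\<lambda>n. sol_const \<bar>t\<bar> * inverse (real (Suc n))) \<longlonglongrightarrow> 0" by simp
    qed
    then show ?thesis by (simp add: LIM_zero_iff)
  qed
  have der: "(sol B p has_vector_derivative w t) (at t)" for t
  proof -
    have "(sol B p has_vector_derivative w t) (at t within {..t + 1})"
    proof (rule has_vector_derivative_uniform_limit[OF _ _ unif solP_lim])
      show "(sol B (P n) has_vector_derivative v n s) (at s within {..t + 1})" for n s
        by (rule has_vector_derivative_at_within[OF solP])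
    qed auto
    moreover have "at t within {..t + 1} = at t"
      by (rule at_within_interior) simp
    ultimately show ?thesis by simp
  qed
  have w_cont: "continuous_on UNIV w"
  proof -
    have "continuous_on {..<real n} w" for n
    proof (rule uniform_limit_theorem[OF always_eventually])
      show "uniform_limit {..<real n} v w sequentially"
        using unif[of "real n"] by (rule uniform_limit_on_subset) auto
    qed (auto intro: continuous_on_subset[OF v_cont])
    then have "continuous_on (\<Union>n. {..<real n}) w"
      by (intro continuous_on_open_UN) auto
    moreover have "(\<Union>n. {..<real n}) = UNIV"
      using reals_Archimedean2 by auto
    ultimately show ?thesis by simp
  qed
  have w_0: "w t = 0" if "t \<le> 0" for t
    using v_lim[of t] v_0[OF that] by (simp add: LIMSEQ_const_iff)
  let ?K = "growth T / bmin * (integral {0..T} (\<lambda>s. norm (\<psi> 0 s)) + 2)"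
  have w_bound: "norm (w t) \<le> ?K" if t: "t \<le> T" for t
  proof -
    have "norm (v n t) \<le> ?K" for n
    proof -
      have "norm (v 0 t) \<le> ?C T * integral {0..t} (\<lambda>s. norm (\<psi> 0 s))"
        unfolding v_def by (rule sol_norm_integral[OF B continuous_on_subset[OF \<psi>(1)] t]) simp
      also have "\<dots> \<le> ?C T * integral {0..T} (\<lambda>s. norm (\<psi> 0 s))"
        by (intro mult_left_mono C integral_norm_support T \<psi>) simp
      finally have 1: "norm (v 0 t) \<le> ?C T * integral {0..T} (\<lambda>s. norm (\<psi> 0 s))" .
      have "norm (v n t - v 0 t) \<le> ?C T * (inverse (real (Suc n)) + inverse (real (Suc 0)))"
        by (rule v_diff[OF t])
      also have "\<dots> \<le> ?C T * 2"
        using le_imp_inverse_le[of 1 "real (Suc n)"] by (intro mult_left_mono C) simp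
      finally have 2: "norm (v n t - v 0 t) \<le> ?C T * 2" .
      show ?thesis
        using norm_triangle_sub[of "v n t" "v 0 t"] 1 2 by (simp only: distrib_left)
    qed
    then show ?thesis
      using tendsto_norm[OF v_lim[of t]] by (intro LIMSEQ_le_const2) auto
  qed
  have "causal T (Suc 0) (max (sol_const T * Kp) ?K) (sol B p)"
  proof (rule causal_SucI[OF _ der])
    show "causal T 0 (max (sol_const T * Kp) ?K) (sol B p)"
      using causal_sol[OF B T p] by (rule causal_mono) simp
    show "causal T 0 (max (sol_const T * Kp) ?K) w"
      using w_cont w_0 w_bound by (simp add: le_max_iff_disj)
  qed
  then show ?thesis by simp
qed

text \<open>The vanishing initial values let \<open>f\<close> be extended by zero to negative times. Beyond \<open>T\<close> it is extended such that the second
  derivative \<open>p\<close> stays constant. The solution is \<open>C\<^sup>3\<close> although \<open>\<phi>\<close> is only \<open>C\<^sup>2\<close>, because \<open>causal_sol_W1\<close> applies to \<open>p\<close>.\<close>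

lemma W31_data:
  assumes T: "0 < T" and W: "W_k1 3 T f"
    and f0: "f 0 = 0" "deriv_on T f 0 = 0" "deriv_on T (deriv_on T f) 0 = 0"
  obtains \<phi> K K' where "\<And>t. t \<in> {0..T} \<Longrightarrow> \<phi> t = f t" "causal T 2 K \<phi>"
    "\<And>B. B \<in> PD \<Longrightarrow> causal T 3 K' (sol B \<phi>)"
proof -
  obtain g1 g2 g3 where g3: "L1_on T g3"
    and i3: "\<And>t. t \<in> {0..T} \<Longrightarrow> (g3 has_integral (g2 t - g2 0)) {0..t}"
    and i2: "\<And>t. t \<in> {0..T} \<Longrightarrow> (g2 has_integral (g1 t - g1 0)) {0..t}"
    and i1: "\<And>t. t \<in> {0..T} \<Longrightarrow> (g1 has_integral (f t - f 0)) {0..t}"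
    using W unfolding numeral_3_eq_3 W_k1.simps by blast
  have prim_cont: "continuous_on {0..T} h"
    if "\<And>t. t \<in> {0..T} \<Longrightarrow> (g has_integral (h t - h 0)) {0..t}" for g h :: "real \<Rightarrow> 'a"
  proof -
    have "g integrable_on {0..T}" using that[of T] T by auto
    then have "continuous_on {0..T} (\<lambda>t. h 0 + integral {0..t} g)"
      by (intro continuous_intros indefinite_integral_continuous_1)
    then show ?thesis by (rule continuous_on_eq) (simp add: integral_unique[OF that])
  qed
  have prim_der: "deriv_on T h t = g t" if t: "t \<in> {0..T}" and g: "continuous_on {0..T} g"
    and h: "\<And>t. t \<in> {0..T} \<Longrightarrow> (g has_integral (h t - h 0)) {0..t}" for g h :: "real \<Rightarrow> 'a" and t
  proof -
    have "((\<lambda>u. h 0 + integral {0..u} g) has_vector_derivative 0 + g t) (at t within {0..T})"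
      by (intro has_vector_derivative_add has_vector_derivative_const integral_has_vector_derivative g t)
    then have hd: "((\<lambda>u. h 0 + integral {0..u} g) has_vector_derivative g t) (at t within {0..T})"
      by simp
    have hu: "h u = h 0 + integral {0..u} g" if "u \<in> {0..T}" for u
      using integral_unique[OF h[OF that]] by simp
    have "(h has_vector_derivative g t) (at t within {0..T})"
      by (rule has_vector_derivative_transform[OF t hu hd])
    then show ?thesis
      unfolding deriv_on_def using vector_derivative_within_cbox[of 0 T t h "g t"] T t by simp
  qed
  have c2: "continuous_on {0..T} g2" by (rule prim_cont[OF i3])
  have c1: "continuous_on {0..T} g1" by (rule prim_cont[OF i2])
  have T0: "0 \<in> {0..T}" using T by simp
  have g10: "g1 0 = 0" using prim_der[OF T0 c1 i1] f0 by simp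
  have d1: "deriv_on T f t = g1 t" if "t \<in> {0..T}" for t using prim_der[OF that c1 i1] .
  have "(g2 has_integral (deriv_on T f t - deriv_on T f 0)) {0..t}" if "t \<in> {0..T}" for t
    using i2[OF that] d1[OF that] d1[OF T0] by simp
  from prim_der[OF T0 c2 this] have g20: "g2 0 = 0" using f0 by simp
  (* continuous, constant beyond T, and zero for t \<le> 0 because g2 0 = 0 *)
  define p where "p t = g2 (max 0 (min t T))" for t
  define p1 where "p1 t = integral {0..t} p" for t
  define \<phi> where "\<phi> t = integral {0..t} p1" for t
  have p: "continuous_on UNIV p" "\<And>t. t \<le> 0 \<Longrightarrow> p t = 0"
    unfolding p_def by (intro continuous_on_compose2[OF c2] continuous_intros)
      (use T g20 in \<open>auto simp: max_def min_def\<close>)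
  have p_g2: "p t = g2 t" if "t \<in> {0..T}" for t using that by (simp add: p_def)
  have p1: "continuous_on UNIV p1" "\<And>t. t \<le> 0 \<Longrightarrow> p1 t = 0"
    unfolding p1_def using causal_primitive_continuous[OF p] by auto
  have p1_der: "(p1 has_vector_derivative p t) (at t)" for t
    unfolding p1_def[abs_def] by (rule causal_primitive[OF p])
  have \<phi>: "continuous_on UNIV \<phi>" "\<And>t. t \<le> 0 \<Longrightarrow> \<phi> t = 0"
    unfolding \<phi>_def using causal_primitive_continuous[OF p1] by auto
  have \<phi>_der: "(\<phi> has_vector_derivative p1 t) (at t)" for t
    unfolding \<phi>_def[abs_def] by (rule causal_primitive[OF p1])
  have p1_g1: "p1 t = g1 t" if t: "t \<in> {0..T}" for t
  proof -
    have "p1 t = integral {0..t} g2" unfolding p1_def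
      by (rule integral_cong) (use t p_g2 in auto)
    then show ?thesis using i2[OF t] g10 by (simp add: integral_unique)
  qed
  have \<phi>_f: "\<phi> t = f t" if t: "t \<in> {0..T}" for t
  proof -
    have "\<phi> t = integral {0..t} g1" unfolding \<phi>_def
      by (rule integral_cong) (use t p1_g1 in auto)
    then show ?thesis using i1[OF t] f0(1) by (simp add: integral_unique)
  qed
  obtain K0 K1 K2 where K: "causal T 0 K0 \<phi>" "causal T 0 K1 p1" "causal T 0 K2 p"
    using causal_bound_exists[OF \<phi>] causal_bound_exists[OF p1] causal_bound_exists[OF p] by metis
  define K where "K = max K0 (max K1 K2)"
  have Kp: "causal T 0 K p" using K(3) by (rule causal_mono) (simp add: K_def)
  have Kp1: "causal T (Suc 0) K p1"
    using K(2) by (intro causal_SucI[OF _ p1_der Kp]) (rule causal_mono, auto simp: K_def)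
  have K\<phi>: "causal T (Suc (Suc 0)) K \<phi>"
    using K(1) by (intro causal_SucI[OF _ \<phi>_der Kp1]) (rule causal_mono, auto simp: K_def)
  have p_g3: "(g3 has_integral p t) {0..t}" if "t \<in> {0..T}" for t
    using i3[OF that] p_g2[OF that] g20 by simp
  have p_T: "p t = p T" if "T \<le> t" for t using that T by (simp add: p_def)
  obtain \<psi> :: "nat \<Rightarrow> real \<Rightarrow> 'a" where \<psi>:
    "\<And>n. continuous_on UNIV (\<psi> n)" "\<And>n t. t \<le> 0 \<or> T \<le> t \<Longrightarrow> \<psi> n t = 0"
    "\<And>m n. integral {0..T} (\<lambda>s. norm (\<psi> m s - \<psi> n s)) \<le> inverse (real (Suc m)) + inverse (real (Suc n))"
    "\<And>n t. norm (integral {0..t} (\<psi> n) - p t) \<le> inverse (real (Suc n))"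
    by (rule W1_approximation[OF g3 less_imp_le[OF T] p_g3 p(2) p_T]) blast+
  define K' where "K' = max (sol_const T * K) (growth T / bmin * (integral {0..T} (\<lambda>s. norm (\<psi> 0 s)) + 2))"
  have "causal T 3 K' (sol B \<phi>)" if B: "B \<in> PD" for B
  proof -
    have T': "0 \<le> T" using T by simp
    have p1: "causal T (Suc 0) K' (sol B p)"
      using causal_sol_W1[OF B T' Kp \<psi>] by (simp add: K'_def)
    have z1: "causal T 0 K' (sol B p1)"
      using causal_sol[OF B T' causal_0[OF Kp1]] by (rule causal_mono) (simp add: K'_def)
    have d1: "(sol B p1 has_vector_derivative sol B p t) (at t)" for t
      using sol_derivative[OF B Kp1] by (simp add: time_deriv_eq[OF p1_der])
    have 2: "causal T (Suc (Suc 0)) K' (sol B p1)" by (rule causal_SucI[OF z1 d1 p1])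
    have z0: "causal T 0 K' (sol B \<phi>)"
      using causal_sol[OF B T' causal_0[OF K\<phi>]] by (rule causal_mono) (simp add: K'_def)
    have d0: "(sol B \<phi> has_vector_derivative sol B p1 t) (at t)" for t
      using sol_derivative[OF B causal_le[OF K\<phi>]] by (simp add: time_deriv_eq[OF \<phi>_der])
    have "causal T (Suc (Suc (Suc 0))) K' (sol B \<phi>)"
      by (rule causal_SucI[OF z0 d0 2])
    then show ?thesis by (simp only: numeral_3_eq_3)
  qed
  moreover have "causal T 2 K \<phi>" using K\<phi> by (simp only: numeral_2_eq_2)
  ultimately show thesis using that \<phi>_f by blast
qed

end

section \<open>Solutions on the time interval\<close>

lemma has_derivative_of_quadratic_remainder:
  fixes F :: "'a::real_normed_vector \<Rightarrow> 'b::real_normed_vector"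
  assumes L: "bounded_linear L" and d: "0 < d"
    and rem: "\<And>y. dist y x < d \<Longrightarrow> norm (F y - F x - L (y - x)) \<le> K * (norm (y - x))\<^sup>2"
  shows "(F has_derivative L) (at x)"
proof (rule has_derivativeI_sandwich[OF d L])
  show "norm (F y - F x - L (y - x)) / norm (y - x) \<le> K * norm (y - x)"
    if "y \<in> UNIV" "y \<noteq> x" "dist y x < d" for y
    using rem[OF that(3)] that(2) by (simp add: field_simps power2_eq_square)
  have "((\<lambda>y. K * norm (y - x)) \<longlongrightarrow> K * norm (x - x)) (at x)"
    by (intro tendsto_intros)
  then show "((\<lambda>y. K * norm (y - x)) \<longlongrightarrow> 0) (at x)" by simp
qed

definition on_interval :: "real \<Rightarrow> (real \<Rightarrow> 'a::real_normed_vector) \<Rightarrow> real \<Rightarrow>\<^sub>C 'a" where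
  "on_interval T z = Bcontfun (\<lambda>t. z (clamp 0 T t))"

lemma on_interval_apply:
  assumes "continuous_on UNIV z"
  shows "apply_bcontfun (on_interval T z) t = z (clamp 0 T t)"
proof -
  have c: "continuous_on (cbox 0 T) z" using assms by (rule continuous_on_subset) simp
  have "(\<lambda>t. z (clamp 0 T t)) \<in> bcontfun"
    unfolding bcontfun_def
    using clamp_continuous_on[OF c, of UNIV] clamp_bounded[OF compact_imp_bounded[OF compact_continuous_image[OF c compact_cbox]]]
    by blast
  then show ?thesis by (simp add: on_interval_def Bcontfun_inverse)
qed

lemma clamp_mem: "0 \<le> T \<Longrightarrow> clamp 0 T t \<in> {0..T::real}"
  using clamp_in_interval[of 0 T t] by simp

lemma clamp_id: "t \<in> {0..T::real} \<Longrightarrow> clamp 0 T t = t"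
  using clamp_cancel_cbox[of t 0 T] by simp

lemma on_interval_mem:
  assumes "continuous_on UNIV z" "0 \<le> T"
  shows "on_interval T z \<in> C_interval T"
  using assms by (simp add: C_interval_def on_interval_apply clamp_id[OF clamp_mem])

lemma on_interval_norm:
  assumes "causal T k K z" "0 \<le> T"
  shows "norm (on_interval T z) \<le> K"
proof (rule norm_bound)
  show "norm (apply_bcontfun (on_interval T z) t) \<le> K" for t
    using causal_bound[OF assms(1), of "clamp 0 T t"] clamp_mem[OF assms(2), of t]
    by (simp add: on_interval_apply causal_continuous[OF assms(1)])
qed

lemma norm_sa_op_eq: "norm (blinfun_of H) = norm H"
  by (simp add: norm_sa_op.rep_eq)

lemma has_vector_derivative_on_interval:
  assumes eq: "\<And>s. s \<in> {0..T} \<Longrightarrow> z s = y s" and y: "(y has_vector_derivative y') (at t)"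
    and t: "t \<in> {0..T}" and T: "0 < T"
  shows "(z has_vector_derivative y') (at t within {0..T})" "deriv_on T z t = y'"
proof -
  show 1: "(z has_vector_derivative y') (at t within {0..T})"
    by (rule has_vector_derivative_transform[OF t eq has_vector_derivative_at_within[OF y]])
  show "deriv_on T z t = y'"
    unfolding deriv_on_def using vector_derivative_within_cbox[of 0 T t z y'] T t 1 by simp
qed

lemma C_k_causal:
  assumes T: "0 < T" and y: "causal T k K y" and eq: "\<And>t. t \<in> {0..T} \<Longrightarrow> z t = y t"
  shows "C_k k T z"
  using y eq
proof (induction k arbitrary: y z)
  case 0
  have "continuous_on {0..T} y" using causal_continuous[OF 0(1)] by (rule continuous_on_subset) simp
  then have "continuous_on {0..T} z" by (rule continuous_on_eq) (use 0(2) in auto)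
  then show ?case by simp
next
  case (Suc k)
  note d = has_vector_derivative_on_interval[OF Suc.prems(2) causal_derivative[OF Suc.prems(1)] _ T]
  have "z differentiable_on {0..T}"
    unfolding differentiable_on_def using d(1) by (blast intro: differentiableI_vector)
  moreover have "C_k k T (deriv_on T z)"
    using Suc.prems(1) d(2) by (intro Suc.IH[of "time_deriv y"]) auto
  ultimately show ?case by simp
qed

context evolution_problem
begin

text \<open>The right-hand side that a change \<open>H\<close> of the parameter produces from a velocity \<open>v\<close>.\<close>

definition load :: "'a sa_op \<Rightarrow> (real \<Rightarrow> 'a) \<Rightarrow> real \<Rightarrow> 'a" where
  "load H v = (\<lambda>t. - blinfun_of H (v t))"

lemma causal_load: "0 \<le> T \<Longrightarrow> causal T k K v \<Longrightarrow> causal T k (norm H * K) (load H v)"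
  unfolding load_def using causal_uminus[OF causal_blinfun[of T k K v "blinfun_of H"]]
  by (simp add: norm_sa_op_eq)

lemma load_add: "load H (\<lambda>t. v t + w t) = (\<lambda>t. load H v t + load H w t)"
  by (auto simp: load_def blinfun.add_right)

lemma load_op_add: "load (H + H') v = (\<lambda>t. load H v t + load H' v t)"
  by (auto simp: load_def plus_sa_op.rep_eq blinfun.add_left)

lemma load_op_scale: "load (c *\<^sub>R H) v = (\<lambda>t. c *\<^sub>R load H v t)"
  by (auto simp: load_def scaleR_sa_op.rep_eq blinfun.scaleR_left)

lemma load_scale: "load H (\<lambda>t. c *\<^sub>R v t) = (\<lambda>t. c *\<^sub>R load H v t)"
  by (auto simp: load_def blinfun.scaleR_right)

lemma sol_add:
  assumes "B \<in> PD" "causal T j K h" "causal T k K' g"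
  shows "sol B (\<lambda>t. h t + g t) = (\<lambda>t. sol B h t + sol B g t)"
  using sol_lin(1)[OF assms(1) causal_continuous[OF assms(2)] causal_continuous[OF assms(3)]] by auto

lemma sol_scale:
  assumes "B \<in> PD" "causal T j K h"
  shows "sol B (\<lambda>t. c *\<^sub>R h t) = (\<lambda>t. c *\<^sub>R sol B h t)"
  using sol_lin(2)[OF assms(1) causal_continuous[OF assms(2)] causal_continuous[OF assms(2)]] by auto

lemma velocity_add:
  assumes "B \<in> PD" "causal T (Suc j) K h" "causal T (Suc k) K' g"
  shows "velocity B (\<lambda>t. h t + g t) = (\<lambda>t. velocity B h t + velocity B g t)"
  using velocity_lin(1)[OF assms(1) causal_le[OF assms(2)] causal_le[OF assms(3)]] by auto

lemma velocity_scale: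
  assumes "B \<in> PD" "causal T (Suc j) K h"
  shows "velocity B (\<lambda>t. c *\<^sub>R h t) = (\<lambda>t. c *\<^sub>R velocity B h t)"
  using velocity_lin(2)[OF assms(1) causal_le[OF assms(2)] causal_le[OF assms(2)]] by auto

lemma sol_change:
  assumes B: "B \<in> PD" and B': "B' \<in> PD" and T: "0 \<le> T" and h: "causal T (Suc (Suc 0)) K h"
  shows "sol B' h = (\<lambda>t. sol B h t + sol B (load (B' - B) (velocity B' h)) t)"
    and "velocity B' h = (\<lambda>t. velocity B h t + velocity B (load (B' - B) (velocity B' h)) t)"
proof -
  have L: "causal T (Suc 0) (norm (B' - B) * (vel_const T * K)) (load (B' - B) (velocity B' h))"
    by (intro causal_load T causal_velocity[OF B' T h])
  show "sol B' h = (\<lambda>t. sol B h t + sol B (load (B' - B) (velocity B' h)) t)"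
    using sol_perturbation[OF B B' T h] sol_add[OF B h L] by (simp add: load_def)
  show "velocity B' h = (\<lambda>t. velocity B h t + velocity B (load (B' - B) (velocity B' h)) t)"
    using velocity_perturbation[OF B B' T h] velocity_add[OF B h L] by (simp add: load_def)
qed

lemma classical_solution_sol:
  assumes B: "B \<in> PD" and T: "0 < T" and h: "causal T 0 K h" and s: "causal T (Suc 0) K' (sol B h)"
    and rhs: "\<And>t. t \<in> {0..T} \<Longrightarrow> r t = h t" and z: "\<And>t. t \<in> {0..T} \<Longrightarrow> z t = sol B h t"
  shows "classical_solution D A Q T B r 0 z"
proof -
  have s0: "time_deriv (sol B h) t = 0" if "t \<le> 0" for t using s that by (intro causal_zero[of T 0 K']) auto
  note eq = sol_equation_of_derivative[OF B h causal_derivative[OF s] s0]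
  have cont: "continuous_on {0..T} (sol B h)" "continuous_on {0..T} (time_deriv (sol B h))" "continuous_on {0..T} h"
    using causal_continuous[OF s] causal_continuous[of T 0 K' "time_deriv (sol B h)"] causal_continuous[OF h] s
    by (auto intro: continuous_on_subset)
  have Az: "A (sol B h t) = h t - blinfun_of B (time_deriv (sol B h) t) - blinfun_of B (Q (sol B h t))" for t
    using eq(2)[of t] by (simp add: algebra_simps)
  have "continuous_on {0..T} (\<lambda>t. (sol B h t, h t - blinfun_of B (time_deriv (sol B h) t) - blinfun_of B (Q (sol B h t))))"
    by (intro continuous_intros cont)
  then have "continuous_on {0..T} (\<lambda>t. (z t, A (z t)))"
    by (rule continuous_on_eq) (simp add: Az z)
  moreover have "C_k (Suc 0) T z" by (rule C_k_causal[OF T s z])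
  moreover have "z 0 = 0" using z[of 0] T by (simp add: sol_zero[OF B])
  moreover have "deriv_on T z t = time_deriv (sol B h) t" if "t \<in> {0..T}" for t
    using has_vector_derivative_on_interval(2)[OF z causal_derivative[OF s] that T] .
  ultimately show ?thesis
    using eq z rhs by (simp add: classical_solution_def)
qed

text \<open>By the equation, \<open>A\<close> applied to the solution equals \<open>h - B z' - B Q z\<close>, so it is as smooth as \<open>h\<close> and \<open>z'\<close>, and its derivative
  is \<open>A z'\<close> by the equation for \<open>z'\<close>.\<close>

lemma C_k_graph_sol:
  assumes B: "B \<in> PD" and T: "0 < T" and h: "causal T k K h" and s: "causal T (Suc k) K' (sol B h)"
    and z: "\<And>t. t \<in> {0..T} \<Longrightarrow> z t = sol B h t"
  shows "C_k_graph k D A T z"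
  using h s z
proof (induction k arbitrary: h z)
  case 0
  then show ?case
    using classical_solution_sol[OF B T 0(1,2) refl 0(3)] by (simp add: classical_solution_def)
next
  case (Suc k)
  have h1: "causal T (Suc 0) K h" using Suc.prems(1) by (rule causal_le) simp
  have dh: "causal T k K (time_deriv h)" using Suc.prems(1) by simp
  have dsol: "time_deriv (sol B h) = sol B (time_deriv h)" by (rule time_deriv_sol[OF B h1])
  have s': "causal T (Suc k) K' (sol B (time_deriv h))" using Suc.prems(2) by (simp add: dsol)
  have zd: "deriv_on T z t = sol B (time_deriv h) t" "(z has_vector_derivative sol B (time_deriv h) t) (at t within {0..T})"
    if "t \<in> {0..T}" for t
    using has_vector_derivative_on_interval[OF Suc.prems(3) causal_derivative[OF Suc.prems(2)] that T]
    by (simp_all add: dsol)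
  have eq1: "sol B h t \<in> D" "A (sol B h t) = h t - blinfun_of B (sol B (time_deriv h) t) - blinfun_of B (Q (sol B h t))" for t
    using sol_equation[OF B h1, of t] by (auto simp: dsol algebra_simps)
  have s1: "causal T (Suc 0) K' (sol B (time_deriv h))" using s' by (rule causal_le) simp
  have s0: "time_deriv (sol B (time_deriv h)) t = 0" if "t \<le> 0" for t using s1 that by (intro causal_zero[of T 0 K']) auto
  have eq2: "A (sol B (time_deriv h) t) = time_deriv h t - blinfun_of B (time_deriv (sol B (time_deriv h)) t) - blinfun_of B (Q (sol B (time_deriv h) t))" for t
    using sol_equation_of_derivative(2)[OF B causal_0[OF dh] causal_derivative[OF s1] s0, of t]
    by (simp add: algebra_simps)
  have "((\<lambda>s. (z s, A (z s))) has_vector_derivative (deriv_on T z t, A (deriv_on T z t))) (at t within {0..T})"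
    if t: "t \<in> {0..T}" for t
  proof -
    have "((\<lambda>s. h s - blinfun_of B (sol B (time_deriv h) s) - blinfun_of B (Q (sol B h s))) has_vector_derivative A (sol B (time_deriv h) t)) (at t)"
      unfolding eq2
      by (intro has_vector_derivative_diff bounded_linear.has_vector_derivative[OF blinfun.bounded_linear_right]
          causal_derivative[OF h1] causal_derivative[OF s1] sol_derivative[OF B h1])
    then have "((\<lambda>s. A (z s)) has_vector_derivative A (sol B (time_deriv h) t)) (at t within {0..T})"
      by (intro has_vector_derivative_on_interval(1)[OF _ _ t T, rotated]) (auto simp: Suc.prems(3) eq1(2))
    then show ?thesis
      using zd[OF t] by (simp add: has_vector_derivative_Pair)
  qed
  moreover have "C_k_graph k D A T (deriv_on T z)"
    by (rule Suc.IH[OF dh s' zd(1)])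
  ultimately show ?case using Suc.prems(3) eq1(1) by simp
qed

lemma classical_solution_unique:
  assumes B: "B \<in> PD" and T: "0 < T" and h: "causal T (Suc 0) K h"
    and rhs: "\<And>t. t \<in> {0..T} \<Longrightarrow> r t = h t"
    and z: "classical_solution D A Q T B r 0 z" and t: "t \<in> {0..T}"
  shows "z t = sol B h t"
proof (rule classical_unique[OF B, where h = h and \<tau> = T and z' = "deriv_on T z" and w' = "time_deriv (sol B h)"])
  show "continuous_on {0..T} (sol B h)"
    using sol_continuous[OF B causal_0[OF h]] by (rule continuous_on_subset) simp
  have diff: "z differentiable_on {0..T}" using z by (simp add: classical_solution_def)
  then show "continuous_on {0..T} z" by (rule differentiable_imp_continuous_on)
  show "z 0 = sol B h 0" using z by (simp add: classical_solution_def sol_zero[OF B])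
  fix s assume s: "0 < s" "s < T"
  have "(z has_vector_derivative deriv_on T z s) (at s within {0..T})"
    using diff s unfolding differentiable_on_def deriv_on_def
    by (intro vector_derivative_works[THEN iffD1]) auto
  then show "(z has_vector_derivative deriv_on T z s) (at s)"
    using s at_within_interior[of s "{0..T}"] by (simp add: interior_atLeastAtMost_real)
  show "z s \<in> D" using z s by (simp add: classical_solution_def)
  show "blinfun_of B (deriv_on T z s) + A (z s) + blinfun_of B (Q (z s)) = h s"
    using z rhs[of s] s by (simp add: classical_solution_def)
  show "(sol B h has_vector_derivative time_deriv (sol B h) s) (at s)"
    using sol_derivative[OF B h] unfolding time_deriv_sol[OF B h] .
  show "sol B h s \<in> D" "blinfun_of B (time_deriv (sol B h) s) + A (sol B h s) + blinfun_of B (Q (sol B h s)) = h s"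
    using sol_equation[OF B h] by auto
qed (use t in auto)

lemma gen_eta: "(\<lambda>x. - (inv (blinfun_of B) (A x) + Q x)) = gen B"
  by (auto simp: gen_def)

lemma mild_solution_iff:
  assumes B: "B \<in> PD" and h: "continuous_on UNIV h" and rhs: "\<And>t. t \<in> {0..T} \<Longrightarrow> r t = h t"
  shows "mild_solution D A Q T B r 0 z \<longleftrightarrow> (\<forall>t\<in>{0..T}. z t = sol B h t)"
proof -
  let ?G = "dissipative.propagator D (gen B) \<omega>"
  have L1: "L1_on T r"
  proof (rule L1_on_continuous)
    have "continuous_on {0..T} h" using h by (rule continuous_on_subset) simp
    then show "continuous_on {0..T} r" by (rule continuous_on_eq) (use rhs in auto)
  qed
  have int: "integral {0..t} (\<lambda>s. S (t - s) (inv (blinfun_of B) (r s))) = sol B h t"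
    if S: "\<And>t. 0 \<le> t \<Longrightarrow> S t = ?G t" and t: "t \<in> {0..T}" for S t
  proof -
    have "integral {0..t} (\<lambda>s. S (t - s) (inv (blinfun_of B) (r s)))
        = integral {0..t} (\<lambda>s. ?G (t - s) (Binv B (h s)))"
      by (rule integral_cong) (use S t rhs in \<open>auto simp: Binv_apply[OF B]\<close>)
    then show ?thesis by (simp add: sol_def dissipative.duhamel_def[OF dissipative[OF B]])
  qed
  have uniq: "S t = ?G t" if "generates D (gen B) S" "0 \<le> t" for S t
    by (rule dissipative.generates_unique[OF dissipative[OF B] that])
  show ?thesis
    unfolding mild_solution_def gen_eta
  proof (intro iffI conjI L1)
    assume "L1_on T r \<and> (\<exists>S. generates D (gen B) S \<and>
        (\<forall>t\<in>{0..T}. z t = S t 0 + integral {0..t} (\<lambda>s. S (t - s) (inv (blinfun_of B) (r s)))))"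
    then obtain S where S: "generates D (gen B) S"
      and z: "\<And>t. t \<in> {0..T} \<Longrightarrow> z t = S t 0 + integral {0..t} (\<lambda>s. S (t - s) (inv (blinfun_of B) (r s)))"
      by blast
    show "\<forall>t\<in>{0..T}. z t = sol B h t"
      using z int[OF uniq[OF S]] by (simp add: blinfun.zero_right)
  next
    assume "\<forall>t\<in>{0..T}. z t = sol B h t"
    then show "\<exists>S. generates D (gen B) S \<and>
        (\<forall>t\<in>{0..T}. z t = S t 0 + integral {0..t} (\<lambda>s. S (t - s) (inv (blinfun_of B) (r s))))"
      using dissipative.generates_propagator[OF dissipative[OF B]] int[of ?G]
      by (intro exI[of _ ?G]) (simp add: blinfun.zero_right)
  qed
qed

lemma param_to_solution_eq:
  assumes B: "B \<in> PD" and T: "0 \<le> T" and h: "causal T 0 K h" and rhs: "\<And>t. t \<in> {0..T} \<Longrightarrow> r t = h t"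
  shows "param_to_solution D A Q T r 0 B = on_interval T (sol B h)"
  unfolding param_to_solution_def
proof (rule the_equality)
  have mild: "mild_solution D A Q T B r 0 z \<longleftrightarrow> (\<forall>t\<in>{0..T}. z t = sol B h t)" for z
    by (rule mild_solution_iff[OF B causal_continuous[OF h] rhs])
  have c: "continuous_on UNIV (sol B h)" by (rule sol_continuous[OF B h])
  show "on_interval T (sol B h) \<in> C_interval T \<and> mild_solution D A Q T B r 0 (apply_bcontfun (on_interval T (sol B h)))"
    using on_interval_mem[OF c T] by (simp add: mild on_interval_apply[OF c] clamp_id)
  fix u assume u: "u \<in> C_interval T \<and> mild_solution D A Q T B r 0 (apply_bcontfun u)"
  show "u = on_interval T (sol B h)"
  proof (rule bcontfun_eqI)
    fix t
    have "apply_bcontfun u t = apply_bcontfun u (clamp 0 T t)" using u by (simp add: C_interval_def)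
    also have "\<dots> = sol B h (clamp 0 T t)" using u clamp_mem[OF T] by (simp add: mild)
    finally show "apply_bcontfun u t = apply_bcontfun (on_interval T (sol B h)) t"
      by (simp add: on_interval_apply[OF c])
  qed
qed

end

section \<open>Taylor expansion of the solution map\<close>

text \<open>The function \<open>\<phi>\<close> is the causal extension of the right-hand side. The assumption on the velocity is one order better than
  \<open>causal_velocity\<close> gives for a right-hand side of class \<open>C\<^sup>2\<close>, and is uniform in the parameter. This is where the
  third derivative of the right-hand side enters.\<close>

locale regular_problem = evolution_problem D A Q bmin bmax
  for D :: "'a::{real_inner,banach} set" and A Q bmin bmax +
  fixes T :: real and \<phi> :: "real \<Rightarrow> 'a" and K V :: real
  assumes T: "0 < T" and \<phi>: "causal T 2 K \<phi>"
    and V: "\<And>B. B \<in> PD \<Longrightarrow> causal T 2 V (velocity B \<phi>)"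
begin

lemma T0: "0 \<le> T" using T by simp

lemma \<phi>': "causal T (Suc (Suc 0)) K \<phi>"
  using \<phi> by (simp only: numeral_2_eq_2)

abbreviation v :: "'a sa_op \<Rightarrow> real \<Rightarrow> 'a" where "v B \<equiv> velocity B \<phi>"

lemma v: "B \<in> PD \<Longrightarrow> causal T (Suc (Suc 0)) V (v B)"
  using V by (simp only: numeral_2_eq_2)

lemma load_v: "B \<in> PD \<Longrightarrow> causal T (Suc (Suc 0)) (norm H * V) (load H (v B))"
  by (intro causal_load T0 v)

lemma velocity_load_v: "B \<in> PD \<Longrightarrow> B' \<in> PD \<Longrightarrow> causal T (Suc 0) (vel_const T * (norm H * V)) (velocity B (load H (v B')))"
  by (intro causal_velocity T0 load_v)

text \<open>The right-hand side of the equation for the second derivative in the directions \<open>H1\<close>, \<open>H2\<close>.\<close>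

definition rhs2 :: "'a sa_op \<Rightarrow> 'a sa_op \<Rightarrow> 'a sa_op \<Rightarrow> real \<Rightarrow> 'a" where
  "rhs2 B H1 H2 = (\<lambda>t. load H1 (velocity B (load H2 (v B))) t + load H2 (velocity B (load H1 (v B))) t)"

lemma rhs2:
  assumes B: "B \<in> PD"
  shows "causal T (Suc 0) (2 * vel_const T * V * norm H1 * norm H2) (rhs2 B H1 H2)"
proof -
  have "causal T (Suc 0) (norm H1 * (vel_const T * (norm H2 * V)) + norm H2 * (vel_const T * (norm H1 * V))) (rhs2 B H1 H2)"
    unfolding rhs2_def by (intro causal_add causal_load T0 velocity_load_v B)
  then show ?thesis by (simp add: mult_ac)
qed

definition F1 :: "'a sa_op \<Rightarrow> 'a sa_op \<Rightarrow>\<^sub>L (real \<Rightarrow>\<^sub>C 'a)" where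
  "F1 B = Blinfun (\<lambda>H. on_interval T (sol B (load H (v B))))"

definition F2 :: "'a sa_op \<Rightarrow> 'a sa_op \<Rightarrow>\<^sub>L 'a sa_op \<Rightarrow>\<^sub>L (real \<Rightarrow>\<^sub>C 'a)" where
  "F2 B = Blinfun (\<lambda>H1. Blinfun (\<lambda>H2. on_interval T (sol B (rhs2 B H1 H2))))"

lemma sol_cont: "B \<in> PD \<Longrightarrow> causal T k c h \<Longrightarrow> continuous_on UNIV (sol B h)"
  by (rule sol_continuous[OF _ causal_0])

lemma sol_est:
  assumes "B \<in> PD" "causal T k c h"
  shows "norm (on_interval T (sol B h)) \<le> sol_const T * c"
  by (rule on_interval_norm[OF causal_sol[OF assms(1) T0 assms(2)] T0])

lemma F1_apply:
  assumes B: "B \<in> PD"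
  shows "F1 B H = on_interval T (sol B (load H (v B)))"
proof -
  have "bounded_linear (\<lambda>H. on_interval T (sol B (load H (v B))))"
  proof (rule bounded_linear_intro)
    show "on_interval T (sol B (load (H + H') (v B)))
        = on_interval T (sol B (load H (v B))) + on_interval T (sol B (load H' (v B)))" for H H'
      by (rule bcontfun_eqI)
        (simp add: load_op_add sol_add[OF B load_v[OF B] load_v[OF B]] plus_bcontfun.rep_eq
          on_interval_apply sol_cont[OF B load_v[OF B]] continuous_on_add)
    show "on_interval T (sol B (load (c *\<^sub>R H) (v B))) = c *\<^sub>R on_interval T (sol B (load H (v B)))" for c H
      by (rule bcontfun_eqI)
        (simp add: load_op_scale sol_scale[OF B load_v[OF B]] scaleR_bcontfun.rep_eq
          on_interval_apply sol_cont[OF B load_v[OF B]] continuous_on_scaleR)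
    show "norm (on_interval T (sol B (load H (v B)))) \<le> norm H * (sol_const T * V)" for H
      using sol_est[OF B load_v[OF B, of H]] by (simp add: mult_ac)
  qed
  then show ?thesis by (simp add: F1_def bounded_linear_Blinfun_apply)
qed

lemma rhs2_lin:
  assumes B: "B \<in> PD"
  shows "rhs2 B (H + H') G = (\<lambda>t. rhs2 B H G t + rhs2 B H' G t)" "rhs2 B (c *\<^sub>R H) G = (\<lambda>t. c *\<^sub>R rhs2 B H G t)"
    and "rhs2 B H G = rhs2 B G H"
  by (auto simp: rhs2_def load_op_add load_op_scale velocity_add[OF B load_v[OF B] load_v[OF B]]
      velocity_scale[OF B load_v[OF B]] load_add load_scale algebra_simps)

lemma F2_apply:
  assumes B: "B \<in> PD"
  shows "F2 B H1 H2 = on_interval T (sol B (rhs2 B H1 H2))"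
proof -
  let ?f = "\<lambda>H1 H2. on_interval T (sol B (rhs2 B H1 H2))"
  have sym: "?f H1 H2 = ?f H2 H1" for H1 H2 by (simp only: rhs2_lin(3)[OF B, of H1 H2])
  have add: "?f (H + H') G = ?f H G + ?f H' G" for H H' G
    by (rule bcontfun_eqI)
      (simp add: rhs2_lin(1)[OF B] sol_add[OF B rhs2[OF B] rhs2[OF B]] plus_bcontfun.rep_eq
        on_interval_apply sol_cont[OF B rhs2[OF B]] continuous_on_add)
  have scale: "?f (c *\<^sub>R H) G = c *\<^sub>R ?f H G" for c H G
    by (rule bcontfun_eqI)
      (simp add: rhs2_lin(2)[OF B] sol_scale[OF B rhs2[OF B]] scaleR_bcontfun.rep_eq
        on_interval_apply sol_cont[OF B rhs2[OF B]] continuous_on_scaleR)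
  let ?C = "sol_const T * (2 * vel_const T * V)"
  have bound: "norm (?f H G) \<le> norm G * (?C * norm H)" for H G
    using sol_est[OF B rhs2[OF B, of H G]] by (simp add: mult_ac)
  have lin2: "bounded_linear (?f H)" for H
  proof (rule bounded_linear_intro)
    show "?f H (G + G') = ?f H G + ?f H G'" for G G' using add[of G G' H] by (simp only: sym[of H])
    show "?f H (c *\<^sub>R G) = c *\<^sub>R ?f H G" for c G using scale[of c G H] by (simp only: sym[of H])
  qed (rule bound)
  define f2 where "f2 H = Blinfun (?f H)" for H
  have f2: "f2 H G = ?f H G" for H G
    by (simp add: f2_def bounded_linear_Blinfun_apply[OF lin2])
  have "bounded_linear f2"
  proof (rule bounded_linear_intro)
    show "f2 (H + H') = f2 H + f2 H'" for H H'
      by (rule blinfun_eqI) (simp add: f2 blinfun.add_left add)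
    show "f2 (c *\<^sub>R H) = c *\<^sub>R f2 H" for c H
      by (rule blinfun_eqI) (simp add: f2 blinfun.scaleR_left scale)
    have V0: "0 \<le> V" using causal_K_nonneg[OF v[OF B] T0] .
    show "norm (f2 H) \<le> norm H * ?C" for H
    proof (rule norm_blinfun_bound)
      show "0 \<le> norm H * ?C" using sol_const_nonneg[OF T0] vel_const_nonneg[OF T0] V0 by simp
      show "norm (f2 H G) \<le> norm H * ?C * norm G" for G
        using bound[of H G] by (simp add: f2 mult_ac)
    qed
  qed
  then show ?thesis
    using f2[of H1 H2] by (simp add: F2_def bounded_linear_Blinfun_apply f2_def[symmetric])
qed

text \<open>The velocities for \<open>B'\<close> and \<open>B\<close> differ by \<open>e\<close>, which is linear in \<open>B' - B\<close> up to higher order. The remainder is the solution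
  for the right-hand side \<open>load (B' - B) e\<close>.\<close>

lemma first_remainder:
  assumes B: "B \<in> PD" and B': "B' \<in> PD"
  shows "norm (on_interval T (sol B' \<phi>) - on_interval T (sol B \<phi>) - F1 B (B' - B))
      \<le> sol_const T * vel_const T * V * (norm (B' - B))\<^sup>2"
proof -
  let ?H = "B' - B"
  define e where "e = velocity B (load ?H (v B'))"
  have e: "causal T (Suc 0) (vel_const T * (norm ?H * V)) e"
    unfolding e_def by (rule velocity_load_v[OF B B'])
  have v': "v B' = (\<lambda>t. v B t + e t)"
    unfolding e_def by (rule sol_change(2)[OF B B' T0 \<phi>'])
  have Le: "causal T (Suc 0) (norm ?H * (vel_const T * (norm ?H * V))) (load ?H e)"
    by (rule causal_load[OF T0 e])
  have "sol B' \<phi> = (\<lambda>t. sol B \<phi> t + sol B (load ?H (v B')) t)"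
    by (rule sol_change(1)[OF B B' T0 \<phi>'])
  also have "\<dots> = (\<lambda>t. sol B \<phi> t + (sol B (load ?H (v B)) t + sol B (load ?H e) t))"
    unfolding v' load_add sol_add[OF B load_v[OF B] Le] ..
  finally have "sol B' \<phi> t = sol B \<phi> t + (sol B (load ?H (v B)) t + sol B (load ?H e) t)" for t
    by (rule fun_cong)
  then have "on_interval T (sol B' \<phi>) - on_interval T (sol B \<phi>) - F1 B ?H = on_interval T (sol B (load ?H e))"
    by (intro bcontfun_eqI)
      (simp add: F1_apply[OF B] minus_bcontfun.rep_eq on_interval_apply[OF sol_cont[OF B \<phi>']]
        on_interval_apply[OF sol_cont[OF B' \<phi>']] on_interval_apply[OF sol_cont[OF B load_v[OF B]]]
        on_interval_apply[OF sol_cont[OF B Le]])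
  then show ?thesis
    using sol_est[OF B Le] by (simp add: power2_eq_square mult_ac)
qed

text \<open>With \<open>H = B' - B\<close>, the first derivative at \<open>B'\<close> in the direction \<open>G\<close> is the solution for the parameter \<open>B'\<close> and the right-hand side
  \<open>load G (v B')\<close>. Both the parameter and this right-hand side are expanded around \<open>B\<close>. The terms of first order in \<open>H\<close> form \<open>F2 B H G\<close>, and
  the right-hand sides \<open>r1\<close>, \<open>r2\<close>, \<open>r3\<close> collect the terms in which \<open>H\<close> occurs twice and \<open>G\<close> once.\<close>

lemma second_remainder:
  assumes B: "B \<in> PD" and B': "B' \<in> PD"
  shows "norm (F1 B' G - F1 B G - F2 B (B' - B) G)
      \<le> 3 * sol_const T * (vel_const T)\<^sup>2 * V * (norm (B' - B))\<^sup>2 * norm G"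
proof -
  let ?H = "B' - B" and ?c = "vel_const T"
  define e where "e = velocity B (load ?H (v B'))"
  define w where "w = velocity B (load G (v B))"
  define w' where "w' = velocity B' (load G (v B'))"
  have e: "causal T (Suc 0) (?c * (norm ?H * V)) e"
    unfolding e_def by (rule velocity_load_v[OF B B'])
  have w: "causal T (Suc 0) (?c * (norm G * V)) w"
    unfolding w_def by (rule velocity_load_v[OF B B])
  have w': "causal T (Suc 0) (?c * (norm G * V)) w'"
    unfolding w'_def by (rule velocity_load_v[OF B' B'])
  have He: "causal T (Suc 0) (norm ?H * (?c * (norm ?H * V))) (load ?H e)"
    and Ge: "causal T (Suc 0) (norm G * (?c * (norm ?H * V))) (load G e)"
    and Hw: "causal T (Suc 0) (norm ?H * (?c * (norm G * V))) (load ?H w)"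
    and Hw': "causal T (Suc 0) (norm ?H * (?c * (norm G * V))) (load ?H w')"
    by (intro causal_load T0 e w w')+
  define r1 where "r1 = load G (velocity B (load ?H e))"
  define r2 where "r2 = load ?H (velocity B (load G e))"
  define r3 where "r3 = load ?H (velocity B (load ?H w'))"
  let ?r = "?c\<^sup>2 * V * (norm ?H)\<^sup>2 * norm G"
  have "causal T 0 (norm G * (?c * (norm ?H * (?c * (norm ?H * V))))) r1"
    unfolding r1_def by (intro causal_load T0 causal_velocity[OF B T0 He])
  then have r1: "causal T 0 ?r r1" by (simp only: power2_eq_square mult_ac)
  have "causal T 0 (norm ?H * (?c * (norm G * (?c * (norm ?H * V))))) r2"
    unfolding r2_def by (intro causal_load T0 causal_velocity[OF B T0 Ge])
  then have r2: "causal T 0 ?r r2" by (simp only: power2_eq_square mult_ac)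
  have "causal T 0 (norm ?H * (?c * (norm ?H * (?c * (norm G * V))))) r3"
    unfolding r3_def by (intro causal_load T0 causal_velocity[OF B T0 Hw'])
  then have r3: "causal T 0 ?r r3" by (simp only: power2_eq_square mult_ac)
  have v': "v B' = (\<lambda>t. v B t + e t)"
    unfolding e_def by (rule sol_change(2)[OF B B' T0 \<phi>'])
  have Gv': "load G (v B') = (\<lambda>t. load G (v B) t + load G e t)"
    unfolding v' by (rule load_add)
  have "e = velocity B (\<lambda>t. load ?H (v B) t + load ?H e t)"
    using e_def unfolding v' load_add .
  then have e_exp: "e = (\<lambda>t. velocity B (load ?H (v B)) t + velocity B (load ?H e) t)"
    unfolding velocity_add[OF B load_v[OF B] He] .
  have w'_exp: "w' = (\<lambda>t. w t + velocity B (load G e) t + velocity B (load ?H w') t)"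
    using sol_change(2)[OF B B' T0 load_v[OF B', of G]]
    unfolding w'_def[symmetric] by (simp add: Gv' velocity_add[OF B load_v[OF B] Ge] w_def)
  have "sol B' (load G (v B')) = (\<lambda>t. sol B (load G (v B')) t + sol B (load ?H w') t)"
    unfolding w'_def by (rule sol_change(1)[OF B B' T0 load_v[OF B']])
  moreover have "sol B (load G (v B')) = (\<lambda>t. sol B (load G (v B)) t + sol B (load G e) t)"
    unfolding Gv' by (rule sol_add[OF B load_v[OF B] Ge])
  moreover have "sol B (load G e) = (\<lambda>t. sol B (load G (velocity B (load ?H (v B)))) t + sol B r1 t)"
  proof -
    have "load G e = (\<lambda>t. load G (velocity B (load ?H (v B))) t + r1 t)"
      using arg_cong[OF e_exp, of "load G"] unfolding load_add r1_def .
    then show ?thesis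
      using sol_add[OF B causal_load[OF T0 velocity_load_v[OF B B]] r1] by simp
  qed
  moreover have "sol B (load ?H w') = (\<lambda>t. sol B (load ?H w) t + sol B r2 t + sol B r3 t)"
  proof -
    have "load ?H w' = (\<lambda>t. load ?H w t + r2 t + r3 t)"
      using arg_cong[OF w'_exp, of "load ?H"] unfolding load_add r2_def r3_def .
    then show ?thesis
      using sol_add[OF B causal_add[OF causal_0[OF Hw] r2] r3] sol_add[OF B causal_0[OF Hw] r2] by simp
  qed
  moreover have "sol B (rhs2 B ?H G) = (\<lambda>t. sol B (load ?H w) t + sol B (load G (velocity B (load ?H (v B)))) t)"
    unfolding rhs2_def w_def[symmetric]
    by (rule sol_add[OF B Hw causal_load[OF T0 velocity_load_v[OF B B]]])
  ultimately have exp: "sol B' (load G (v B')) t = sol B (load G (v B)) t + sol B (rhs2 B ?H G) t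
      + (sol B r1 t + sol B r2 t + sol B r3 t)" for t
    by (auto simp: algebra_simps)
  have "F1 B' G - F1 B G - F2 B ?H G
      = on_interval T (sol B r1) + on_interval T (sol B r2) + on_interval T (sol B r3)"
    by (rule bcontfun_eqI)
      (simp add: F1_apply[OF B] F1_apply[OF B'] F2_apply[OF B] minus_bcontfun.rep_eq plus_bcontfun.rep_eq
        on_interval_apply[OF sol_cont[OF B load_v[OF B]]] on_interval_apply[OF sol_cont[OF B' load_v[OF B']]]
        on_interval_apply[OF sol_cont[OF B rhs2[OF B]]] on_interval_apply[OF sol_cont[OF B r1]]
        on_interval_apply[OF sol_cont[OF B r2]] on_interval_apply[OF sol_cont[OF B r3]] exp)
  also have "norm \<dots> \<le> sol_const T * ?r + sol_const T * ?r + sol_const T * ?r"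
    by (intro norm_triangle_mono sol_est[OF B r1] sol_est[OF B r2] sol_est[OF B r3])
  finally show ?thesis by (simp add: algebra_simps)
qed

lemma first_derivative:
  assumes B: "B \<in> interior PD" and F: "\<And>B. B \<in> PD \<Longrightarrow> F B = on_interval T (sol B \<phi>)"
  shows "(F has_derivative F1 B) (at B)"
proof -
  obtain d where d: "0 < d" "ball B d \<subseteq> PD" using B mem_interior by blast
  have BP: "B \<in> PD" using B interior_subset by blast
  show ?thesis
  proof (rule has_derivative_of_quadratic_remainder[OF blinfun.bounded_linear_right d(1)])
    fix B' assume "dist B' B < d"
    then have "B' \<in> PD" using d(2) by (auto simp: dist_commute)
    then show "norm (F B' - F B - F1 B (B' - B)) \<le> sol_const T * vel_const T * V * (norm (B' - B))\<^sup>2"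
      using first_remainder[OF BP] by (simp add: F BP)
  qed
qed

lemma second_derivative:
  assumes B: "B \<in> interior PD"
  shows "(F1 has_derivative F2 B) (at B)"
proof -
  obtain d where d: "0 < d" "ball B d \<subseteq> PD" using B mem_interior by blast
  have BP: "B \<in> PD" using B interior_subset by blast
  have V0: "0 \<le> V" using causal_K_nonneg[OF v[OF BP] T0] .
  show ?thesis
  proof (rule has_derivative_of_quadratic_remainder[OF blinfun.bounded_linear_right d(1)])
    fix B' assume "dist B' B < d"
    then have B': "B' \<in> PD" using d(2) by (auto simp: dist_commute)
    show "norm (F1 B' - F1 B - F2 B (B' - B)) \<le> 3 * sol_const T * (vel_const T)\<^sup>2 * V * (norm (B' - B))\<^sup>2"
    proof (rule norm_blinfun_bound)
      show "0 \<le> 3 * sol_const T * (vel_const T)\<^sup>2 * V * (norm (B' - B))\<^sup>2"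
        using sol_const_nonneg[OF T0] V0 by simp
      show "norm ((F1 B' - F1 B - F2 B (B' - B)) G)
          \<le> 3 * sol_const T * (vel_const T)\<^sup>2 * V * (norm (B' - B))\<^sup>2 * norm G" for G
        using second_remainder[OF BP B', of G] by (simp add: blinfun.diff_left)
    qed
  qed
qed

end

theorem theorem3p5:
  fixes D :: "('a::{real_inner,banach}) set"
    and A :: "'a \<Rightarrow> 'a"
    and Q :: "'a \<Rightarrow>\<^sub>L 'a"
    and T bmin bmax :: real
    and f :: "real \<Rightarrow> 'a"
    and B :: "'a sa_op"
  assumes "0 < T"
    and "0 < bmin" and "bmin < bmax"
    and "maximal_monotone D A"
    and "W_k1 3 T f"
    and "f 0 = 0" and "deriv_on T f 0 = 0" and "deriv_on T (deriv_on T f) 0 = 0"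
    and "B \<in> interior (param_domain bmin bmax)"
  defines "F \<equiv> param_to_solution D A Q T f 0"
  defines "u \<equiv> apply_bcontfun (F B)"
  defines "rhs \<equiv> \<lambda>(H :: 'a sa_op) v t. - blinfun_of H (deriv_on T v t + Q (v t))"
  shows "F B \<in> C_interval T
    \<and> mild_solution D A Q T B f 0 u
    \<and> classical_solution D A Q T B f 0 u
    \<and> C_k 3 T u
    \<and> C_k_graph 2 D A T u
    \<and> (\<forall>H. \<exists>v. classical_solution D A Q T B (rhs H u) 0 v)
    \<and> (\<forall>H v. classical_solution D A Q T B (rhs H u) 0 v
           \<longrightarrow> C_k 2 T v \<and> C_k_graph 1 D A T v)
    \<and> (\<exists>F2 :: 'a sa_op \<Rightarrow>\<^sub>L 'a sa_op \<Rightarrow>\<^sub>L (real \<Rightarrow>\<^sub>C 'a).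
           has_second_derivative F F2 B
           \<and> (\<forall>H1 H2 u1 u2.
                classical_solution D A Q T B (rhs H1 u) 0 u1
                \<longrightarrow> classical_solution D A Q T B (rhs H2 u) 0 u2
                \<longrightarrow> F2 H1 H2 \<in> C_interval T
                  \<and> mild_solution D A Q T B (\<lambda>t. rhs H1 u2 t + rhs H2 u1 t) 0
                      (apply_bcontfun (F2 H1 H2))
                  \<and> classical_solution D A Q T B (\<lambda>t. rhs H1 u2 t + rhs H2 u1 t) 0
                      (apply_bcontfun (F2 H1 H2))))"
proof -
  note T = \<open>0 < T\<close>
  interpret evolution_problem D A Q bmin bmax
    using assms(2-4) by unfold_locales auto
  obtain \<phi> K K' where \<phi>_f: "\<And>t. t \<in> {0..T} \<Longrightarrow> \<phi> t = f t" and \<phi>: "causal T 2 K \<phi>"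
    and K': "\<And>B. B \<in> PD \<Longrightarrow> causal T 3 K' (sol B \<phi>)"
    by (rule W31_data[OF T assms(5-8)]) blast
  have sol3: "causal T (Suc (Suc (Suc 0))) K' (sol B \<phi>)" if "B \<in> PD" for B
    using K'[OF that] by (simp only: numeral_3_eq_3)
  interpret regular_problem D A Q bmin bmax T \<phi> K "K' + norm Q * K'"
  proof
    show "causal T 2 (K' + norm Q * K') (velocity B \<phi>)" if "B \<in> PD" for B
    proof -
      have "causal T (Suc (Suc 0)) (K' + norm Q * K') (\<lambda>t. time_deriv (sol B \<phi>) t + Q (sol B \<phi> t))"
        using sol3[OF that] causal_lower[OF sol3[OF that]] T by (intro causal_add causal_blinfun) auto
      then show ?thesis by (simp only: numeral_2_eq_2 velocity_def[abs_def])
    qed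
  qed (fact T \<phi>)+
  have BP: "B \<in> PD" using assms(9) interior_subset by blast
  have F_eq: "F B = on_interval T (sol B \<phi>)" if "B \<in> PD" for B
    unfolding F_def by (rule param_to_solution_eq[OF that T0 causal_0[OF \<phi>]]) (simp add: \<phi>_f)
  have s3: "causal T (Suc (Suc (Suc 0))) K' (sol B \<phi>)" by (rule sol3[OF BP])
  have s1: "causal T (Suc 0) K' (sol B \<phi>)" using s3 by (rule causal_le) simp
  have u_eq: "u t = sol B \<phi> t" if "t \<in> {0..T}" for t
    by (simp add: u_def F_eq[OF BP] on_interval_apply[OF sol_cont[OF BP \<phi>']] clamp_id[OF that])
  have rhs_eq: "rhs H z t = load H (velocity B h) t"
    if z: "\<And>t. t \<in> {0..T} \<Longrightarrow> z t = sol B h t" and h: "causal T (Suc 0) c (sol B h)" and t: "t \<in> {0..T}"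
    for H z h c t
    using has_vector_derivative_on_interval(2)[OF z causal_derivative[OF h] t T] z[OF t]
    by (simp add: rhs_def load_def velocity_def)
  note rhs_u = rhs_eq[OF u_eq s1]
  have load_sol: "causal T (Suc (Suc 0)) (sol_const T * (norm H * (K' + norm Q * K'))) (sol B (load H (v B)))" for H
    by (rule causal_sol[OF BP T0 load_v[OF BP]])
  have load_sol1: "causal T (Suc 0) (sol_const T * (norm H * (K' + norm Q * K'))) (sol B (load H (v B)))" for H
    using load_sol by (rule causal_lower)
  have part1: "F B \<in> C_interval T"
    unfolding F_eq[OF BP] by (rule on_interval_mem[OF sol_cont[OF BP \<phi>'] T0])
  have part2: "mild_solution D A Q T B f 0 u"
    using mild_solution_iff[OF BP causal_continuous[OF \<phi>], of T f u] \<phi>_f u_eq by auto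
  have part3: "classical_solution D A Q T B f 0 u"
    by (rule classical_solution_sol[OF BP T causal_0[OF \<phi>] s1 _ u_eq]) (simp add: \<phi>_f)
  have part4: "C_k 3 T u" by (rule C_k_causal[OF T K'[OF BP] u_eq])
  have part5: "C_k_graph 2 D A T u"
    using C_k_graph_sol[OF BP T \<phi>' s3 u_eq] by (simp only: numeral_2_eq_2)
  have part6: "\<exists>v. classical_solution D A Q T B (rhs H u) 0 v" for H
    using classical_solution_sol[OF BP T causal_0[OF load_v[OF BP]] load_sol1 rhs_u refl] by blast
  have linear_eq: "z t = sol B (load H (v B)) t"
    if "classical_solution D A Q T B (rhs H u) 0 z" "t \<in> {0..T}" for H z t
    by (rule classical_solution_unique[OF BP T causal_lower[OF load_v[OF BP]] rhs_u that])
  have part7: "C_k 2 T z \<and> C_k_graph 1 D A T z"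
    if z: "classical_solution D A Q T B (rhs H u) 0 z" for H z
  proof
    show "C_k 2 T z"
      using C_k_causal[OF T load_sol linear_eq[OF z]] by (simp only: numeral_2_eq_2)
    show "C_k_graph 1 D A T z"
      using C_k_graph_sol[OF BP T causal_lower[OF load_v[OF BP]] load_sol linear_eq[OF z]] by simp
  qed
  have second: "has_second_derivative F (F2 B) B"
    unfolding has_second_derivative_def
  proof (intro exI[of _ F1] conjI)
    have "\<forall>\<^sub>F B' in nhds B. B' \<in> interior PD"
      using assms(9) by (intro eventually_nhds_in_open) auto
    then show "\<forall>\<^sub>F B' in nhds B. (F has_derivative F1 B') (at B')"
      by eventually_elim (rule first_derivative[OF _ F_eq])
    show "(F1 has_derivative F2 B) (at B)" by (rule second_derivative[OF assms(9)])
  qed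
  have part8: "F2 B H1 H2 \<in> C_interval T
      \<and> mild_solution D A Q T B (\<lambda>t. rhs H1 u2 t + rhs H2 u1 t) 0 (apply_bcontfun (F2 B H1 H2))
      \<and> classical_solution D A Q T B (\<lambda>t. rhs H1 u2 t + rhs H2 u1 t) 0 (apply_bcontfun (F2 B H1 H2))"
    if u1: "classical_solution D A Q T B (rhs H1 u) 0 u1" and u2: "classical_solution D A Q T B (rhs H2 u) 0 u2"
    for H1 H2 u1 u2
  proof -
    have r: "rhs H1 u2 t + rhs H2 u1 t = rhs2 B H1 H2 t" if "t \<in> {0..T}" for t
      using rhs_eq[OF linear_eq[OF u2] load_sol1 that] rhs_eq[OF linear_eq[OF u1] load_sol1 that]
      by (simp add: rhs2_def)
    have z: "apply_bcontfun (F2 B H1 H2) t = sol B (rhs2 B H1 H2) t" if "t \<in> {0..T}" for t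
      by (simp add: F2_apply[OF BP] on_interval_apply[OF sol_cont[OF BP rhs2[OF BP]]] clamp_id[OF that])
    show ?thesis
    proof (intro conjI)
      show "F2 B H1 H2 \<in> C_interval T"
        unfolding F2_apply[OF BP] by (rule on_interval_mem[OF sol_cont[OF BP rhs2[OF BP]] T0])
      show "mild_solution D A Q T B (\<lambda>t. rhs H1 u2 t + rhs H2 u1 t) 0 (apply_bcontfun (F2 B H1 H2))"
        using mild_solution_iff[OF BP causal_continuous[OF rhs2[OF BP]] r] z by blast
      show "classical_solution D A Q T B (\<lambda>t. rhs H1 u2 t + rhs H2 u1 t) 0 (apply_bcontfun (F2 B H1 H2))"
        by (rule classical_solution_sol[OF BP T causal_0[OF rhs2[OF BP]] causal_sol[OF BP T0 rhs2[OF BP]] r z])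
    qed
  qed
  from part1 part2 part3 part4 part5 part6 part7 second part8 show ?thesis by blast
qed

end
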